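(* Let $A,B$ be multirings. (i) If $f\colon A\to B$ is a multiring morphism, then there exists a unique multiring morphism $V(f)\colon V(A)\to V(B)$ such that $V(f)\circ v_A=v_B\circ f$. Furthermore, $V\colon\mathbf{Multi}\to\mathbf{GvNH}$ is a functor. (ii) If $f\colon A\to B$ is a multiring morphism and $B$ is a geometric von Neumann hyperring, then there exists a unique multiring morphism $\overline f\colon V(A)\to B$ such that $\overline f\circ v_A=f$. In other words, the functor $V\colon\mathbf{Multi}\to\mathbf{GvNH}$ is left adjoint to the inclusion functor $\mathbf{GvNH}\to\mathbf{Multi}$.
   Context: A multiring is a tuple $(A,+,-,\cdot,0,1)$ where $(A,\cdot,1)$ is a commutative monoid, $+\colon A\times A\to\{\text{nonempty subsets of }A\}$ and $-\colon A\to A$ are functions and $0\in A$, such that for all $a,b,c,d\in A$: (1) $a\in b+c$ implies $c\in -b+a$ and $b\in a+(-c)$; (2) $a\in b+0$ iff $a=b$; (3) if $x\in g+c$ with $g\in a+b$, then there is $h\in b+c$ with $x\in a+h$; (4) $a+b=b+a$; (5) $a\cdot 0=0$; (6) $a\in b+c$ implies $ad\in bd+cd$. Sums of subsets are unions of elementwise sums. A hyperring is a multiring such that $x\in bd+cd$ implies $x=ad$ for some $a\in b+c$. A morphism of multirings $f$ satisfies $f(a)\in f(b)+f(c)$ whenever $a\in b+c$, and preserves $\cdot,-,0,1$. $\mathbf{Multi}$ is the category of multirings. An ideal is a nonempty $\alpha\subseteq A$ with $\alpha+\alpha\subseteq\alpha$, $A\alpha\subseteq\alpha$; it is prime if $1\notin\alpha$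 and $ab\in\alpha$ implies $a\in\alpha$ or $b\in\alpha$. $\mathrm{spec}(A)$ is the set of prime ideals with the topology with basis $D(a)=\{p: a\notin p\}$ (a spectral space); $(\mathrm{spec}(A))_{const}$ is the same set with the constructible topology (generated by the $D(a)$ and their complements). $(x)$ denotes the ideal generated by $x$. For a multiplicative set $S$ ($1\in S$, $SS\subseteq S$), $S^{-1}A$ is the multiring of fractions $a/s$, with $a/s=b/t$ iff $atu=bsu$ for some $u\in S$, $a/s\in b/t+c/u$ iff $atuv\in bsuv+cstv$ for some $v\in S$, and $(a/s)(b/t)=ab/st$. For an ideal $I$, $A/I$ is the set of classes of $a\sim b\Leftrightarrow (a-b)\cap I\ne\emptyset$, with $\overline a\in\overline b+\overline c$ iff $a\in b+c+i$ for some $i\in I$, and induced product. For $p\in\mathrm{spec}(A)$, $K_A(p)=((A/p)\setminus\{0\})^{-1}(A/p)$; for $x\in A$, $y\in A\setminus p$, $\frac xy\in K_A(p)$ is the evident element. A constructible section is a function $f\colon\mathrm{spec}(A)\to\bigsqcup_{p}K_A(p)$ with $f(p)\in K_A(p)$ for all $p$ such that for each $p\in\mathrm{spec}(A)$ there are a clopen $U$ of $(\mathrm{spec}(A))_{const}$ and $x,y\in A$ with $p\in U\subseteq D(y)$ and $f(q)=\frac xy\in K_A(q)$ for all $q\in U$. $V(A)$ is the set of constructible sections, with pointwise product, negation and constants and with $f\in g+h$ iff $f(p)\in g(p)+h(p)$ in $K_A(p)$ for all $p$. The map $v_A\colon A\to V(A)$ is $v_A(a)(p)=\frac a1\in K_A(p)$.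 It is known that $V(A)$ is a geometric von Neumann hyperring and $v_A$ a multiring morphism. A von Neumann hyperring is a hyperring $A$ such that for all $a\in A$ there is $b\in A$ with $a=a^2b$. It is geometric if its structural presheaf is a sheaf: $\mathcal F(D(a))=S_a^{-1}A$ with $S_a=\{x:\exists n\ge0,\ a^n\in(x)\}$, and canonical restriction maps, where "sheaf" means that for every cover $D(e)=\bigcup_iD(e_i)$ by basic opens, (1) for $a,b,c\in\mathcal F(D(e))$, if $a|_{D(e_i)}\in b|_{D(e_i)}+c|_{D(e_i)}$ for all $i$ then $a\in b+c$, and (2) families $x_i\in\mathcal F(D(e_i))$ agreeing on the $D(e_ie_j)$ glue to an element of $\mathcal F(D(e))$. $\mathbf{GvNH}$ is the category of geometric von Neumann hyperrings with multiring morphisms. *)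

theory Defs
  imports "HOL-Algebra.Group" "HOL-Analysis.Function_Topology"
begin

section \<open>Multirings and their morphisms\<close>

record 'a multiring = "'a monoid" +
  hadd :: "'a \<Rightarrow> 'a \<Rightarrow> 'a set" (infixl \<open>\<boxplus>\<index>\<close> 65)
  hneg :: "'a \<Rightarrow> 'a" (\<open>\<boxminus>\<index> _\<close> [81] 80)
  hzero :: 'a (\<open>\<zero>\<index>\<close>)

locale multiring = comm_monoid A for A :: "('a, 'm) multiring_scheme" (structure) +
  assumes hadd_closed: "\<lbrakk>a \<in> carrier A; b \<in> carrier A\<rbrakk> \<Longrightarrow> a \<boxplus> b \<subseteq> carrier A"
    and hadd_nonempty: "\<lbrakk>a \<in> carrier A; b \<in> carrier A\<rbrakk> \<Longrightarrow> a \<boxplus> b \<noteq> {}"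
    and hneg_closed: "a \<in> carrier A \<Longrightarrow> \<boxminus> a \<in> carrier A"
    and hzero_closed: "\<zero> \<in> carrier A"
    and hadd_reversible:
      "\<lbrakk>a \<in> carrier A; b \<in> carrier A; c \<in> carrier A; a \<in> b \<boxplus> c\<rbrakk>
        \<Longrightarrow> c \<in> (\<boxminus> b) \<boxplus> a \<and> b \<in> a \<boxplus> (\<boxminus> c)"
    and hadd_zero: "\<lbrakk>a \<in> carrier A; b \<in> carrier A\<rbrakk> \<Longrightarrow> a \<in> b \<boxplus> \<zero> \<longleftrightarrow> a = b"
    and hadd_assoc:
      "\<lbrakk>a \<in> carrier A; b \<in> carrier A; c \<in> carrier A; g \<in> a \<boxplus> b; x \<in> g \<boxplus> c\<rbrakk>
        \<Longrightarrow> \<exists>h \<in> b \<boxplus> c. x \<in> a \<boxplus> h"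
    and hadd_comm: "\<lbrakk>a \<in> carrier A; b \<in> carrier A\<rbrakk> \<Longrightarrow> a \<boxplus> b = b \<boxplus> a"
    and mult_hzero: "a \<in> carrier A \<Longrightarrow> a \<otimes> \<zero> = \<zero>"
    and hadd_mult:
      "\<lbrakk>a \<in> carrier A; b \<in> carrier A; c \<in> carrier A; d \<in> carrier A; a \<in> b \<boxplus> c\<rbrakk>
        \<Longrightarrow> a \<otimes> d \<in> (b \<otimes> d) \<boxplus> (c \<otimes> d)"

locale hyperring = multiring +
  assumes hadd_mult_converse:
    "\<lbrakk>b \<in> carrier A; c \<in> carrier A; d \<in> carrier A; x \<in> (b \<otimes> d) \<boxplus> (c \<otimes> d)\<rbrakk>
      \<Longrightarrow> \<exists>a \<in> b \<boxplus> c. x = a \<otimes> d"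

text \<open>
  Morphisms are extensional functions (undefined outside the carrier), so that equality in HOL is
  equality of morphisms. They are composed by the library function \<^const>\<open>compose\<close>:
  \<open>compose (carrier A) g f\<close> is \<open>g\<close> after \<open>f\<close>, and the identity of \<open>A\<close> is \<open>\<lambda>a \<in> carrier A. a\<close>.
\<close>

definition multiring_hom ::
    "('a, 'm) multiring_scheme \<Rightarrow> ('b, 'n) multiring_scheme \<Rightarrow> ('a \<Rightarrow> 'b) set" where
  "multiring_hom A B =
    {f \<in> carrier A \<rightarrow>\<^sub>E carrier B.
      (\<forall>a \<in> carrier A. \<forall>b \<in> carrier A. \<forall>c \<in> carrier A.
         a \<in> b \<boxplus>\<^bsub>A\<^esub> c \<longrightarrow> f a \<in> f b \<boxplus>\<^bsub>B\<^esub> f c) \<and>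
      (\<forall>a \<in> carrier A. \<forall>b \<in> carrier A. f (a \<otimes>\<^bsub>A\<^esub> b) = f a \<otimes>\<^bsub>B\<^esub> f b) \<and>
      (\<forall>a \<in> carrier A. f (\<boxminus>\<^bsub>A\<^esub> a) = \<boxminus>\<^bsub>B\<^esub> f a) \<and>
      f \<zero>\<^bsub>A\<^esub> = \<zero>\<^bsub>B\<^esub> \<and> f \<one>\<^bsub>A\<^esub> = \<one>\<^bsub>B\<^esub>}"


section \<open>Ideals and the spectrum\<close>

definition mr_ideal :: "('a, 'm) multiring_scheme \<Rightarrow> 'a set \<Rightarrow> bool" where
  "mr_ideal A I \<longleftrightarrow> I \<subseteq> carrier A \<and> I \<noteq> {} \<and>
    (\<forall>a \<in> I. \<forall>b \<in> I. a \<boxplus>\<^bsub>A\<^esub> b \<subseteq> I) \<and>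
    (\<forall>a \<in> carrier A. \<forall>b \<in> I. a \<otimes>\<^bsub>A\<^esub> b \<in> I)"

definition mr_spec :: "('a, 'm) multiring_scheme \<Rightarrow> 'a set set" where
  "mr_spec A = {p. mr_ideal A p \<and> \<one>\<^bsub>A\<^esub> \<notin> p \<and>
    (\<forall>a \<in> carrier A. \<forall>b \<in> carrier A. a \<otimes>\<^bsub>A\<^esub> b \<in> p \<longrightarrow> a \<in> p \<or> b \<in> p)}"

definition mr_genideal :: "('a, 'm) multiring_scheme \<Rightarrow> 'a \<Rightarrow> 'a set" where
  "mr_genideal A x = \<Inter> {I. mr_ideal A I \<and> x \<in> I}"

definition basic_open :: "('a, 'm) multiring_scheme \<Rightarrow> 'a \<Rightarrow> 'a set set" where
  "basic_open A a = {p \<in> mr_spec A. a \<notin> p}"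

definition constructible_topology :: "('a, 'm) multiring_scheme \<Rightarrow> 'a set topology" where
  "constructible_topology A = topology_generated_by
    (basic_open A ` carrier A \<union> (\<lambda>a. mr_spec A - basic_open A a) ` carrier A)"


section \<open>Fractions, quotients and residue hyperfields\<close>

definition frac_rel :: "('a, 'm) multiring_scheme \<Rightarrow> 'a set \<Rightarrow> ('a \<times> 'a) rel" where
  "frac_rel A S = {((a, s), (b, t)). a \<in> carrier A \<and> s \<in> S \<and> b \<in> carrier A \<and> t \<in> S \<and>
    (\<exists>u \<in> S. a \<otimes>\<^bsub>A\<^esub> t \<otimes>\<^bsub>A\<^esub> u = b \<otimes>\<^bsub>A\<^esub> s \<otimes>\<^bsub>A\<^esub> u)}"

definition frac :: "('a, 'm) multiring_scheme \<Rightarrow> 'a set \<Rightarrow> 'a \<Rightarrow> 'a \<Rightarrow> ('a \<times> 'a) set" where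
  "frac A S a s = frac_rel A S `` {(a, s)}"

text \<open>
  The operations on classes below are given by a union over (or by the existence of)
  representatives; for a multiring \<open>A\<close>, a multiplicative set \<open>S\<close> and an ideal \<open>I\<close> they do not
  depend on the representatives, and the unions are then single classes.
\<close>

definition fractions :: "('a, 'm) multiring_scheme \<Rightarrow> 'a set \<Rightarrow> ('a \<times> 'a) set multiring" where
  "fractions A S =
    \<lparr>carrier = (carrier A \<times> S) // frac_rel A S,
     mult = (\<lambda>X Y. \<Union>(a, s) \<in> X. \<Union>(b, t) \<in> Y. frac A S (a \<otimes>\<^bsub>A\<^esub> b) (s \<otimes>\<^bsub>A\<^esub> t)),
     one = frac A S \<one>\<^bsub>A\<^esub> \<one>\<^bsub>A\<^esub>,
     hadd = (\<lambda>Y Z. {frac A S a s | a s. a \<in> carrier A \<and> s \<in> S \<and>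
       (\<exists>(b, t) \<in> Y. \<exists>(c, u) \<in> Z. \<exists>v \<in> S.
          a \<otimes>\<^bsub>A\<^esub> t \<otimes>\<^bsub>A\<^esub> u \<otimes>\<^bsub>A\<^esub> v \<in>
            (b \<otimes>\<^bsub>A\<^esub> s \<otimes>\<^bsub>A\<^esub> u \<otimes>\<^bsub>A\<^esub> v) \<boxplus>\<^bsub>A\<^esub> (c \<otimes>\<^bsub>A\<^esub> s \<otimes>\<^bsub>A\<^esub> t \<otimes>\<^bsub>A\<^esub> v))}),
     hneg = (\<lambda>X. \<Union>(a, s) \<in> X. frac A S (\<boxminus>\<^bsub>A\<^esub> a) s),
     hzero = frac A S \<zero>\<^bsub>A\<^esub> \<one>\<^bsub>A\<^esub>\<rparr>"

definition quot_rel :: "('a, 'm) multiring_scheme \<Rightarrow> 'a set \<Rightarrow> 'a rel" where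
  "quot_rel A I = {(a, b). a \<in> carrier A \<and> b \<in> carrier A \<and>
    (a \<boxplus>\<^bsub>A\<^esub> (\<boxminus>\<^bsub>A\<^esub> b)) \<inter> I \<noteq> {}}"

definition quot_class :: "('a, 'm) multiring_scheme \<Rightarrow> 'a set \<Rightarrow> 'a \<Rightarrow> 'a set" where
  "quot_class A I a = quot_rel A I `` {a}"

definition quotient_multiring :: "('a, 'm) multiring_scheme \<Rightarrow> 'a set \<Rightarrow> 'a set multiring" where
  "quotient_multiring A I =
    \<lparr>carrier = carrier A // quot_rel A I,
     mult = (\<lambda>X Y. \<Union>a \<in> X. \<Union>b \<in> Y. quot_class A I (a \<otimes>\<^bsub>A\<^esub> b)),
     one = quot_class A I \<one>\<^bsub>A\<^esub>,
     hadd = (\<lambda>Y Z. {quot_class A I a | a. a \<in> carrier A \<and>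
       (\<exists>b \<in> Y. \<exists>c \<in> Z. \<exists>i \<in> I. \<exists>d \<in> b \<boxplus>\<^bsub>A\<^esub> c. a \<in> d \<boxplus>\<^bsub>A\<^esub> i)}),
     hneg = (\<lambda>X. \<Union>a \<in> X. quot_class A I (\<boxminus>\<^bsub>A\<^esub> a)),
     hzero = quot_class A I \<zero>\<^bsub>A\<^esub>\<rparr>"

definition residue_denoms :: "('a, 'm) multiring_scheme \<Rightarrow> 'a set \<Rightarrow> 'a set set" where
  "residue_denoms A p =
    carrier (quotient_multiring A p) - {\<zero>\<^bsub>quotient_multiring A p\<^esub>}"

definition residue_field ::
    "('a, 'm) multiring_scheme \<Rightarrow> 'a set \<Rightarrow> ('a set \<times> 'a set) set multiring" where
  "residue_field A p = fractions (quotient_multiring A p) (residue_denoms A p)"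

definition residue_frac ::
    "('a, 'm) multiring_scheme \<Rightarrow> 'a set \<Rightarrow> 'a \<Rightarrow> 'a \<Rightarrow> ('a set \<times> 'a set) set" where
  "residue_frac A p x y =
    frac (quotient_multiring A p) (residue_denoms A p) (quot_class A p x) (quot_class A p y)"


section \<open>The hyperring of constructible sections\<close>

definition constructible_sections ::
    "('a, 'm) multiring_scheme \<Rightarrow> ('a set \<Rightarrow> ('a set \<times> 'a set) set) set" where
  "constructible_sections A =
    {f \<in> (\<Pi>\<^sub>E p \<in> mr_spec A. carrier (residue_field A p)).
      \<forall>p \<in> mr_spec A. \<exists>U. \<exists>x \<in> carrier A. \<exists>y \<in> carrier A.
        openin (constructible_topology A) U \<and> closedin (constructible_topology A) U \<and>
        p \<in> U \<and> U \<subseteq> basic_open A y \<and> (\<forall>q \<in> U. f q = residue_frac A q x y)}"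

definition V_hull ::
    "('a, 'm) multiring_scheme \<Rightarrow> ('a set \<Rightarrow> ('a set \<times> 'a set) set) multiring" where
  "V_hull A =
    \<lparr>carrier = constructible_sections A,
     mult = (\<lambda>f g. \<lambda>p \<in> mr_spec A. f p \<otimes>\<^bsub>residue_field A p\<^esub> g p),
     one = (\<lambda>p \<in> mr_spec A. \<one>\<^bsub>residue_field A p\<^esub>),
     hadd = (\<lambda>g h. {f \<in> constructible_sections A.
       \<forall>p \<in> mr_spec A. f p \<in> g p \<boxplus>\<^bsub>residue_field A p\<^esub> h p}),
     hneg = (\<lambda>f. \<lambda>p \<in> mr_spec A. \<boxminus>\<^bsub>residue_field A p\<^esub> f p),
     hzero = (\<lambda>p \<in> mr_spec A. \<zero>\<^bsub>residue_field A p\<^esub>)\<rparr>"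

definition V_unit ::
    "('a, 'm) multiring_scheme \<Rightarrow> 'a \<Rightarrow> 'a set \<Rightarrow> ('a set \<times> 'a set) set" where
  "V_unit A = (\<lambda>a \<in> carrier A. \<lambda>p \<in> mr_spec A. residue_frac A p a \<one>\<^bsub>A\<^esub>)"

definition V_map ::
    "('a, 'm) multiring_scheme \<Rightarrow> ('b, 'n) multiring_scheme \<Rightarrow> ('a \<Rightarrow> 'b) \<Rightarrow>
     ('a set \<Rightarrow> ('a set \<times> 'a set) set) \<Rightarrow> 'b set \<Rightarrow> ('b set \<times> 'b set) set" where
  "V_map A B f = (THE g. g \<in> multiring_hom (V_hull A) (V_hull B) \<and>
     compose (carrier A) g (V_unit A) = compose (carrier A) (V_unit B) f)"


section \<open>Geometric von Neumann hyperrings\<close>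

definition sheaf_denoms :: "('a, 'm) multiring_scheme \<Rightarrow> 'a \<Rightarrow> 'a set" where
  "sheaf_denoms A a = {x \<in> carrier A. \<exists>n::nat. a [^]\<^bsub>A\<^esub> n \<in> mr_genideal A x}"

definition structure_presheaf ::
    "('a, 'm) multiring_scheme \<Rightarrow> 'a \<Rightarrow> ('a \<times> 'a) set multiring" where
  "structure_presheaf A a = fractions A (sheaf_denoms A a)"

text \<open>
  The restriction of a section over \<open>D(a)\<close> to \<open>D(b) \<subseteq> D(a)\<close> sends \<open>x/s\<close> to \<open>x/s\<close>; it depends
  on \<open>a\<close> only through its argument, a class of pairs with second component in
  \<open>sheaf_denoms A a \<subseteq> sheaf_denoms A b\<close>.
\<close>

definition presheaf_restrict ::
    "('a, 'm) multiring_scheme \<Rightarrow> 'a \<Rightarrow> ('a \<times> 'a) set \<Rightarrow> ('a \<times> 'a) set" where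
  "presheaf_restrict A b X = (\<Union>(x, s) \<in> X. frac A (sheaf_denoms A b) x s)"

text \<open>
  Covers of \<open>D(e)\<close> are families \<open>(D(d i))\<^sub>i\<close> indexed by a set \<open>I\<close> of elements of the type \<open>'a\<close>.
  This loses no generality: indices with the same \<open>d i\<close> carry the same section by compatibility.
\<close>

locale von_Neumann_hyperring = hyperring +
  assumes von_Neumann: "a \<in> carrier A \<Longrightarrow> \<exists>b \<in> carrier A. a = a \<otimes> a \<otimes> b"

locale geometric_von_Neumann_hyperring = von_Neumann_hyperring A
  for A :: "('a, 'm) multiring_scheme" (structure) +
  assumes sheaf_hadd:
    "\<And>e (I :: 'a set) d a b c.
      \<lbrakk>e \<in> carrier A; d \<in> I \<rightarrow> carrier A; basic_open A e = (\<Union>i \<in> I. basic_open A (d i));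
       a \<in> carrier (structure_presheaf A e); b \<in> carrier (structure_presheaf A e);
       c \<in> carrier (structure_presheaf A e);
       \<And>i. i \<in> I \<Longrightarrow> presheaf_restrict A (d i) a \<in>
         presheaf_restrict A (d i) b \<boxplus>\<^bsub>structure_presheaf A (d i)\<^esub> presheaf_restrict A (d i) c\<rbrakk>
      \<Longrightarrow> a \<in> b \<boxplus>\<^bsub>structure_presheaf A e\<^esub> c"
    and sheaf_glue:
    "\<And>e (I :: 'a set) d x.
      \<lbrakk>e \<in> carrier A; d \<in> I \<rightarrow> carrier A; basic_open A e = (\<Union>i \<in> I. basic_open A (d i));
       \<And>i. i \<in> I \<Longrightarrow> x i \<in> carrier (structure_presheaf A (d i));
       \<And>i j. \<lbrakk>i \<in> I; j \<in> I\<rbrakk> \<Longrightarrow>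
         presheaf_restrict A (d i \<otimes> d j) (x i) = presheaf_restrict A (d i \<otimes> d j) (x j)\<rbrakk>
      \<Longrightarrow> \<exists>y \<in> carrier (structure_presheaf A e). \<forall>i \<in> I. presheaf_restrict A (d i) y = x i"

end

theory Submission
  imports Defs
begin

text \<open>
  Everything rests on the residue hyperfields \<open>K(p)\<close>. A sum relation between fractions at a prime \<open>p\<close>
  is witnessed by some \<open>v \<notin> p\<close> and some \<open>i \<in> p\<close> (\<open>residue_hadd_iff\<close>), and the same witnesses serve at
  all primes of the constructible open set \<open>D(v) - D(i)\<close>. Sum relations, and with them equalities,
  therefore spread from a point to a neighbourhood (\<open>near_hadd\<close>, \<open>near_eq\<close>). The constructible
  topology is compact (\<open>compact_constructible\<close>) and has a base of clopen sets, so conditions of this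
  kind that are solvable in every \<open>K(p)\<close> are solved by one constructible section
  (\<open>section_from_pointwise\<close>). Since each \<open>K(p)\<close> is a hyperfield, this makes the hull a von Neumann
  hyperring. It is geometric because a cover by basic open sets, tested at the primes of sections that
  vanish at a given point, is a cover of supports, and sections are defined locally.

  A morphism \<open>\<phi>\<close> from the hull of \<open>A\<close> to a hyperfield is determined by \<open>\<phi> \<circ> v\<close>
  (\<open>hom_from_V_hull_determined\<close>): with \<open>p\<close> the kernel of \<open>\<phi> \<circ> v\<close>, a section \<open>h\<close> is a fraction \<open>x/y\<close>
  near \<open>p\<close>, and \<open>\<phi> h\<close> has to be \<open>\<phi> (v x)\<close> divided by \<open>\<phi> (v y)\<close>. Evaluation at the points of the spectrum of
  \<open>B\<close> extends this to morphisms into the hull of \<open>B\<close>. For the existence of \<open>V(f)\<close> the prime \<open>q\<close> of \<open>B\<close> is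
  pulled back to \<open>p\<close>, and \<open>x/y\<close> in \<open>K(p)\<close> is sent to \<open>f x/f y\<close> in \<open>K(q)\<close>.

  Finally, if \<open>B\<close> is a geometric von Neumann hyperring, then \<open>v\<close> is an isomorphism from \<open>B\<close> to its hull. For
  every element \<open>i\<close> of a prime \<open>q\<close> there is a complement, an element \<open>e \<notin> q\<close> with \<open>i e = 0\<close>
  (\<open>complement_ex\<close>). Multiplication by complements turns relations in the residue hyperfields into relations in \<open>B\<close>
  on a cover by basic open sets. The two parts of the sheaf condition then show that \<open>v\<close> reflects sums
  (\<open>V_unit_reflects_hadd\<close>), so that it is injective, and that it is onto (\<open>V_unit_surj\<close>). The universal
  property follows, with the inverse of \<open>v\<close> after \<open>V(f)\<close> as extension of \<open>f\<close>.
\<close>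

section \<open>Arithmetic in multirings\<close>

text \<open>
  The operations on classes are unions over representatives. Once the classes in such a union are
  known to coincide, these facts evaluate it.
\<close>

lemma UN_eq_const: "\<lbrakk>a \<in> X; \<And>x. x \<in> X \<Longrightarrow> F x = c\<rbrakk> \<Longrightarrow> (\<Union>x \<in> X. F x) = c"
  by blast

lemma UN2_eq_const:
  "\<lbrakk>a \<in> X; b \<in> Y; \<And>x y. \<lbrakk>x \<in> X; y \<in> Y\<rbrakk> \<Longrightarrow> F x y = c\<rbrakk> \<Longrightarrow> (\<Union>x \<in> X. \<Union>y \<in> Y. F x y) = c"
  by blast

context multiring
begin

lemma hadd_mem_carrier [dest]:
  "\<lbrakk>x \<in> a \<boxplus> b; a \<in> carrier A; b \<in> carrier A\<rbrakk> \<Longrightarrow> x \<in> carrier A"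
  using hadd_closed by blast

lemmas [simp, intro] = hneg_closed hzero_closed

lemma hadd_rev_left:
  "\<lbrakk>a \<in> b \<boxplus> c; b \<in> carrier A; c \<in> carrier A\<rbrakk> \<Longrightarrow> c \<in> (\<boxminus> b) \<boxplus> a"
  using hadd_reversible hadd_mem_carrier by blast

lemma hadd_rev_right:
  "\<lbrakk>a \<in> b \<boxplus> c; b \<in> carrier A; c \<in> carrier A\<rbrakk> \<Longrightarrow> b \<in> a \<boxplus> (\<boxminus> c)"
  using hadd_reversible hadd_mem_carrier by blast

lemma mem_hadd_zero [simp]: "a \<in> carrier A \<Longrightarrow> a \<in> a \<boxplus> \<zero>"
  using hadd_zero by blast

lemma hadd_zero_right: "\<lbrakk>a \<in> b \<boxplus> \<zero>; b \<in> carrier A\<rbrakk> \<Longrightarrow> a = b"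
  using hadd_zero hadd_mem_carrier by blast

lemma mem_zero_hadd [simp]: "a \<in> carrier A \<Longrightarrow> a \<in> \<zero> \<boxplus> a"
  using hadd_comm mem_hadd_zero by blast

lemma hadd_zero_left: "\<lbrakk>a \<in> \<zero> \<boxplus> b; b \<in> carrier A\<rbrakk> \<Longrightarrow> a = b"
  using hadd_comm hadd_zero_right by blast

text \<open>
  The associativity axiom is one inclusion; commutativity turns it into the other.
\<close>

lemma hadd_assoc_right:
  assumes "x \<in> a \<boxplus> h" "h \<in> b \<boxplus> c" "a \<in> carrier A" "b \<in> carrier A" "c \<in> carrier A"
  shows "\<exists>g \<in> a \<boxplus> b. x \<in> g \<boxplus> c"
proof -
  have h: "h \<in> carrier A" using assms by blast
  have "h \<in> c \<boxplus> b" "x \<in> h \<boxplus> a" using assms h hadd_comm by blast+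
  then obtain g where "g \<in> b \<boxplus> a" "x \<in> c \<boxplus> g" using hadd_assoc assms by metis
  moreover from this have "g \<in> carrier A" using assms by blast
  ultimately show ?thesis using hadd_comm assms by blast
qed

lemma zero_mem_diff: "a \<in> carrier A \<Longrightarrow> \<zero> \<in> a \<boxplus> (\<boxminus> a)"
  using hadd_rev_left[of a a \<zero>] hadd_comm by (metis hneg_closed hzero_closed mem_hadd_zero)

lemma hneg_unique: "\<lbrakk>\<zero> \<in> a \<boxplus> b; a \<in> carrier A; b \<in> carrier A\<rbrakk> \<Longrightarrow> b = \<boxminus> a"
  using hadd_rev_left hadd_zero_right by blast

lemma hneg_hneg [simp]: "a \<in> carrier A \<Longrightarrow> \<boxminus> (\<boxminus> a) = a"
  using hneg_unique[of "\<boxminus> a" a] zero_mem_diff hadd_comm by (metis hneg_closed)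

lemma zero_mult [simp]: "a \<in> carrier A \<Longrightarrow> \<zero> \<otimes> a = \<zero>"
  using mult_hzero m_comm by simp

lemmas mult_zero [simp] = mult_hzero

text \<open>
  Multiplying \<open>0 \<in> a + (- a)\<close> by \<open>b\<close> shows that \<open>(- a) b\<close> is an additive inverse of \<open>a b\<close>.
\<close>

lemma hneg_mult_left: "\<lbrakk>a \<in> carrier A; b \<in> carrier A\<rbrakk> \<Longrightarrow> (\<boxminus> a) \<otimes> b = \<boxminus> (a \<otimes> b)"
  using hneg_unique[of "a \<otimes> b" "(\<boxminus> a) \<otimes> b"] hadd_mult[of \<zero> a "\<boxminus> a" b] zero_mem_diff
  by simp

lemma hneg_eq_mult: "a \<in> carrier A \<Longrightarrow> \<boxminus> a = (\<boxminus> \<one>) \<otimes> a"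
  using hneg_mult_left[of \<one> a] by simp

lemma hneg_hadd:
  "\<lbrakk>a \<in> b \<boxplus> c; b \<in> carrier A; c \<in> carrier A\<rbrakk> \<Longrightarrow> \<boxminus> a \<in> (\<boxminus> b) \<boxplus> (\<boxminus> c)"
  using hadd_mult[of a b c "\<boxminus> \<one>"] hadd_mem_carrier[of a b c]
  by (simp add: m_comm hneg_eq_mult[of a] hneg_eq_mult[of b] hneg_eq_mult[of c])

end

lemma ideal_carrier: "\<lbrakk>mr_ideal A I; a \<in> I\<rbrakk> \<Longrightarrow> a \<in> carrier A"
  unfolding mr_ideal_def by blast

lemma ideal_hadd: "\<lbrakk>mr_ideal A I; a \<in> I; b \<in> I; x \<in> a \<boxplus>\<^bsub>A\<^esub> b\<rbrakk> \<Longrightarrow> x \<in> I"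
  unfolding mr_ideal_def by blast

lemma ideal_mult: "\<lbrakk>mr_ideal A I; a \<in> carrier A; b \<in> I\<rbrakk> \<Longrightarrow> a \<otimes>\<^bsub>A\<^esub> b \<in> I"
  unfolding mr_ideal_def by blast

context multiring
begin

lemma ideal_zero:
  assumes "mr_ideal A I" shows "\<zero> \<in> I"
proof -
  obtain a where "a \<in> I" using assms unfolding mr_ideal_def by blast
  then show ?thesis
    using ideal_mult[OF assms hzero_closed, of a] ideal_carrier[OF assms, of a] by simp
qed

lemma ideal_mult_right: "\<lbrakk>mr_ideal A I; a \<in> I; b \<in> carrier A\<rbrakk> \<Longrightarrow> a \<otimes> b \<in> I"
  using ideal_carrier[of A I a] ideal_mult[of A I b a] m_comm[of a b] by simp

lemma ideal_neg: "\<lbrakk>mr_ideal A I; a \<in> I\<rbrakk> \<Longrightarrow> \<boxminus> a \<in> I"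
  using hneg_eq_mult[of a] ideal_carrier[of A I a] ideal_mult[of A I "\<boxminus> \<one>" a] by simp

end

lemma multiring_homD:
  assumes "f \<in> multiring_hom A B"
  shows "a \<in> carrier A \<Longrightarrow> f a \<in> carrier B"
    "\<lbrakk>a \<in> b \<boxplus>\<^bsub>A\<^esub> c; a \<in> carrier A; b \<in> carrier A; c \<in> carrier A\<rbrakk> \<Longrightarrow> f a \<in> f b \<boxplus>\<^bsub>B\<^esub> f c"
    "\<lbrakk>a \<in> carrier A; b \<in> carrier A\<rbrakk> \<Longrightarrow> f (a \<otimes>\<^bsub>A\<^esub> b) = f a \<otimes>\<^bsub>B\<^esub> f b"
    "a \<in> carrier A \<Longrightarrow> f (\<boxminus>\<^bsub>A\<^esub> a) = \<boxminus>\<^bsub>B\<^esub> f a"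
    "f \<zero>\<^bsub>A\<^esub> = \<zero>\<^bsub>B\<^esub>" "f \<one>\<^bsub>A\<^esub> = \<one>\<^bsub>B\<^esub>" "f \<in> extensional (carrier A)"
  using assms unfolding multiring_hom_def by (auto simp: PiE_iff)

lemma multiring_homI:
  assumes "f \<in> extensional (carrier A)"
    "\<And>a. a \<in> carrier A \<Longrightarrow> f a \<in> carrier B"
    "\<And>a b c. \<lbrakk>a \<in> carrier A; b \<in> carrier A; c \<in> carrier A; a \<in> b \<boxplus>\<^bsub>A\<^esub> c\<rbrakk>
       \<Longrightarrow> f a \<in> f b \<boxplus>\<^bsub>B\<^esub> f c"
    "\<And>a b. \<lbrakk>a \<in> carrier A; b \<in> carrier A\<rbrakk> \<Longrightarrow> f (a \<otimes>\<^bsub>A\<^esub> b) = f a \<otimes>\<^bsub>B\<^esub> f b"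
    "\<And>a. a \<in> carrier A \<Longrightarrow> f (\<boxminus>\<^bsub>A\<^esub> a) = \<boxminus>\<^bsub>B\<^esub> f a"
    "f \<zero>\<^bsub>A\<^esub> = \<zero>\<^bsub>B\<^esub>" "f \<one>\<^bsub>A\<^esub> = \<one>\<^bsub>B\<^esub>"
  shows "f \<in> multiring_hom A B"
  using assms unfolding multiring_hom_def by (auto simp: PiE_iff)

lemma multiring_hom_compose:
  assumes A: "multiring A" and f: "f \<in> multiring_hom A B" and g: "g \<in> multiring_hom B C"
  shows "compose (carrier A) g f \<in> multiring_hom A C"
proof -
  interpret multiring A by fact
  show ?thesis
  proof (rule multiring_homI)
    fix a b c assume "a \<in> carrier A" "b \<in> carrier A" "c \<in> carrier A" "a \<in> b \<boxplus>\<^bsub>A\<^esub> c"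
    then show "compose (carrier A) g f a \<in> compose (carrier A) g f b \<boxplus>\<^bsub>C\<^esub> compose (carrier A) g f c"
      using multiring_homD(1,2)[OF f] multiring_homD(2)[OF g] by (simp add: compose_eq)
  qed (simp_all add: compose_def multiring_homD[OF f] multiring_homD[OF g])
qed

section \<open>Quotients by ideals\<close>

context multiring
begin

lemma quot_rel_iff:
  assumes "mr_ideal A I"
  shows "(a, b) \<in> quot_rel A I \<longleftrightarrow> a \<in> carrier A \<and> b \<in> carrier A \<and> (\<exists>i \<in> I. a \<in> b \<boxplus> i)"
proof -
  have "(a \<boxplus> (\<boxminus> b)) \<inter> I \<noteq> {} \<longleftrightarrow> (\<exists>i \<in> I. a \<in> b \<boxplus> i)"
    if ab: "a \<in> carrier A" "b \<in> carrier A"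
  proof
    assume "(a \<boxplus> (\<boxminus> b)) \<inter> I \<noteq> {}"
    then obtain i where i: "i \<in> I" "i \<in> a \<boxplus> (\<boxminus> b)" by blast
    then have "a \<in> i \<boxplus> b" using hadd_rev_right[of i a "\<boxminus> b"] ab by simp
    moreover have "i \<in> carrier A" using i ideal_carrier[OF assms] by blast
    ultimately show "\<exists>i \<in> I. a \<in> b \<boxplus> i" using i ab hadd_comm[of b i] by blast
  next
    assume "\<exists>i \<in> I. a \<in> b \<boxplus> i"
    then obtain i where i: "i \<in> I" "a \<in> b \<boxplus> i" by blast
    moreover have "i \<in> carrier A" using i ideal_carrier[OF assms] by blast
    ultimately have "i \<in> (\<boxminus> b) \<boxplus> a" using hadd_rev_left ab by blast
    then show "(a \<boxplus> (\<boxminus> b)) \<inter> I \<noteq> {}" using i ab hadd_comm[of "\<boxminus> b" a] by auto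
  qed
  then show ?thesis unfolding quot_rel_def by auto
qed

text \<open>
  Summands from \<open>I\<close> can be moved past other summands and collected into a single one. Independence of
  representatives in \<open>A/I\<close> needs no other computation.
\<close>

lemma ideal_absorb:
  assumes I: "mr_ideal A I" and "x \<in> y \<boxplus> i" "y \<in> z \<boxplus> j" "i \<in> I" "j \<in> I" "z \<in> carrier A"
  shows "\<exists>k \<in> I. x \<in> z \<boxplus> k"
proof -
  have "i \<in> carrier A" "j \<in> carrier A" using assms(4,5) ideal_carrier[OF I] by blast+
  then obtain k where "k \<in> j \<boxplus> i" "x \<in> z \<boxplus> k" using hadd_assoc[of z j i y x] assms by blast
  then show ?thesis using ideal_hadd[OF I] assms by blast
qed

lemma ideal_absorb_summand:
  assumes I: "mr_ideal A I" and "x \<in> b' \<boxplus> c" "b' \<in> b \<boxplus> i" "i \<in> I" "b \<in> carrier A" "c \<in> carrier A"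
  shows "\<exists>d \<in> b \<boxplus> c. x \<in> d \<boxplus> i"
proof -
  have i: "i \<in> carrier A" using assms(4) ideal_carrier[OF I] by blast
  then obtain h where "h \<in> i \<boxplus> c" "x \<in> b \<boxplus> h" using hadd_assoc[of b i c b' x] assms by blast
  then have "h \<in> c \<boxplus> i" using hadd_comm i assms by blast
  then show ?thesis using hadd_assoc_right \<open>x \<in> b \<boxplus> h\<close> i assms by blast
qed

lemma quot_equiv:
  assumes I: "mr_ideal A I"
  shows "equiv (carrier A) (quot_rel A I)"
proof (rule equivI)
  show "quot_rel A I \<subseteq> carrier A \<times> carrier A" unfolding quot_rel_def by auto
  show "refl_on (carrier A) (quot_rel A I)"
  proof (rule refl_onI)
    fix x assume "x \<in> carrier A"
    then show "(x, x) \<in> quot_rel A I"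
      using ideal_zero[OF I] mem_hadd_zero[of x] quot_rel_iff[OF I] by blast
  qed
  show "sym (quot_rel A I)"
    using hadd_rev_right ideal_neg[OF I] ideal_carrier[OF I]
    by (fastforce intro!: symI simp: quot_rel_iff[OF I])
  show "trans (quot_rel A I)"
    using ideal_absorb[OF I] by (auto intro!: transI simp: quot_rel_iff[OF I])
qed

lemma quot_class_eq_iff:
  "\<lbrakk>mr_ideal A I; a \<in> carrier A; b \<in> carrier A\<rbrakk>
    \<Longrightarrow> quot_class A I a = quot_class A I b \<longleftrightarrow> (\<exists>i \<in> I. a \<in> b \<boxplus> i)"
  unfolding quot_class_def using eq_equiv_class_iff[OF quot_equiv] quot_rel_iff by blast

lemma quot_class_self: "\<lbrakk>mr_ideal A I; a \<in> carrier A\<rbrakk> \<Longrightarrow> a \<in> quot_class A I a"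
  unfolding quot_class_def using equiv_class_self[OF quot_equiv] by blast

lemma mem_quot_class_iff:
  "\<lbrakk>mr_ideal A I; a \<in> carrier A\<rbrakk>
    \<Longrightarrow> b \<in> quot_class A I a \<longleftrightarrow> b \<in> carrier A \<and> quot_class A I b = quot_class A I a"
  using quot_equiv[of I] unfolding quot_class_def
  by (metis (no_types, lifting) Image_singleton_iff equiv_class_eq_iff)

lemma quot_carrier: "carrier (quotient_multiring A I) = quot_class A I ` carrier A"
  unfolding quotient_multiring_def quot_class_def quotient_def by auto

lemma quot_carrierI [intro]: "a \<in> carrier A \<Longrightarrow> quot_class A I a \<in> carrier (quotient_multiring A I)"
  unfolding quot_carrier by blast

lemma quot_mult:
  assumes I: "mr_ideal A I" and a: "a \<in> carrier A" and b: "b \<in> carrier A"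
  shows "quot_class A I a \<otimes>\<^bsub>quotient_multiring A I\<^esub> quot_class A I b = quot_class A I (a \<otimes> b)"
proof -
  have H: "quot_class A I (a' \<otimes> b') = quot_class A I (a \<otimes> b)"
    if a': "a' \<in> quot_class A I a" and b': "b' \<in> quot_class A I b" for a' b'
  proof -
    obtain i j where i: "i \<in> I" "a' \<in> a \<boxplus> i" and j: "j \<in> I" "b' \<in> b \<boxplus> j"
      and c: "a' \<in> carrier A" "b' \<in> carrier A"
      using a' b' a b mem_quot_class_iff[OF I] quot_class_eq_iff[OF I] by metis
    have ij: "i \<in> carrier A" "j \<in> carrier A" using i j ideal_carrier[OF I] by blast+
    have 1: "a' \<otimes> b' \<in> (a \<otimes> b') \<boxplus> (i \<otimes> b')"
      using hadd_mult i c a ij by blast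
    have 2: "a \<otimes> b' \<in> (a \<otimes> b) \<boxplus> (a \<otimes> j)"
      using hadd_mult[of b' b j a] j c a b ij by (simp add: m_comm)
    have "i \<otimes> b' \<in> I" "a \<otimes> j \<in> I"
      using ideal_mult_right[OF I] ideal_mult[OF I] i j c a by blast+
    then show ?thesis
      using ideal_absorb[OF I 1 2] a b c quot_class_eq_iff[OF I] by simp
  qed
  have "(\<Union>a' \<in> quot_class A I a. \<Union>b' \<in> quot_class A I b. quot_class A I (a' \<otimes> b'))
      = quot_class A I (a \<otimes> b)"
    by (rule UN2_eq_const[OF quot_class_self[OF I a] quot_class_self[OF I b] H])
  then show ?thesis unfolding quotient_multiring_def by simp
qed

lemma quot_neg:
  assumes I: "mr_ideal A I" and a: "a \<in> carrier A"
  shows "\<boxminus>\<^bsub>quotient_multiring A I\<^esub> (quot_class A I a) = quot_class A I (\<boxminus> a)"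
proof -
  have H: "quot_class A I (\<boxminus> a') = quot_class A I (\<boxminus> a)" if a': "a' \<in> quot_class A I a" for a'
  proof -
    obtain i where i: "i \<in> I" "a' \<in> a \<boxplus> i" and c: "a' \<in> carrier A"
      using a' a mem_quot_class_iff[OF I] quot_class_eq_iff[OF I] by metis
    have "\<boxminus> a' \<in> (\<boxminus> a) \<boxplus> (\<boxminus> i)" using hneg_hadd i a ideal_carrier[OF I] by blast
    then show ?thesis
      using quot_class_eq_iff[OF I] ideal_neg[OF I] i c a by blast
  qed
  have "(\<Union>a' \<in> quot_class A I a. quot_class A I (\<boxminus> a')) = quot_class A I (\<boxminus> a)"
    by (rule UN_eq_const[OF quot_class_self[OF I a] H])
  then show ?thesis unfolding quotient_multiring_def by simp
qed

lemma quot_zero: "\<zero>\<^bsub>quotient_multiring A I\<^esub> = quot_class A I \<zero>"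
  and quot_one: "\<one>\<^bsub>quotient_multiring A I\<^esub> = quot_class A I \<one>"
  unfolding quotient_multiring_def by auto

text \<open>
  Replacing one of the three representatives by another adds a summand from \<open>I\<close> on one side of the
  relation, and all of these are absorbed into one.
\<close>

lemma quot_hadd_iff:
  assumes I: "mr_ideal A I" and a: "a \<in> carrier A" and b: "b \<in> carrier A" and c: "c \<in> carrier A"
  shows "quot_class A I a \<in> quot_class A I b \<boxplus>\<^bsub>quotient_multiring A I\<^esub> quot_class A I c
    \<longleftrightarrow> (\<exists>d \<in> b \<boxplus> c. \<exists>i \<in> I. a \<in> d \<boxplus> i)" (is "?L \<longleftrightarrow> ?R")
proof
  assume ?L
  then obtain a' b' c' d i where a': "a' \<in> carrier A" "quot_class A I a = quot_class A I a'"
    and b': "b' \<in> quot_class A I b" and c': "c' \<in> quot_class A I c"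
    and d: "d \<in> b' \<boxplus> c'" and i: "i \<in> I" "a' \<in> d \<boxplus> i"
    unfolding quotient_multiring_def by auto
  obtain j k l where j: "j \<in> I" "b' \<in> b \<boxplus> j" and k: "k \<in> I" "c' \<in> c \<boxplus> k"
      and l: "l \<in> I" "a \<in> a' \<boxplus> l" and C: "b' \<in> carrier A" "c' \<in> carrier A"
    using a' b' c' a b c mem_quot_class_iff[OF I] quot_class_eq_iff[OF I] by metis
  obtain d1 where d1: "d1 \<in> b \<boxplus> c'" "d \<in> d1 \<boxplus> j"
    using ideal_absorb_summand[OF I d j(2) j(1)] b C by blast
  then have "d1 \<in> c' \<boxplus> b" using hadd_comm b C by blast
  then obtain d2 where d2: "d2 \<in> c \<boxplus> b" "d1 \<in> d2 \<boxplus> k"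
    using ideal_absorb_summand[OF I _ k(2) k(1)] b c by blast
  have d2c: "d2 \<in> carrier A" using d2 b c by blast
  obtain k1 where k1: "k1 \<in> I" "d \<in> d2 \<boxplus> k1"
    using ideal_absorb[OF I d1(2) d2(2) j(1) k(1) d2c] by blast
  obtain k2 where k2: "k2 \<in> I" "a' \<in> d2 \<boxplus> k2"
    using ideal_absorb[OF I i(2) k1(2) i(1) k1(1) d2c] by blast
  obtain k3 where "k3 \<in> I" "a \<in> d2 \<boxplus> k3"
    using ideal_absorb[OF I l(2) k2(2) l(1) k2(1) d2c] by blast
  then show ?R using d2 hadd_comm b c by blast
next
  assume ?R
  then have "\<exists>b' \<in> quot_class A I b. \<exists>c' \<in> quot_class A I c. \<exists>i \<in> I. \<exists>d \<in> b' \<boxplus> c'. a \<in> d \<boxplus> i"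
    using quot_class_self[OF I b] quot_class_self[OF I c] by blast
  then show ?L
    using a unfolding quotient_multiring_def multiring.simps by blast
qed

lemma quot_hadd_closed:
  "X \<boxplus>\<^bsub>quotient_multiring A I\<^esub> Y \<subseteq> carrier (quotient_multiring A I)"
  unfolding quot_carrier unfolding quotient_multiring_def multiring.simps by blast

lemma quot_hadd_of_mem:
  assumes I: "mr_ideal A I" and "a \<in> b \<boxplus> c" "b \<in> carrier A" "c \<in> carrier A"
  shows "quot_class A I a \<in> quot_class A I b \<boxplus>\<^bsub>quotient_multiring A I\<^esub> quot_class A I c"
  using quot_hadd_iff[OF I] assms ideal_zero[OF I] mem_hadd_zero hadd_mem_carrier by meson

text \<open>
  A class in a sum of classes has a representative in the sum of the given representatives. Hence each
  axiom for \<open>A/I\<close> follows from the same axiom for \<open>A\<close>.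
\<close>

lemma quot_hadd_repr:
  assumes I: "mr_ideal A I" and b: "b \<in> carrier A" and c: "c \<in> carrier A"
    and X: "X \<in> quot_class A I b \<boxplus>\<^bsub>quotient_multiring A I\<^esub> quot_class A I c"
  shows "\<exists>d \<in> b \<boxplus> c. X = quot_class A I d"
proof -
  have "X \<in> quot_class A I ` carrier A" using X quot_hadd_closed quot_carrier by blast
  then obtain a where a: "a \<in> carrier A" "X = quot_class A I a" by blast
  then obtain d i where d: "d \<in> b \<boxplus> c" and i: "i \<in> I" "a \<in> d \<boxplus> i"
    using X quot_hadd_iff[OF I a(1) b c] by blast
  have "d \<in> carrier A" using d b c by (rule hadd_mem_carrier)
  then show ?thesis using d i a quot_class_eq_iff[OF I, of a d] by blast
qed

lemma quotient_multiring:
  assumes I: "mr_ideal A I"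
  shows "multiring (quotient_multiring A I)" (is "multiring ?Q")
proof -
  let ?c = "quot_class A I"
  have carr: "\<And>X. X \<in> carrier ?Q \<Longrightarrow> \<exists>a \<in> carrier A. X = ?c a" unfolding quot_carrier by blast
  show ?thesis
  proof (intro multiring.intro comm_monoidI multiring_axioms.intro)
    fix X Y assume "X \<in> carrier ?Q" "Y \<in> carrier ?Q"
    then obtain a b where ab: "a \<in> carrier A" "b \<in> carrier A" "X = ?c a" "Y = ?c b"
      using carr by metis
    show "X \<otimes>\<^bsub>?Q\<^esub> Y \<in> carrier ?Q" "X \<otimes>\<^bsub>?Q\<^esub> Y = Y \<otimes>\<^bsub>?Q\<^esub> X"
      unfolding ab(3,4) using ab(1,2)
      by (simp_all add: quot_mult[OF I] m_comm[of a b] quot_carrierI)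
    show "X \<boxplus>\<^bsub>?Q\<^esub> Y \<subseteq> carrier ?Q" by (rule quot_hadd_closed)
    obtain d where "d \<in> a \<boxplus> b" using hadd_nonempty ab by blast
    then show "X \<boxplus>\<^bsub>?Q\<^esub> Y \<noteq> {}" using quot_hadd_of_mem[OF I] ab by blast
    have "a \<boxplus> b = b \<boxplus> a" using hadd_comm ab by blast
    then have *: "?c d \<in> X \<boxplus>\<^bsub>?Q\<^esub> Y \<longleftrightarrow> ?c d \<in> Y \<boxplus>\<^bsub>?Q\<^esub> X" if "d \<in> carrier A" for d
      using quot_hadd_iff[OF I] ab that by simp
    show "X \<boxplus>\<^bsub>?Q\<^esub> Y = Y \<boxplus>\<^bsub>?Q\<^esub> X"
    proof (rule Set.set_eqI)
      fix W
      show "W \<in> X \<boxplus>\<^bsub>?Q\<^esub> Y \<longleftrightarrow> W \<in> Y \<boxplus>\<^bsub>?Q\<^esub> X"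
      proof (cases "W \<in> carrier ?Q")
        case True
        then obtain d where "d \<in> carrier A" "W = ?c d" using carr by metis
        then show ?thesis using * by simp
      next
        case False
        then show ?thesis
          using subsetD[OF quot_hadd_closed[of I X Y], of W] subsetD[OF quot_hadd_closed[of I Y X], of W]
          by argo
      qed
    qed
    show "X \<in> Y \<boxplus>\<^bsub>?Q\<^esub> \<zero>\<^bsub>?Q\<^esub> \<longleftrightarrow> X = Y"
      using ab quot_hadd_iff[OF I, of a b \<zero>] quot_class_eq_iff[OF I, of a b]
        hadd_zero_right[of _ b] mem_hadd_zero[of b]
      unfolding quot_zero by (metis hzero_closed)
  next
    fix X assume "X \<in> carrier ?Q"
    then obtain a where a: "a \<in> carrier A" "X = ?c a" using carr by metis
    show "\<one>\<^bsub>?Q\<^esub> \<otimes>\<^bsub>?Q\<^esub> X = X" "X \<otimes>\<^bsub>?Q\<^esub> \<zero>\<^bsub>?Q\<^esub> = \<zero>\<^bsub>?Q\<^esub>"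
      unfolding quot_zero quot_one a(2) by (simp_all add: quot_mult[OF I] a)
    show "\<boxminus>\<^bsub>?Q\<^esub> X \<in> carrier ?Q"
      unfolding a(2) quot_neg[OF I a(1)] using a(1) by (intro quot_carrierI hneg_closed)
  next
    fix X Y Z assume "X \<in> carrier ?Q" "Y \<in> carrier ?Q" "Z \<in> carrier ?Q"
    then obtain a b c where abc: "a \<in> carrier A" "b \<in> carrier A" "c \<in> carrier A"
        "X = ?c a" "Y = ?c b" "Z = ?c c"
      using carr by metis
    show "X \<otimes>\<^bsub>?Q\<^esub> Y \<otimes>\<^bsub>?Q\<^esub> Z = X \<otimes>\<^bsub>?Q\<^esub> (Y \<otimes>\<^bsub>?Q\<^esub> Z)"
      unfolding abc(4-6) using abc(1-3) by (simp add: quot_mult[OF I] m_assoc)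
    show "Z \<in> \<boxminus>\<^bsub>?Q\<^esub> Y \<boxplus>\<^bsub>?Q\<^esub> X \<and> Y \<in> X \<boxplus>\<^bsub>?Q\<^esub> \<boxminus>\<^bsub>?Q\<^esub> Z" if X: "X \<in> Y \<boxplus>\<^bsub>?Q\<^esub> Z"
    proof -
      obtain d where d: "d \<in> b \<boxplus> c" "X = ?c d"
        using quot_hadd_repr[OF I abc(2,3)] X unfolding abc(5,6) by blast
      have "d \<in> carrier A" using d(1) abc(2,3) by (rule hadd_mem_carrier)
      then show ?thesis
        using d abc(1-3) hadd_rev_left[of d b c] hadd_rev_right[of d b c]
        unfolding abc(5,6) by (simp add: quot_neg[OF I] quot_hadd_of_mem[OF I])
    qed
    show "\<exists>H \<in> Y \<boxplus>\<^bsub>?Q\<^esub> Z. W \<in> X \<boxplus>\<^bsub>?Q\<^esub> H" if G: "G \<in> X \<boxplus>\<^bsub>?Q\<^esub> Y" and W: "W \<in> G \<boxplus>\<^bsub>?Q\<^esub> Z"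
      for G W
    proof -
      obtain g where g: "g \<in> a \<boxplus> b" "G = ?c g"
        using quot_hadd_repr[OF I abc(1,2)] G unfolding abc(4,5) by blast
      have gc: "g \<in> carrier A" using g(1) abc(1,2) by (rule hadd_mem_carrier)
      obtain w where w: "w \<in> g \<boxplus> c" "W = ?c w"
        using quot_hadd_repr[OF I gc abc(3)] W unfolding abc(6) g(2) by blast
      obtain h where h: "h \<in> b \<boxplus> c" "w \<in> a \<boxplus> h"
        using hadd_assoc[OF abc(1-3) g(1) w(1)] by blast
      have "h \<in> carrier A" using h(1) abc(2,3) by (rule hadd_mem_carrier)
      then show ?thesis
        using quot_hadd_of_mem[OF I h(2) abc(1)] quot_hadd_of_mem[OF I h(1) abc(2,3)]
        unfolding abc(4-6) w(2) by blast
    qed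
    show "X \<otimes>\<^bsub>?Q\<^esub> W \<in> Y \<otimes>\<^bsub>?Q\<^esub> W \<boxplus>\<^bsub>?Q\<^esub> Z \<otimes>\<^bsub>?Q\<^esub> W" if W: "W \<in> carrier ?Q" and X: "X \<in> Y \<boxplus>\<^bsub>?Q\<^esub> Z" for W
    proof -
      obtain w where w: "w \<in> carrier A" "W = ?c w" using W carr by blast
      obtain d where d: "d \<in> b \<boxplus> c" "X = ?c d"
        using quot_hadd_repr[OF I abc(2,3)] X unfolding abc(5,6) by blast
      have "d \<in> carrier A" using d(1) abc(2,3) by (rule hadd_mem_carrier)
      then show ?thesis
        using d abc(1-3) w(1) hadd_mult[of d b c w]
        unfolding abc(5,6) w(2) by (simp add: quot_mult[OF I] quot_hadd_of_mem[OF I])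
    qed
  qed (simp_all add: quot_one quot_zero quot_carrierI)
qed

end

section \<open>Multirings of fractions\<close>

locale multiplicative_set = multiring +
  fixes S
  assumes S_carrier: "S \<subseteq> carrier A" and one_S: "\<one> \<in> S"
    and mult_S: "\<lbrakk>s \<in> S; t \<in> S\<rbrakk> \<Longrightarrow> s \<otimes> t \<in> S"
begin

lemma S_closed: "s \<in> S \<Longrightarrow> s \<in> carrier A"
  using S_carrier by blast

lemma frac_rel_iff:
  "((a, s), (b, t)) \<in> frac_rel A S \<longleftrightarrow>
    a \<in> carrier A \<and> s \<in> S \<and> b \<in> carrier A \<and> t \<in> S \<and> (\<exists>u \<in> S. a \<otimes> t \<otimes> u = b \<otimes> s \<otimes> u)"
  unfolding frac_rel_def by simp

lemma frac_equiv: "equiv (carrier A \<times> S) (frac_rel A S)"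
proof (rule equivI)
  show "frac_rel A S \<subseteq> (carrier A \<times> S) \<times> (carrier A \<times> S)"
    unfolding frac_rel_def by auto
  show "refl_on (carrier A \<times> S) (frac_rel A S)"
    using one_S by (intro refl_onI) (auto simp: frac_rel_iff)
  show "sym (frac_rel A S)"
    unfolding frac_rel_def by (rule symI) force
  show "trans (frac_rel A S)"
  proof (rule transI)
    fix X Y Z assume "(X, Y) \<in> frac_rel A S" "(Y, Z) \<in> frac_rel A S"
    then obtain a s b t c r u v where X: "X = (a, s)" "Z = (c, r)"
      and mem: "a \<in> carrier A" "b \<in> carrier A" "c \<in> carrier A" "s \<in> S" "t \<in> S" "r \<in> S" "u \<in> S" "v \<in> S"
      and u: "a \<otimes> t \<otimes> u = b \<otimes> s \<otimes> u" and v: "b \<otimes> r \<otimes> v = c \<otimes> t \<otimes> v"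
      unfolding frac_rel_def by blast
    note m = mem(1-3) mem(4-8)[THEN S_closed]
    have "a \<otimes> r \<otimes> (t \<otimes> u \<otimes> v) = (a \<otimes> t \<otimes> u) \<otimes> (r \<otimes> v)" using m by (simp add: m_ac)
    also have "\<dots> = (b \<otimes> r \<otimes> v) \<otimes> (s \<otimes> u)" unfolding u using m by (simp add: m_ac)
    also have "\<dots> = c \<otimes> s \<otimes> (t \<otimes> u \<otimes> v)" unfolding v using m by (simp add: m_ac)
    finally show "(X, Z) \<in> frac_rel A S"
      unfolding X frac_rel_iff using mem mult_S by blast
  qed
qed

lemma frac_eq_iff:
  "\<lbrakk>a \<in> carrier A; s \<in> S; b \<in> carrier A; t \<in> S\<rbrakk>
    \<Longrightarrow> frac A S a s = frac A S b t \<longleftrightarrow> (\<exists>u \<in> S. a \<otimes> t \<otimes> u = b \<otimes> s \<otimes> u)"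
  unfolding frac_def using eq_equiv_class_iff[OF frac_equiv, of "(a, s)" "(b, t)"]
  by (simp add: frac_rel_iff)

lemma mem_frac_iff:
  "\<lbrakk>a \<in> carrier A; s \<in> S\<rbrakk>
    \<Longrightarrow> (b, t) \<in> frac A S a s \<longleftrightarrow> b \<in> carrier A \<and> t \<in> S \<and> frac A S b t = frac A S a s"
  using eq_equiv_class_iff[OF frac_equiv, of "(a, s)" "(b, t)"]
  unfolding frac_def by (auto simp: frac_rel_iff)

lemma frac_self: "\<lbrakk>a \<in> carrier A; s \<in> S\<rbrakk> \<Longrightarrow> (a, s) \<in> frac A S a s"
  by (simp add: mem_frac_iff)

lemma frac_expand:
  "\<lbrakk>a \<in> carrier A; s \<in> S; k \<in> S\<rbrakk> \<Longrightarrow> frac A S (a \<otimes> k) (s \<otimes> k) = frac A S a s"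
  using frac_eq_iff[of "a \<otimes> k" "s \<otimes> k" a s] one_S S_closed mult_S
  by (auto simp: m_ac intro!: bexI[of _ \<one>])

lemma fractions_carrier: "X \<in> carrier (fractions A S) \<longleftrightarrow> (\<exists>a \<in> carrier A. \<exists>s \<in> S. X = frac A S a s)"
  unfolding fractions_def frac_def quotient_def by auto

lemma frac_carrierI: "\<lbrakk>a \<in> carrier A; s \<in> S\<rbrakk> \<Longrightarrow> frac A S a s \<in> carrier (fractions A S)"
  unfolding fractions_carrier by blast

lemma frac_zero: "\<zero>\<^bsub>fractions A S\<^esub> = frac A S \<zero> \<one>"
  and frac_one: "\<one>\<^bsub>fractions A S\<^esub> = frac A S \<one> \<one>"
  unfolding fractions_def by simp_all

lemma frac_mult:
  assumes a: "a \<in> carrier A" "s \<in> S" and b: "b \<in> carrier A" "t \<in> S"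
  shows "frac A S a s \<otimes>\<^bsub>fractions A S\<^esub> frac A S b t = frac A S (a \<otimes> b) (s \<otimes> t)"
proof -
  have H: "(case X of (a', s') \<Rightarrow> \<Union>(b', t') \<in> frac A S b t. frac A S (a' \<otimes> b') (s' \<otimes> t'))
      = frac A S (a \<otimes> b) (s \<otimes> t)" if X: "X \<in> frac A S a s" for X
  proof -
    obtain a' s' where X': "X = (a', s')" by (cases X)
    then have a': "a' \<in> carrier A" "s' \<in> S" "frac A S a' s' = frac A S a s"
      using X mem_frac_iff[OF a] by auto
    then obtain u where u: "u \<in> S" "a' \<otimes> s \<otimes> u = a \<otimes> s' \<otimes> u" using frac_eq_iff a by blast
    have "(case Y of (b', t') \<Rightarrow> frac A S (a' \<otimes> b') (s' \<otimes> t')) = frac A S (a \<otimes> b) (s \<otimes> t)"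
      if Y: "Y \<in> frac A S b t" for Y
    proof -
      obtain b' t' where Y': "Y = (b', t')" by (cases Y)
      then have b': "b' \<in> carrier A" "t' \<in> S" "frac A S b' t' = frac A S b t"
        using Y mem_frac_iff[OF b] by auto
      then obtain v where v: "v \<in> S" "b' \<otimes> t \<otimes> v = b \<otimes> t' \<otimes> v" using frac_eq_iff b by blast
      note m = a a' b b' u(1) v(1) S_closed
      have "a' \<otimes> b' \<otimes> (s \<otimes> t) \<otimes> (u \<otimes> v) = (a' \<otimes> s \<otimes> u) \<otimes> (b' \<otimes> t \<otimes> v)" using m by (simp add: m_ac)
      also have "\<dots> = a \<otimes> b \<otimes> (s' \<otimes> t') \<otimes> (u \<otimes> v)" unfolding u v using m by (simp add: m_ac)
      finally show ?thesis
        unfolding Y' using frac_eq_iff[of "a' \<otimes> b'" "s' \<otimes> t'" "a \<otimes> b" "s \<otimes> t"]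
          mult_S[OF u(1) v(1)] mult_S a a' b b' by auto
    qed
    then show ?thesis
      unfolding X' prod.case by (rule UN_eq_const[OF frac_self[OF b]])
  qed
  show ?thesis
    unfolding fractions_def monoid.simps by (rule UN_eq_const[OF frac_self[OF a] H])
qed

lemma frac_neg:
  assumes a: "a \<in> carrier A" "s \<in> S"
  shows "\<boxminus>\<^bsub>fractions A S\<^esub> (frac A S a s) = frac A S (\<boxminus> a) s"
proof -
  have H: "(case X of (a', s') \<Rightarrow> frac A S (\<boxminus> a') s') = frac A S (\<boxminus> a) s"
    if X: "X \<in> frac A S a s" for X
  proof -
    obtain a' s' where X': "X = (a', s')" by (cases X)
    then have a': "a' \<in> carrier A" "s' \<in> S" "frac A S a' s' = frac A S a s"
      using X mem_frac_iff[OF a] by auto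
    then obtain u where u: "u \<in> S" "a' \<otimes> s \<otimes> u = a \<otimes> s' \<otimes> u" using frac_eq_iff a by blast
    then have "(\<boxminus> a') \<otimes> s \<otimes> u = (\<boxminus> a) \<otimes> s' \<otimes> u" using a a' u S_closed by (simp add: hneg_mult_left)
    then show ?thesis using X' a a' u frac_eq_iff[of "\<boxminus> a'" s' "\<boxminus> a" s] by auto
  qed
  show ?thesis
    unfolding fractions_def multiring.simps by (rule UN_eq_const[OF frac_self[OF a] H])
qed

text \<open>
  A change of representatives is an equality after multiplication by an element of \<open>S\<close>. The three
  multipliers and the old denominators all go into the new witness.
\<close>

lemma frac_hadd_iff:
  assumes a: "a \<in> carrier A" "s \<in> S" and b: "b \<in> carrier A" "t \<in> S" and c: "c \<in> carrier A" "u \<in> S"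
  shows "frac A S a s \<in> frac A S b t \<boxplus>\<^bsub>fractions A S\<^esub> frac A S c u \<longleftrightarrow>
    (\<exists>v \<in> S. a \<otimes> t \<otimes> u \<otimes> v \<in> (b \<otimes> s \<otimes> u \<otimes> v) \<boxplus> (c \<otimes> s \<otimes> t \<otimes> v))" (is "?L \<longleftrightarrow> ?R")
proof
  assume ?L
  then obtain a' s' b' t' c' u' v where mem: "a' \<in> carrier A" "s' \<in> S" "v \<in> S"
      and a': "frac A S a s = frac A S a' s'"
      and b': "(b', t') \<in> frac A S b t" and c': "(c', u') \<in> frac A S c u"
      and h: "a' \<otimes> t' \<otimes> u' \<otimes> v \<in> (b' \<otimes> s' \<otimes> u' \<otimes> v) \<boxplus> (c' \<otimes> s' \<otimes> t' \<otimes> v)"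
    unfolding fractions_def by auto
  have b'': "b' \<in> carrier A" "t' \<in> S" "frac A S b t = frac A S b' t'"
    using b' mem_frac_iff[OF b] by auto
  have c'': "c' \<in> carrier A" "u' \<in> S" "frac A S c u = frac A S c' u'"
    using c' mem_frac_iff[OF c] by auto
  obtain k l m where k: "k \<in> S" "a \<otimes> s' \<otimes> k = a' \<otimes> s \<otimes> k"
      and l: "l \<in> S" "b \<otimes> t' \<otimes> l = b' \<otimes> t \<otimes> l" and m: "m \<in> S" "c \<otimes> u' \<otimes> m = c' \<otimes> u \<otimes> m"
    using a' b'' c'' a b c mem frac_eq_iff by metis
  note car = a(1) b(1) c(1) mem(1) b''(1) c''(1)
    a(2)[THEN S_closed] b(2)[THEN S_closed] c(2)[THEN S_closed] mem(2,3)[THEN S_closed]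
    b''(2)[THEN S_closed] c''(2)[THEN S_closed] k(1)[THEN S_closed] l(1)[THEN S_closed] m(1)[THEN S_closed]
  let ?r = "s \<otimes> t \<otimes> u \<otimes> k \<otimes> l \<otimes> m" and ?V = "s' \<otimes> t' \<otimes> u' \<otimes> v \<otimes> k \<otimes> l \<otimes> m"
  have h': "a' \<otimes> t' \<otimes> u' \<otimes> v \<otimes> ?r \<in> (b' \<otimes> s' \<otimes> u' \<otimes> v \<otimes> ?r) \<boxplus> (c' \<otimes> s' \<otimes> t' \<otimes> v \<otimes> ?r)"
    by (rule hadd_mult[OF _ _ _ _ h]) (use car in simp_all)
  have "a' \<otimes> t' \<otimes> u' \<otimes> v \<otimes> ?r = (a' \<otimes> s \<otimes> k) \<otimes> (t' \<otimes> u' \<otimes> v \<otimes> t \<otimes> u \<otimes> l \<otimes> m)"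
    using car by (simp add: m_ac)
  also have "\<dots> = a \<otimes> t \<otimes> u \<otimes> ?V" unfolding k(2)[symmetric] using car by (simp add: m_ac)
  finally have 1: "a' \<otimes> t' \<otimes> u' \<otimes> v \<otimes> ?r = a \<otimes> t \<otimes> u \<otimes> ?V" .
  have "b' \<otimes> s' \<otimes> u' \<otimes> v \<otimes> ?r = (b' \<otimes> t \<otimes> l) \<otimes> (s' \<otimes> u' \<otimes> v \<otimes> s \<otimes> u \<otimes> k \<otimes> m)"
    using car by (simp add: m_ac)
  also have "\<dots> = b \<otimes> s \<otimes> u \<otimes> ?V" unfolding l(2)[symmetric] using car by (simp add: m_ac)
  finally have 2: "b' \<otimes> s' \<otimes> u' \<otimes> v \<otimes> ?r = b \<otimes> s \<otimes> u \<otimes> ?V" .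
  have "c' \<otimes> s' \<otimes> t' \<otimes> v \<otimes> ?r = (c' \<otimes> u \<otimes> m) \<otimes> (s' \<otimes> t' \<otimes> v \<otimes> s \<otimes> t \<otimes> k \<otimes> l)"
    using car by (simp add: m_ac)
  also have "\<dots> = c \<otimes> s \<otimes> t \<otimes> ?V" unfolding m(2)[symmetric] using car by (simp add: m_ac)
  finally have 3: "c' \<otimes> s' \<otimes> t' \<otimes> v \<otimes> ?r = c \<otimes> s \<otimes> t \<otimes> ?V" .
  have "?V \<in> S" by (intro mult_S mem b''(2) c''(2) k(1) l(1) m(1))
  then show ?R using h' unfolding 1 2 3 by blast
next
  assume ?R
  then show ?L
    unfolding fractions_def multiring.simps using a frac_self[OF b] frac_self[OF c] by blast
qed

lemma frac_hadd_of_mem: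
  assumes "a \<in> b \<boxplus> c" and b: "b \<in> carrier A" and c: "c \<in> carrier A" and s: "s \<in> S"
  shows "frac A S a s \<in> frac A S b s \<boxplus>\<^bsub>fractions A S\<^esub> frac A S c s"
proof -
  have a: "a \<in> carrier A" using assms by blast
  have "a \<otimes> (s \<otimes> s) \<in> (b \<otimes> (s \<otimes> s)) \<boxplus> (c \<otimes> (s \<otimes> s))"
    by (rule hadd_mult[OF a b c _ assms(1)]) (use s S_closed in simp)
  then have "a \<otimes> s \<otimes> s \<otimes> \<one> \<in> (b \<otimes> s \<otimes> s \<otimes> \<one>) \<boxplus> (c \<otimes> s \<otimes> s \<otimes> \<one>)"
    using a b c S_closed[OF s] by (simp add: m_assoc)
  then show ?thesis using frac_hadd_iff[OF a s b s c s] one_S by blast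
qed

lemma fractions_hadd_closed: "X \<boxplus>\<^bsub>fractions A S\<^esub> Y \<subseteq> carrier (fractions A S)"
proof
  fix Z assume "Z \<in> X \<boxplus>\<^bsub>fractions A S\<^esub> Y"
  then show "Z \<in> carrier (fractions A S)"
    unfolding fractions_carrier unfolding fractions_def multiring.simps by blast
qed

text \<open>
  Together with \<open>frac_expand\<close> and \<open>common_denominator\<close>, this fact reduces each axiom for
  fractions to the same axiom for numerators: an element of a sum is the class of an element of the sum of the numerators, after
  these have been brought to a suitable common denominator.
\<close>

lemma frac_hadd_repr:
  assumes b: "b \<in> carrier A" and c: "c \<in> carrier A" and s: "s \<in> S"
    and X: "X \<in> frac A S b s \<boxplus>\<^bsub>fractions A S\<^esub> frac A S c s"
  shows "\<exists>v \<in> S. \<exists>d \<in> (b \<otimes> v) \<boxplus> (c \<otimes> v). X = frac A S d (s \<otimes> v)"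
proof -
  obtain x r where x: "x \<in> carrier A" "r \<in> S" "X = frac A S x r"
    using X fractions_hadd_closed fractions_carrier by blast
  then obtain v where v: "v \<in> S"
      "x \<otimes> s \<otimes> s \<otimes> v \<in> (b \<otimes> r \<otimes> s \<otimes> v) \<boxplus> (c \<otimes> r \<otimes> s \<otimes> v)"
    using X frac_hadd_iff[OF x(1,2) b s c s] by blast
  note car = b c x(1) s[THEN S_closed] x(2)[THEN S_closed] v(1)[THEN S_closed]
  have "frac A S (x \<otimes> (s \<otimes> s \<otimes> v)) (r \<otimes> (s \<otimes> s \<otimes> v)) = X"
    unfolding x(3) by (intro frac_expand x(1,2) mult_S s v(1))
  moreover have "r \<otimes> (s \<otimes> s \<otimes> v) = s \<otimes> (r \<otimes> s \<otimes> v)" using car by (simp add: m_ac)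
  moreover have "x \<otimes> (s \<otimes> s \<otimes> v) \<in> (b \<otimes> (r \<otimes> s \<otimes> v)) \<boxplus> (c \<otimes> (r \<otimes> s \<otimes> v))"
    using v(2) car by (simp add: m_assoc)
  moreover have "r \<otimes> s \<otimes> v \<in> S" by (intro mult_S x(2) s v(1))
  ultimately show ?thesis by metis
qed

lemma common_denominator:
  assumes "finite F" "F \<subseteq> carrier (fractions A S)"
  shows "\<exists>s \<in> S. \<forall>X \<in> F. \<exists>a \<in> carrier A. X = frac A S a s"
  using assms
proof (induction F)
  case empty
  then show ?case using one_S by blast
next
  case (insert X F)
  then obtain s where s: "s \<in> S" "\<And>Y. Y \<in> F \<Longrightarrow> \<exists>a \<in> carrier A. Y = frac A S a s" by auto
  obtain b t where b: "b \<in> carrier A" "t \<in> S" "X = frac A S b t"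
    using insert.prems fractions_carrier[of X] by auto
  have "\<exists>a \<in> carrier A. Y = frac A S a (s \<otimes> t)" if Y: "Y \<in> insert X F" for Y
  proof (cases "Y = X")
    case True
    then have "Y = frac A S (b \<otimes> s) (s \<otimes> t)"
      using frac_expand[OF b(1,2) s(1)] b(3) m_comm[OF S_closed[OF b(2)] S_closed[OF s(1)]] by simp
    moreover have "b \<otimes> s \<in> carrier A" using b(1) S_closed[OF s(1)] by simp
    ultimately show ?thesis by blast
  next
    case False
    then obtain a where a: "a \<in> carrier A" "Y = frac A S a s" using s Y by blast
    then have "Y = frac A S (a \<otimes> t) (s \<otimes> t)" using frac_expand[OF a(1) s(1) b(2)] by simp
    moreover have "a \<otimes> t \<in> carrier A" using a(1) S_closed[OF b(2)] by simp
    ultimately show ?thesis by blast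
  qed
  then show ?case using mult_S s b by blast
qed

lemma common_denominator3:
  assumes "X \<in> carrier (fractions A S)" "Y \<in> carrier (fractions A S)" "Z \<in> carrier (fractions A S)"
  obtains a b c s where "a \<in> carrier A" "b \<in> carrier A" "c \<in> carrier A" "s \<in> S"
    "X = frac A S a s" "Y = frac A S b s" "Z = frac A S c s"
proof -
  obtain s where s: "s \<in> S" "\<forall>W \<in> {X, Y, Z}. \<exists>a \<in> carrier A. W = frac A S a s"
    using common_denominator[of "{X, Y, Z}"] assms by auto
  obtain a where a: "a \<in> carrier A" "X = frac A S a s" using s(2) by blast
  obtain b where b: "b \<in> carrier A" "Y = frac A S b s" using s(2) by blast
  obtain c where c: "c \<in> carrier A" "Z = frac A S c s" using s(2) by blast
  show thesis by (rule that[OF a(1) b(1) c(1) s(1) a(2) b(2) c(2)])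
qed

lemma frac_zero_eq: "s \<in> S \<Longrightarrow> frac A S \<zero> s = \<zero>\<^bsub>fractions A S\<^esub>"
  unfolding frac_zero using frac_eq_iff[of \<zero> s \<zero> \<one>] one_S S_closed[of s]
  by (auto del: hadd_mem_carrier)

theorem multiring_fractions: "multiring (fractions A S)" (is "multiring ?F")
proof (intro multiring.intro comm_monoidI multiring_axioms.intro)
  fix X Y assume XY: "X \<in> carrier ?F" "Y \<in> carrier ?F"
  obtain a b s where ab: "a \<in> carrier A" "b \<in> carrier A" and s: "s \<in> S"
      and X: "X = frac A S a s" and Y: "Y = frac A S b s"
    using common_denominator3[OF XY XY(2)] by metis
  show "X \<otimes>\<^bsub>?F\<^esub> Y \<in> carrier ?F" "X \<otimes>\<^bsub>?F\<^esub> Y = Y \<otimes>\<^bsub>?F\<^esub> X"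
    unfolding X Y using ab s by (simp_all add: frac_mult m_comm[of a b] frac_carrierI mult_S)
  show "X \<boxplus>\<^bsub>?F\<^esub> Y \<subseteq> carrier ?F" by (rule fractions_hadd_closed)
  obtain d where "d \<in> a \<boxplus> b" using hadd_nonempty ab by blast
  then show "X \<boxplus>\<^bsub>?F\<^esub> Y \<noteq> {}" unfolding X Y using frac_hadd_of_mem[OF _ ab s] by blast
  show "X \<in> Y \<boxplus>\<^bsub>?F\<^esub> \<zero>\<^bsub>?F\<^esub> \<longleftrightarrow> X = Y"
  proof
    assume "X \<in> Y \<boxplus>\<^bsub>?F\<^esub> \<zero>\<^bsub>?F\<^esub>"
    then obtain v d where v: "v \<in> S" "d \<in> (b \<otimes> v) \<boxplus> (\<zero> \<otimes> v)" "X = frac A S d (s \<otimes> v)"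
      using frac_hadd_repr[OF ab(2) hzero_closed s] unfolding Y frac_zero_eq[OF s] by blast
    have "d = b \<otimes> v" using v ab S_closed hadd_zero_right by simp
    then show "X = Y" unfolding v Y using frac_expand ab s v by simp
  next
    assume "X = Y"
    then show "X \<in> Y \<boxplus>\<^bsub>?F\<^esub> \<zero>\<^bsub>?F\<^esub>"
      using frac_hadd_of_mem[OF mem_hadd_zero[OF ab(2)] ab(2) hzero_closed s]
      unfolding Y frac_zero_eq[OF s] by simp
  qed
  show "X \<boxplus>\<^bsub>?F\<^esub> Y = Y \<boxplus>\<^bsub>?F\<^esub> X"
  proof -
    have "W \<boxplus>\<^bsub>?F\<^esub> Z \<subseteq> Z \<boxplus>\<^bsub>?F\<^esub> W" if WZ: "W \<in> carrier ?F" "Z \<in> carrier ?F" for W Z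
    proof
      fix U assume U: "U \<in> W \<boxplus>\<^bsub>?F\<^esub> Z"
      obtain w z s where wz: "w \<in> carrier A" "z \<in> carrier A" and s: "s \<in> S"
          and W: "W = frac A S w s" and Z: "Z = frac A S z s"
        using common_denominator3[OF WZ WZ(2)] by metis
      obtain v d where v: "v \<in> S" "d \<in> (w \<otimes> v) \<boxplus> (z \<otimes> v)" "U = frac A S d (s \<otimes> v)"
        using frac_hadd_repr[OF wz s] U unfolding W Z by blast
      have wz': "w \<otimes> v \<in> carrier A" "z \<otimes> v \<in> carrier A" using wz S_closed[OF v(1)] by simp_all
      then have "d \<in> (z \<otimes> v) \<boxplus> (w \<otimes> v)" using v hadd_comm by blast
      then have "U \<in> frac A S (z \<otimes> v) (s \<otimes> v) \<boxplus>\<^bsub>?F\<^esub> frac A S (w \<otimes> v) (s \<otimes> v)"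
        unfolding v(3) by (rule frac_hadd_of_mem[OF _ wz'(2,1) mult_S[OF s v(1)]])
      then show "U \<in> Z \<boxplus>\<^bsub>?F\<^esub> W" unfolding W Z by (simp add: frac_expand wz s v(1))
    qed
    then show ?thesis using XY by blast
  qed
next
  fix X assume "X \<in> carrier ?F"
  then obtain a s where a: "a \<in> carrier A" "s \<in> S" and X: "X = frac A S a s"
    unfolding fractions_carrier by blast
  show "\<one>\<^bsub>?F\<^esub> \<otimes>\<^bsub>?F\<^esub> X = X"
    unfolding X frac_one using a S_closed[OF a(2)] by (simp add: frac_mult one_S)
  show "X \<otimes>\<^bsub>?F\<^esub> \<zero>\<^bsub>?F\<^esub> = \<zero>\<^bsub>?F\<^esub>"
    using a S_closed[OF a(2)] frac_zero_eq[OF a(2)] unfolding X frac_zero by (simp add: frac_mult one_S)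
  show "\<boxminus>\<^bsub>?F\<^esub> X \<in> carrier ?F"
    unfolding X frac_neg[OF a] by (intro frac_carrierI hneg_closed a)
next
  fix X Y Z assume "X \<in> carrier ?F" "Y \<in> carrier ?F" "Z \<in> carrier ?F"
  then obtain a b c s where abc: "a \<in> carrier A" "b \<in> carrier A" "c \<in> carrier A" and s: "s \<in> S"
      and X: "X = frac A S a s" and Y: "Y = frac A S b s" and Z: "Z = frac A S c s"
    by (rule common_denominator3)
  note sc = S_closed[OF s]
  show "X \<otimes>\<^bsub>?F\<^esub> Y \<otimes>\<^bsub>?F\<^esub> Z = X \<otimes>\<^bsub>?F\<^esub> (Y \<otimes>\<^bsub>?F\<^esub> Z)"
    unfolding X Y Z using abc s sc by (simp add: frac_mult mult_S m_assoc)
  show "Z \<in> \<boxminus>\<^bsub>?F\<^esub> Y \<boxplus>\<^bsub>?F\<^esub> X \<and> Y \<in> X \<boxplus>\<^bsub>?F\<^esub> \<boxminus>\<^bsub>?F\<^esub> Z" if XYZ: "X \<in> Y \<boxplus>\<^bsub>?F\<^esub> Z"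
  proof -
    obtain v d where v: "v \<in> S" "d \<in> (b \<otimes> v) \<boxplus> (c \<otimes> v)" "X = frac A S d (s \<otimes> v)"
      using frac_hadd_repr[OF abc(2,3) s] XYZ unfolding Y Z by blast
    have bc: "b \<otimes> v \<in> carrier A" "c \<otimes> v \<in> carrier A" "s \<otimes> v \<in> S"
      using abc S_closed[OF v(1)] mult_S[OF s v(1)] by simp_all
    have d: "d \<in> carrier A" using v(2) bc(1,2) by (rule hadd_mem_carrier)
    have YZ: "Y = frac A S (b \<otimes> v) (s \<otimes> v)" "Z = frac A S (c \<otimes> v) (s \<otimes> v)"
      unfolding Y Z by (simp_all add: frac_expand abc s v(1))
    show ?thesis
      unfolding YZ v(3) using bc d hadd_rev_left[OF v(2) bc(1,2)] hadd_rev_right[OF v(2) bc(1,2)]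
      by (simp add: frac_neg frac_hadd_of_mem)
  qed
  show "\<exists>H \<in> Y \<boxplus>\<^bsub>?F\<^esub> Z. W \<in> X \<boxplus>\<^bsub>?F\<^esub> H" if G: "G \<in> X \<boxplus>\<^bsub>?F\<^esub> Y" and W: "W \<in> G \<boxplus>\<^bsub>?F\<^esub> Z" for G W
  proof -
    obtain v d where v: "v \<in> S" "d \<in> (a \<otimes> v) \<boxplus> (b \<otimes> v)" "G = frac A S d (s \<otimes> v)"
      using frac_hadd_repr[OF abc(1,2) s] G unfolding X Y by blast
    have vc: "v \<in> carrier A" "a \<otimes> v \<in> carrier A" "b \<otimes> v \<in> carrier A" "c \<otimes> v \<in> carrier A" "s \<otimes> v \<in> S"
      using abc S_closed[OF v(1)] mult_S[OF s v(1)] by simp_all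
    have d: "d \<in> carrier A" using v(2) vc(2,3) by (rule hadd_mem_carrier)
    have Z': "Z = frac A S (c \<otimes> v) (s \<otimes> v)" unfolding Z by (simp add: frac_expand abc s v(1))
    obtain w e where w: "w \<in> S" "e \<in> (d \<otimes> w) \<boxplus> (c \<otimes> v \<otimes> w)" "W = frac A S e (s \<otimes> v \<otimes> w)"
      using frac_hadd_repr[OF d vc(4,5)] W unfolding v(3) Z' by blast
    have wc: "w \<in> carrier A" "a \<otimes> v \<otimes> w \<in> carrier A" "b \<otimes> v \<otimes> w \<in> carrier A"
        "c \<otimes> v \<otimes> w \<in> carrier A" "s \<otimes> v \<otimes> w \<in> S"
      using vc S_closed[OF w(1)] mult_S[OF vc(5) w(1)] by simp_all
    have "d \<otimes> w \<in> (a \<otimes> v \<otimes> w) \<boxplus> (b \<otimes> v \<otimes> w)" using hadd_mult[OF d vc(2,3) wc(1) v(2)] .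
    then obtain h where h: "h \<in> (b \<otimes> v \<otimes> w) \<boxplus> (c \<otimes> v \<otimes> w)" "e \<in> (a \<otimes> v \<otimes> w) \<boxplus> h"
      using hadd_assoc[OF wc(2-4) _ w(2)] by blast
    have hc: "h \<in> carrier A" using h(1) wc(3,4) by (rule hadd_mem_carrier)
    have e: "X = frac A S (a \<otimes> v \<otimes> w) (s \<otimes> v \<otimes> w)" "Y = frac A S (b \<otimes> v \<otimes> w) (s \<otimes> v \<otimes> w)"
        "Z = frac A S (c \<otimes> v \<otimes> w) (s \<otimes> v \<otimes> w)"
      unfolding X Y Z using abc s v(1) w(1) vc by (simp_all add: frac_expand)
    show ?thesis
      unfolding e w(3)
      using frac_hadd_of_mem[OF h(1) wc(3-5)] frac_hadd_of_mem[OF h(2) wc(2) hc wc(5)] by blast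
  qed
  show "X \<otimes>\<^bsub>?F\<^esub> W \<in> Y \<otimes>\<^bsub>?F\<^esub> W \<boxplus>\<^bsub>?F\<^esub> Z \<otimes>\<^bsub>?F\<^esub> W" if W: "W \<in> carrier ?F" and XYZ: "X \<in> Y \<boxplus>\<^bsub>?F\<^esub> Z" for W
  proof -
    obtain w r where w: "w \<in> carrier A" "r \<in> S" and W: "W = frac A S w r"
      using W unfolding fractions_carrier by blast
    obtain v d where v: "v \<in> S" "d \<in> (b \<otimes> v) \<boxplus> (c \<otimes> v)" "X = frac A S d (s \<otimes> v)"
      using frac_hadd_repr[OF abc(2,3) s] XYZ unfolding Y Z by blast
    have bc: "b \<otimes> v \<in> carrier A" "c \<otimes> v \<in> carrier A" "s \<otimes> v \<in> S" "s \<otimes> v \<otimes> r \<in> S"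
      using abc S_closed[OF v(1)] mult_S[OF s v(1)] mult_S[OF mult_S[OF s v(1)] w(2)] by simp_all
    have d: "d \<in> carrier A" using v(2) bc(1,2) by (rule hadd_mem_carrier)
    have YZ: "Y = frac A S (b \<otimes> v) (s \<otimes> v)" "Z = frac A S (c \<otimes> v) (s \<otimes> v)"
      unfolding Y Z by (simp_all add: frac_expand abc s v(1))
    have "d \<otimes> w \<in> (b \<otimes> v \<otimes> w) \<boxplus> (c \<otimes> v \<otimes> w)" using hadd_mult[OF d bc(1,2) w(1) v(2)] .
    then have "frac A S (d \<otimes> w) (s \<otimes> v \<otimes> r) \<in>
        frac A S (b \<otimes> v \<otimes> w) (s \<otimes> v \<otimes> r) \<boxplus>\<^bsub>?F\<^esub> frac A S (c \<otimes> v \<otimes> w) (s \<otimes> v \<otimes> r)"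
      by (rule frac_hadd_of_mem) (use bc w in simp_all)
    then show ?thesis
      unfolding YZ v(3) W using bc d w by (simp add: frac_mult)
  qed
qed (simp_all add: frac_one frac_zero frac_carrierI one_S)

end

section \<open>The residue hyperfields\<close>

locale hyperfield = multiring +
  assumes one_neq_zero: "\<one> \<noteq> \<zero>"
    and inverse_ex: "\<lbrakk>a \<in> carrier A; a \<noteq> \<zero>\<rbrakk> \<Longrightarrow> \<exists>b \<in> carrier A. a \<otimes> b = \<one>"
begin

lemma hyperfield_cancel:
  assumes "a \<otimes> b = a \<otimes> c" "a \<in> carrier A" "a \<noteq> \<zero>" "b \<in> carrier A" "c \<in> carrier A"
  shows "b = c"
proof -
  obtain i where i: "i \<in> carrier A" "a \<otimes> i = \<one>" using inverse_ex assms(2,3) by blast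
  have *: "x = i \<otimes> (a \<otimes> x)" if "x \<in> carrier A" for x
  proof -
    have "i \<otimes> (a \<otimes> x) = (a \<otimes> i) \<otimes> x" using i(1) assms(2) that by (simp add: m_ac)
    then show ?thesis using i(2) that by simp
  qed
  show ?thesis using *[OF assms(4)] *[OF assms(5)] assms(1) by simp
qed

lemma mult_eq_zero:
  assumes "a \<otimes> b = \<zero>" "a \<in> carrier A" "b \<in> carrier A"
  shows "a = \<zero> \<or> b = \<zero>"
  using hyperfield_cancel[of a b \<zero>] assms by auto

text \<open>
  Division by a nonzero \<open>d\<close> turns an element of \<open>b d + c d\<close> into one of \<open>b + c\<close>. For \<open>d = 0\<close> the sum
  \<open>b d + c d\<close> contains only zero, and any element of \<open>b + c\<close> serves.
\<close>

lemma hadd_mult_converse_hyperfield: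
  assumes "b \<in> carrier A" "c \<in> carrier A" "d \<in> carrier A" "x \<in> (b \<otimes> d) \<boxplus> (c \<otimes> d)"
  shows "\<exists>a \<in> b \<boxplus> c. x = a \<otimes> d"
proof (cases "d = \<zero>")
  case True
  obtain a where a: "a \<in> b \<boxplus> c" using hadd_nonempty assms by blast
  have "a \<in> carrier A" using a assms(1,2) by (rule hadd_mem_carrier)
  moreover have "x = \<zero>" using assms(1,2,4) True hadd_zero_right[of x \<zero>] by simp
  ultimately show ?thesis using a True by (intro bexI[of _ a]) simp_all
next
  case False
  then obtain i where i: "i \<in> carrier A" "d \<otimes> i = \<one>" using inverse_ex assms by blast
  have x: "x \<in> carrier A"
    by (rule hadd_mem_carrier[OF assms(4)]) (use assms in simp_all)
  have e: "z \<otimes> d \<otimes> i = z" "z \<otimes> i \<otimes> d = z" if "z \<in> carrier A" for z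
    using that i assms(3) m_assoc[of z d i] m_assoc[of z i d] m_comm[of i d] by simp_all
  have "x \<otimes> i \<in> (b \<otimes> d \<otimes> i) \<boxplus> (c \<otimes> d \<otimes> i)"
    by (rule hadd_mult[OF x _ _ i(1) assms(4)]) (use assms in simp_all)
  then have "x \<otimes> i \<in> b \<boxplus> c" using e assms(1,2) by simp
  then show ?thesis using e(2)[OF x] by (intro bexI[of _ "x \<otimes> i"]) simp_all
qed

end

lemma specD:
  assumes "p \<in> mr_spec A"
  shows "mr_ideal A p" "\<one>\<^bsub>A\<^esub> \<notin> p"
    "\<And>a b. \<lbrakk>a \<otimes>\<^bsub>A\<^esub> b \<in> p; a \<in> carrier A; b \<in> carrier A\<rbrakk> \<Longrightarrow> a \<in> p \<or> b \<in> p"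
  using assms unfolding mr_spec_def by blast+

context multiring
begin

lemma spec_mult_notin:
  "\<lbrakk>p \<in> mr_spec A; a \<in> carrier A - p; b \<in> carrier A - p\<rbrakk> \<Longrightarrow> a \<otimes> b \<in> carrier A - p"
  using specD(3) by fastforce

lemma quot_class_eq_zero_iff:
  "\<lbrakk>mr_ideal A I; a \<in> carrier A\<rbrakk> \<Longrightarrow> quot_class A I a = \<zero>\<^bsub>quotient_multiring A I\<^esub> \<longleftrightarrow> a \<in> I"
  unfolding quot_zero using quot_class_eq_iff[of I a \<zero>] hadd_zero_left ideal_carrier mem_zero_hadd
  by (metis hzero_closed)

lemma residue_denoms_iff:
  assumes "p \<in> mr_spec A"
  shows "X \<in> residue_denoms A p \<longleftrightarrow> (\<exists>y \<in> carrier A - p. X = quot_class A p y)"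
  using quot_class_eq_zero_iff[OF specD(1)[OF assms]]
  unfolding residue_denoms_def quot_carrier by blast

lemma residue_denoms_eq: "p \<in> mr_spec A \<Longrightarrow> residue_denoms A p = quot_class A p ` (carrier A - p)"
  using residue_denoms_iff by blast

lemma residue_multiplicative:
  assumes p: "p \<in> mr_spec A"
  shows "multiplicative_set (quotient_multiring A p) (residue_denoms A p)"
proof -
  note I = specD(1)[OF p]
  show ?thesis
  proof (intro multiplicative_set.intro multiplicative_set_axioms.intro quotient_multiring[OF I])
    show "residue_denoms A p \<subseteq> carrier (quotient_multiring A p)" unfolding residue_denoms_def by blast
    show "\<one>\<^bsub>quotient_multiring A p\<^esub> \<in> residue_denoms A p"
      unfolding residue_denoms_iff[OF p] quot_one using specD(2)[OF p] by blast
    show "s \<otimes>\<^bsub>quotient_multiring A p\<^esub> t \<in> residue_denoms A p"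
      if st: "s \<in> residue_denoms A p" "t \<in> residue_denoms A p" for s t
    proof -
      obtain y z where "y \<in> carrier A - p" "s = quot_class A p y" "z \<in> carrier A - p" "t = quot_class A p z"
        using st unfolding residue_denoms_iff[OF p] by blast
      moreover from this have "s \<otimes>\<^bsub>quotient_multiring A p\<^esub> t = quot_class A p (y \<otimes> z)"
        by (simp add: quot_mult[OF I])
      ultimately show ?thesis
        unfolding residue_denoms_iff[OF p] using spec_mult_notin[OF p] by blast
    qed
  qed
qed

lemma residue_denomI: "\<lbrakk>p \<in> mr_spec A; y \<in> carrier A; y \<notin> p\<rbrakk> \<Longrightarrow> quot_class A p y \<in> residue_denoms A p"
  using residue_denoms_iff by blast

lemma residue_carrier:
  assumes p: "p \<in> mr_spec A"
  shows "X \<in> carrier (residue_field A p) \<longleftrightarrow> (\<exists>x \<in> carrier A. \<exists>y \<in> carrier A - p. X = residue_frac A p x y)"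
proof -
  interpret F: multiplicative_set "quotient_multiring A p" "residue_denoms A p"
    by (rule residue_multiplicative[OF p])
  show ?thesis
    unfolding residue_field_def F.fractions_carrier residue_frac_def
    unfolding residue_denoms_eq[OF p] quot_carrier bex_simps(7) ..
qed

lemma residue_fracI:
  "\<lbrakk>p \<in> mr_spec A; x \<in> carrier A; y \<in> carrier A; y \<notin> p\<rbrakk>
    \<Longrightarrow> residue_frac A p x y \<in> carrier (residue_field A p)"
  using residue_carrier by blast

lemma residue_mult:
  assumes p: "p \<in> mr_spec A" and "x \<in> carrier A" "y \<in> carrier A" "y \<notin> p"
    "z \<in> carrier A" "w \<in> carrier A" "w \<notin> p"
  shows "residue_frac A p x y \<otimes>\<^bsub>residue_field A p\<^esub> residue_frac A p z w
    = residue_frac A p (x \<otimes> z) (y \<otimes> w)"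
proof -
  interpret F: multiplicative_set "quotient_multiring A p" "residue_denoms A p"
    by (rule residue_multiplicative[OF p])
  show ?thesis
    unfolding residue_field_def residue_frac_def using assms
    by (simp add: F.frac_mult residue_denomI quot_carrierI quot_mult[OF specD(1)[OF p]])
qed

lemma residue_neg:
  assumes p: "p \<in> mr_spec A" and "x \<in> carrier A" "y \<in> carrier A" "y \<notin> p"
  shows "\<boxminus>\<^bsub>residue_field A p\<^esub> (residue_frac A p x y) = residue_frac A p (\<boxminus> x) y"
proof -
  interpret F: multiplicative_set "quotient_multiring A p" "residue_denoms A p"
    by (rule residue_multiplicative[OF p])
  show ?thesis
    unfolding residue_field_def residue_frac_def using assms
    by (simp add: F.frac_neg residue_denomI quot_carrierI quot_neg[OF specD(1)[OF p]])
qed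

lemma residue_one: "\<one>\<^bsub>residue_field A p\<^esub> = residue_frac A p \<one> \<one>"
  and residue_zero: "\<zero>\<^bsub>residue_field A p\<^esub> = residue_frac A p \<zero> \<one>"
  unfolding residue_field_def residue_frac_def fractions_def by (simp_all add: quot_one quot_zero)

text \<open>
  The witnesses \<open>v\<close> and \<open>i\<close> below serve for every prime \<open>q\<close> with \<open>v \<notin> q\<close> and \<open>i \<in> q\<close>. This is why
  additive relations between fractions are open conditions in the constructible topology.
\<close>

lemma residue_hadd_iff:
  assumes p: "p \<in> mr_spec A" and x: "x \<in> carrier A" "y \<in> carrier A" "y \<notin> p"
    and x': "x' \<in> carrier A" "y' \<in> carrier A" "y' \<notin> p"
    and x'': "x'' \<in> carrier A" "y'' \<in> carrier A" "y'' \<notin> p"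
  shows "residue_frac A p x y \<in> residue_frac A p x' y' \<boxplus>\<^bsub>residue_field A p\<^esub> residue_frac A p x'' y'' \<longleftrightarrow>
    (\<exists>v \<in> carrier A - p. \<exists>d \<in> (x' \<otimes> y \<otimes> y'' \<otimes> v) \<boxplus> (x'' \<otimes> y \<otimes> y' \<otimes> v).
      \<exists>i \<in> p. x \<otimes> y' \<otimes> y'' \<otimes> v \<in> d \<boxplus> i)"
proof -
  note I = specD(1)[OF p]
  interpret F: multiplicative_set "quotient_multiring A p" "residue_denoms A p"
    by (rule residue_multiplicative[OF p])
  let ?Q = "quotient_multiring A p" and ?c = "quot_class A p"
  have "residue_frac A p x y \<in> residue_frac A p x' y' \<boxplus>\<^bsub>residue_field A p\<^esub> residue_frac A p x'' y'' \<longleftrightarrow>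
      (\<exists>V \<in> residue_denoms A p. ?c x \<otimes>\<^bsub>?Q\<^esub> ?c y' \<otimes>\<^bsub>?Q\<^esub> ?c y'' \<otimes>\<^bsub>?Q\<^esub> V \<in>
        (?c x' \<otimes>\<^bsub>?Q\<^esub> ?c y \<otimes>\<^bsub>?Q\<^esub> ?c y'' \<otimes>\<^bsub>?Q\<^esub> V) \<boxplus>\<^bsub>?Q\<^esub> (?c x'' \<otimes>\<^bsub>?Q\<^esub> ?c y \<otimes>\<^bsub>?Q\<^esub> ?c y' \<otimes>\<^bsub>?Q\<^esub> V))"
    unfolding residue_field_def residue_frac_def
    by (rule F.frac_hadd_iff) (intro quot_carrierI residue_denomI p x x' x'')+
  also have "\<dots> \<longleftrightarrow> (\<exists>v \<in> carrier A - p. ?c (x \<otimes> y' \<otimes> y'' \<otimes> v) \<in>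
        ?c (x' \<otimes> y \<otimes> y'' \<otimes> v) \<boxplus>\<^bsub>?Q\<^esub> ?c (x'' \<otimes> y \<otimes> y' \<otimes> v))"
    unfolding residue_denoms_eq[OF p] bex_simps(7)
    by (intro bex_cong refl) (use x x' x'' in \<open>simp add: quot_mult[OF I]\<close>)
  also have "\<dots> \<longleftrightarrow> (\<exists>v \<in> carrier A - p. \<exists>d \<in> (x' \<otimes> y \<otimes> y'' \<otimes> v) \<boxplus> (x'' \<otimes> y \<otimes> y' \<otimes> v).
      \<exists>i \<in> p. x \<otimes> y' \<otimes> y'' \<otimes> v \<in> d \<boxplus> i)"
    by (intro bex_cong refl quot_hadd_iff[OF I]) (use x x' x'' in simp_all)
  finally show ?thesis .
qed

lemma multiring_residue_field: "p \<in> mr_spec A \<Longrightarrow> multiring (residue_field A p)"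
  unfolding residue_field_def by (rule multiplicative_set.multiring_fractions[OF residue_multiplicative])

text \<open>Equality is the additive relation \<open>X \<in> Y + 0\<close>, and so it is an open condition as well.\<close>

lemma residue_eq_iff:
  assumes p: "p \<in> mr_spec A" and X: "X \<in> carrier (residue_field A p)" and Y: "Y \<in> carrier (residue_field A p)"
  shows "X = Y \<longleftrightarrow> X \<in> Y \<boxplus>\<^bsub>residue_field A p\<^esub> \<zero>\<^bsub>residue_field A p\<^esub>"
  using multiring.hadd_zero[OF multiring_residue_field[OF p] X Y] by simp

lemma residue_frac_eqI:
  assumes p: "p \<in> mr_spec A" and x: "x \<in> carrier A" "y \<in> carrier A" "y \<notin> p"
    and z: "z \<in> carrier A" "w \<in> carrier A" "w \<notin> p" and e: "x \<otimes> w = z \<otimes> y"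
  shows "residue_frac A p x y = residue_frac A p z w"
proof -
  have "x \<otimes> w \<otimes> \<one> \<otimes> \<one> \<in> (z \<otimes> y \<otimes> \<one> \<otimes> \<one>) \<boxplus> (\<zero> \<otimes> y \<otimes> w \<otimes> \<one>)"
    using x z e mem_hadd_zero[of "z \<otimes> y"] by simp
  moreover have "x \<otimes> w \<otimes> \<one> \<otimes> \<one> \<in> (x \<otimes> w \<otimes> \<one> \<otimes> \<one>) \<boxplus> \<zero>"
    by (rule mem_hadd_zero) (use x z in simp)
  moreover have "\<one> \<in> carrier A - p" "\<zero> \<in> p"
    using specD(2)[OF p] ideal_zero[OF specD(1)[OF p]] by blast+
  ultimately show ?thesis
    unfolding residue_eq_iff[OF p residue_fracI[OF p x] residue_fracI[OF p z]] residue_zero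
      residue_hadd_iff[OF p x z hzero_closed one_closed specD(2)[OF p]] by blast
qed

lemma residue_frac_eq_zero_iff:
  assumes p: "p \<in> mr_spec A" and x: "x \<in> carrier A" "y \<in> carrier A" "y \<notin> p"
  shows "residue_frac A p x y = \<zero>\<^bsub>residue_field A p\<^esub> \<longleftrightarrow> x \<in> p"
proof -
  note I = specD(1)[OF p]
  interpret F: multiplicative_set "quotient_multiring A p" "residue_denoms A p"
    by (rule residue_multiplicative[OF p])
  let ?Q = "quotient_multiring A p" and ?c = "quot_class A p"
  have "residue_frac A p x y = \<zero>\<^bsub>residue_field A p\<^esub> \<longleftrightarrow>
      (\<exists>V \<in> residue_denoms A p. ?c x \<otimes>\<^bsub>?Q\<^esub> \<one>\<^bsub>?Q\<^esub> \<otimes>\<^bsub>?Q\<^esub> V = \<zero>\<^bsub>?Q\<^esub> \<otimes>\<^bsub>?Q\<^esub> ?c y \<otimes>\<^bsub>?Q\<^esub> V)"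
    unfolding residue_field_def F.frac_zero residue_frac_def
    by (rule F.frac_eq_iff) (intro quot_carrierI residue_denomI p x F.hzero_closed F.one_S)+
  also have "\<dots> \<longleftrightarrow> (\<exists>v \<in> carrier A - p. ?c (x \<otimes> v) = \<zero>\<^bsub>?Q\<^esub>)"
    unfolding residue_denoms_eq[OF p] bex_simps(7)
    by (intro bex_cong refl)
      (use x in \<open>simp add: quot_mult[OF I] quot_carrierI\<close>)
  also have "\<dots> \<longleftrightarrow> (\<exists>v \<in> carrier A - p. x \<otimes> v \<in> p)"
    by (intro bex_cong refl quot_class_eq_zero_iff[OF I]) (use x in simp)
  also have "\<dots> \<longleftrightarrow> x \<in> p"
  proof
    assume "\<exists>v \<in> carrier A - p. x \<otimes> v \<in> p"
    then show "x \<in> p" using specD(3)[OF p _ x(1)] by blast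
  next
    assume "x \<in> p"
    then have "x \<otimes> \<one> \<in> p" by (rule ideal_mult_right[OF I _ one_closed])
    then show "\<exists>v \<in> carrier A - p. x \<otimes> v \<in> p" using specD(2)[OF p] one_closed by blast
  qed
  finally show ?thesis .
qed

lemma hyperfield_residue_field:
  assumes p: "p \<in> mr_spec A"
  shows "hyperfield (residue_field A p)"
proof (intro hyperfield.intro hyperfield_axioms.intro multiring_residue_field[OF p])
  show "\<one>\<^bsub>residue_field A p\<^esub> \<noteq> \<zero>\<^bsub>residue_field A p\<^esub>"
    unfolding residue_one using residue_frac_eq_zero_iff[OF p, of \<one> \<one>] specD(2)[OF p] by simp
  fix X assume X: "X \<in> carrier (residue_field A p)" "X \<noteq> \<zero>\<^bsub>residue_field A p\<^esub>"
  then obtain x y where x: "x \<in> carrier A" "y \<in> carrier A" "y \<notin> p" "X = residue_frac A p x y"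
    unfolding residue_carrier[OF p] by blast
  then have xp: "x \<notin> p" using X(2) residue_frac_eq_zero_iff[OF p] by blast
  have "X \<otimes>\<^bsub>residue_field A p\<^esub> residue_frac A p y x = residue_frac A p (x \<otimes> y) (y \<otimes> x)"
    unfolding x(4) by (rule residue_mult[OF p]) (use x xp in simp_all)
  also have "\<dots> = \<one>\<^bsub>residue_field A p\<^esub>"
    unfolding residue_one
    by (rule residue_frac_eqI[OF p]) (use x xp spec_mult_notin[OF p, of y x] specD(2)[OF p] in \<open>simp_all add: m_comm\<close>)
  finally show "\<exists>Y \<in> carrier (residue_field A p). X \<otimes>\<^bsub>residue_field A p\<^esub> Y = \<one>\<^bsub>residue_field A p\<^esub>"
    using residue_fracI[OF p x(2,1) xp] by blast
qed

end

section \<open>The constructible topology is compact\<close>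

context multiring
begin

lemma topspace_constructible [simp]: "topspace (constructible_topology A) = mr_spec A"
proof -
  have "basic_open A \<one> = mr_spec A" unfolding basic_open_def using specD(2) by blast
  then show ?thesis
    unfolding constructible_topology_def topology_generated_by_topspace
    by (auto simp: basic_open_def intro!: bexI[of _ \<one>] del: hadd_mem_carrier)
qed

lemma openin_basic: "a \<in> carrier A \<Longrightarrow> openin (constructible_topology A) (basic_open A a)"
  and openin_cobasic: "a \<in> carrier A \<Longrightarrow> openin (constructible_topology A) (mr_spec A - basic_open A a)"
  unfolding constructible_topology_def by (intro topology_generated_by_Basis; blast)+

lemma closedin_basic:
  assumes "a \<in> carrier A"
  shows "closedin (constructible_topology A) (basic_open A a)"
    and "closedin (constructible_topology A) (mr_spec A - basic_open A a)"
proof -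
  have "mr_spec A - (mr_spec A - basic_open A a) = basic_open A a" unfolding basic_open_def by blast
  then show "closedin (constructible_topology A) (basic_open A a)"
    using openin_cobasic[OF assms] unfolding closedin_def by (auto simp: basic_open_def)
  show "closedin (constructible_topology A) (mr_spec A - basic_open A a)"
    using openin_basic[OF assms] by (metis openin_closedin_eq topspace_constructible closedin_diff closedin_topspace)
qed

text \<open>
  The generating sets come in complementary pairs, so they are clopen.
\<close>

lemma constructible_clopen_base:
  assumes "openin (constructible_topology A) U" "p \<in> U"
  shows "\<exists>W. openin (constructible_topology A) W \<and> closedin (constructible_topology A) W \<and> p \<in> W \<and> W \<subseteq> U"
proof -
  have "generate_topology_on
      (basic_open A ` carrier A \<union> (\<lambda>a. mr_spec A - basic_open A a) ` carrier A) U"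
    using assms(1) unfolding constructible_topology_def openin_topology_generated_by_iff .
  then show ?thesis using assms(2)
  proof induction
    case Empty
    then show ?case by simp
  next
    case (Int a b)
    obtain W1 W2 where "openin (constructible_topology A) W1" "closedin (constructible_topology A) W1" "p \<in> W1" "W1 \<subseteq> a"
        and "openin (constructible_topology A) W2" "closedin (constructible_topology A) W2" "p \<in> W2" "W2 \<subseteq> b"
      using Int by blast
    then show ?case by (intro exI[of _ "W1 \<inter> W2"]) auto
  next
    case (UN K)
    then obtain k where k: "k \<in> K" "p \<in> k" by blast
    then obtain W where "openin (constructible_topology A) W" "closedin (constructible_topology A) W" "p \<in> W" "W \<subseteq> k"
      using UN.IH by blast
    then show ?case using k by blast
  next
    case (Basis s)
    then have "openin (constructible_topology A) s \<and> closedin (constructible_topology A) s"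
      using openin_basic openin_cobasic closedin_basic by blast
    then show ?case using Basis by blast
  qed
qed

lemma mr_spec_iff:
  assumes "p \<subseteq> carrier A"
  shows "p \<in> mr_spec A \<longleftrightarrow> \<zero> \<in> p \<and> \<one> \<notin> p \<and>
    (\<forall>a \<in> carrier A. \<forall>b \<in> carrier A. \<forall>c \<in> a \<boxplus> b. a \<in> p \<longrightarrow> b \<in> p \<longrightarrow> c \<in> p) \<and>
    (\<forall>a \<in> carrier A. \<forall>b \<in> carrier A. b \<in> p \<longrightarrow> a \<otimes> b \<in> p) \<and>
    (\<forall>a \<in> carrier A. \<forall>b \<in> carrier A. a \<otimes> b \<in> p \<longrightarrow> a \<in> p \<or> b \<in> p)" (is "_ \<longleftrightarrow> ?R")
proof
  assume "p \<in> mr_spec A"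
  note s = specD(1,2)[OF this] specD(3)[OF this]
  show ?R
    using ideal_zero[OF s(1)] s(2,3) ideal_hadd[OF s(1)] ideal_mult[OF s(1)] by blast
next
  assume R: ?R
  have "mr_ideal A p"
    unfolding mr_ideal_def
  proof (intro conjI ballI assms)
    show "p \<noteq> {}" using R by blast
    show "a \<boxplus> b \<subseteq> p" if "a \<in> p" "b \<in> p" for a b
    proof
      fix x assume "x \<in> a \<boxplus> b"
      then show "x \<in> p" using R that subsetD[OF assms that(1)] subsetD[OF assms that(2)] by blast
    qed
    show "a \<otimes> b \<in> p" if "a \<in> carrier A" "b \<in> p" for a b
      using R that subsetD[OF assms that(2)] by blast
  qed
  then show "p \<in> mr_spec A" unfolding mr_spec_def using R by blast
qed

text \<open>
  A prime ideal is a subset of the carrier satisfying conditions that each involve finitely many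
  memberships. Hence the prime ideals form a closed subset of a power of the two-point space, which
  is compact by Tychonoff's theorem.
\<close>

theorem compact_constructible: "compact_space (constructible_topology A)"
proof -
  define Y where "Y = product_topology (\<lambda>_. discrete_topology (UNIV :: bool set)) (carrier A)"
  define \<psi> where "\<psi> \<chi> = {a \<in> carrier A. \<chi> a}" for \<chi> :: "'a \<Rightarrow> bool"
  define C where "C = {\<chi> \<in> topspace Y. \<psi> \<chi> \<in> mr_spec A}"
  have top_Y: "topspace Y = (\<Pi>\<^sub>E a \<in> carrier A. UNIV)" unfolding Y_def by simp
  define lit where "lit a v = {\<chi> \<in> topspace Y. \<chi> a \<in> {v}}" for a v
  have lit: "openin Y (lit a v)" if "a \<in> carrier A" for a v
    unfolding lit_def Y_def
    by (rule openin_continuous_map_preimage[OF continuous_map_product_projection[OF that]]) simp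
  have "compact_space Y"
    unfolding Y_def by (simp add: compact_space_product_topology compact_space_discrete_topology)
  moreover have "closedin Y C"
  proof -
    have "\<exists>T. openin Y T \<and> \<chi> \<in> T \<and> T \<subseteq> topspace Y - C" if \<chi>: "\<chi> \<in> topspace Y - C" for \<chi>
    proof -
      have sub: "\<psi> \<xi> \<subseteq> carrier A" for \<xi> unfolding \<psi>_def by blast
      have in_C: "\<xi> \<in> C \<longleftrightarrow> \<xi> \<in> topspace Y \<and> \<xi> \<zero> \<and> \<not> \<xi> \<one> \<and>
          (\<forall>a \<in> carrier A. \<forall>b \<in> carrier A. \<forall>c \<in> a \<boxplus> b. \<xi> a \<longrightarrow> \<xi> b \<longrightarrow> \<xi> c) \<and>
          (\<forall>a \<in> carrier A. \<forall>b \<in> carrier A. \<xi> b \<longrightarrow> \<xi> (a \<otimes> b)) \<and>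
          (\<forall>a \<in> carrier A. \<forall>b \<in> carrier A. \<xi> (a \<otimes> b) \<longrightarrow> \<xi> a \<or> \<xi> b)" for \<xi>
      proof -
        have mem: "a \<in> \<psi> \<xi> \<longleftrightarrow> \<xi> a" if "a \<in> carrier A" for a using that unfolding \<psi>_def by blast
        have "(\<forall>c \<in> a \<boxplus> b. a \<in> \<psi> \<xi> \<longrightarrow> b \<in> \<psi> \<xi> \<longrightarrow> c \<in> \<psi> \<xi>) \<longleftrightarrow> (\<forall>c \<in> a \<boxplus> b. \<xi> a \<longrightarrow> \<xi> b \<longrightarrow> \<xi> c)"
          if "a \<in> carrier A" "b \<in> carrier A" for a b
          using mem that hadd_mem_carrier[OF _ that] by blast
        then show ?thesis
          unfolding C_def mem_Collect_eq mr_spec_iff[OF sub] using mem by simp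
      qed
      have pt: "\<chi> \<in> topspace Y" using \<chi> by blast
      \<comment> \<open>A violated condition involves at most three coordinates, and fixing these keeps it violated.\<close>
      have "\<not> \<chi> \<zero> \<or> \<chi> \<one> \<or>
          (\<exists>a \<in> carrier A. \<exists>b \<in> carrier A. \<exists>c \<in> a \<boxplus> b. \<chi> a \<and> \<chi> b \<and> \<not> \<chi> c) \<or>
          (\<exists>a \<in> carrier A. \<exists>b \<in> carrier A. \<chi> b \<and> \<not> \<chi> (a \<otimes> b)) \<or>
          (\<exists>a \<in> carrier A. \<exists>b \<in> carrier A. \<chi> (a \<otimes> b) \<and> \<not> \<chi> a \<and> \<not> \<chi> b)"
        using \<chi> in_C[of \<chi>] by blast
      then consider "\<not> \<chi> \<zero>" | "\<chi> \<one>"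
        | a b c where "a \<in> carrier A" "b \<in> carrier A" "c \<in> a \<boxplus> b" "\<chi> a" "\<chi> b" "\<not> \<chi> c"
        | a b where "a \<in> carrier A" "b \<in> carrier A" "\<chi> b" "\<not> \<chi> (a \<otimes> b)"
        | a b where "a \<in> carrier A" "b \<in> carrier A" "\<chi> (a \<otimes> b)" "\<not> \<chi> a" "\<not> \<chi> b"
        by blast
      then show ?thesis
      proof cases
        case 1
        have "\<xi> \<notin> C" if "\<not> \<xi> \<zero>" for \<xi> using in_C[of \<xi>] that by blast
        then have "lit \<zero> False \<subseteq> topspace Y - C" unfolding lit_def by blast
        moreover have "\<chi> \<in> lit \<zero> False" using 1 pt by (simp add: lit_def)
        ultimately show ?thesis using lit[OF hzero_closed] by blast
      next
        case 2
        have "\<xi> \<notin> C" if "\<xi> \<one>" for \<xi> using in_C[of \<xi>] that by blast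
        then have "lit \<one> True \<subseteq> topspace Y - C" unfolding lit_def by blast
        moreover have "\<chi> \<in> lit \<one> True" using 2 pt by (simp add: lit_def)
        ultimately show ?thesis using lit[OF one_closed] by blast
      next
        case (3 a b c)
        have c: "c \<in> carrier A" using 3(3,1,2) by (rule hadd_mem_carrier)
        have "\<xi> \<notin> C" if "\<xi> a" "\<xi> b" "\<not> \<xi> c" for \<xi> using in_C[of \<xi>] 3(1-3) that by blast
        then have "lit a True \<inter> lit b True \<inter> lit c False \<subseteq> topspace Y - C"
          unfolding lit_def by blast
        moreover have "openin Y (lit a True \<inter> lit b True \<inter> lit c False)"
          by (intro openin_Int lit 3 c)
        moreover have "\<chi> \<in> lit a True \<inter> lit b True \<inter> lit c False" using 3(4-6) pt by (simp add: lit_def)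
        ultimately show ?thesis by blast
      next
        case (4 a b)
        have "\<xi> \<notin> C" if "\<xi> b" "\<not> \<xi> (a \<otimes> b)" for \<xi> using in_C[of \<xi>] 4(1,2) that by blast
        then have "lit b True \<inter> lit (a \<otimes> b) False \<subseteq> topspace Y - C"
          unfolding lit_def by blast
        moreover have "openin Y (lit b True \<inter> lit (a \<otimes> b) False)"
          by (intro openin_Int lit 4 m_closed)
        moreover have "\<chi> \<in> lit b True \<inter> lit (a \<otimes> b) False" using 4(3,4) pt by (simp add: lit_def)
        ultimately show ?thesis by blast
      next
        case (5 a b)
        have "\<xi> \<notin> C" if "\<xi> (a \<otimes> b)" "\<not> \<xi> a" "\<not> \<xi> b" for \<xi> using in_C[of \<xi>] 5(1,2) that by blast
        then have "lit (a \<otimes> b) True \<inter> lit a False \<inter> lit b False \<subseteq> topspace Y - C"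
          unfolding lit_def by blast
        moreover have "openin Y (lit (a \<otimes> b) True \<inter> lit a False \<inter> lit b False)"
          by (intro openin_Int lit 5 m_closed)
        moreover have "\<chi> \<in> lit (a \<otimes> b) True \<inter> lit a False \<inter> lit b False"
          using 5(3-5) pt by (simp add: lit_def)
        ultimately show ?thesis by blast
      qed
    qed
    then have "openin Y (topspace Y - C)" by (subst openin_subopen) blast
    then show ?thesis unfolding closedin_def C_def by blast
  qed
  ultimately have comp: "compactin Y C" by (rule closedin_compact_space)
  have top_C: "topspace (subtopology Y C) = C" unfolding C_def by auto
  have \<psi>_spec: "\<psi> ` C = mr_spec A"
  proof
    show "mr_spec A \<subseteq> \<psi> ` C"
    proof
      fix p assume p: "p \<in> mr_spec A"
      have "p \<subseteq> carrier A" using ideal_carrier[OF specD(1)[OF p]] by blast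
      then have e: "\<psi> (\<lambda>a \<in> carrier A. a \<in> p) = p" unfolding \<psi>_def by auto
      then have "(\<lambda>a \<in> carrier A. a \<in> p) \<in> C" unfolding C_def top_Y using p by auto
      then show "p \<in> \<psi> ` C" using e by (metis imageI)
    qed
  qed (auto simp: C_def)
  have "continuous_map (subtopology Y C) (constructible_topology A) \<psi>"
    unfolding constructible_topology_def
  proof (rule continuous_on_generated_topo)
    fix U assume "U \<in> basic_open A ` carrier A \<union> (\<lambda>a. mr_spec A - basic_open A a) ` carrier A"
    then obtain a where a: "a \<in> carrier A" "U = basic_open A a \<or> U = mr_spec A - basic_open A a" by blast
    have "\<psi> -` basic_open A a \<inter> C = lit a False \<inter> C" "\<psi> -` (mr_spec A - basic_open A a) \<inter> C = lit a True \<inter> C"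
      unfolding lit_def basic_open_def C_def \<psi>_def using a(1) by auto
    then have "\<psi> -` U \<inter> C = lit a False \<inter> C \<or> \<psi> -` U \<inter> C = lit a True \<inter> C" using a(2) by blast
    then show "openin (subtopology Y C) (\<psi> -` U \<inter> topspace (subtopology Y C))"
      unfolding top_C openin_subtopology using lit[OF a(1)] by blast
  next
    have "\<Union> (basic_open A ` carrier A \<union> (\<lambda>a. mr_spec A - basic_open A a) ` carrier A) = mr_spec A"
      using topspace_constructible unfolding constructible_topology_def topology_generated_by_topspace .
    then show "\<psi> ` topspace (subtopology Y C) \<subseteq>
        \<Union> (basic_open A ` carrier A \<union> (\<lambda>a. mr_spec A - basic_open A a) ` carrier A)"
      unfolding top_C using \<psi>_spec by simp
  qed
  then have "compactin (constructible_topology A) (\<psi> ` C)"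
    by (rule image_compactin[rotated]) (simp add: comp compactin_subtopology)
  then show ?thesis unfolding \<psi>_spec compact_space_def by simp
qed

end

section \<open>Germs of fractions and gluing\<close>

abbreviation near :: "('a, 'm) multiring_scheme \<Rightarrow> 'a set \<Rightarrow> 'a set filter" where
  "near A p \<equiv> nhdsin (constructible_topology A) p"

text \<open>
  Neighbourhood filters take the place of the clopen sets in the definition of constructible sections.
  The conditions agree because of \<open>constructible_clopen_base\<close>, and several local conditions
  combine as eventual properties without intersecting their domains by hand.
\<close>

definition fraction_germ ::
    "('a, 'm) multiring_scheme \<Rightarrow> 'a set \<Rightarrow> ('a set \<Rightarrow> ('a set \<times> 'a set) set) \<Rightarrow> bool" where
  "fraction_germ A p f \<longleftrightarrow> (\<exists>x \<in> carrier A. \<exists>y \<in> carrier A.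
    \<forall>\<^sub>F q in near A p. y \<notin> q \<and> f q = residue_frac A q x y)"

context multiring
begin

lemma near_iff:
  "p \<in> mr_spec A \<Longrightarrow> eventually P (near A p) \<longleftrightarrow>
    (\<exists>U. openin (constructible_topology A) U \<and> p \<in> U \<and> (\<forall>q \<in> U. P q))"
  by (simp add: eventually_nhdsin)

lemma near_self: "\<lbrakk>eventually P (near A p); p \<in> mr_spec A\<rbrakk> \<Longrightarrow> P p"
  using near_iff by blast

lemma near_spec: "p \<in> mr_spec A \<Longrightarrow> \<forall>\<^sub>F q in near A p. q \<in> mr_spec A"
  unfolding near_iff using openin_topspace[of "constructible_topology A"] topspace_constructible by metis

lemma near_notin: "\<lbrakk>p \<in> mr_spec A; a \<in> carrier A; a \<notin> p\<rbrakk> \<Longrightarrow> \<forall>\<^sub>F q in near A p. a \<notin> q"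
  unfolding near_iff
  by (intro exI[of _ "basic_open A a"] conjI openin_basic) (simp_all add: basic_open_def)

lemma near_in:
  assumes "p \<in> mr_spec A" "a \<in> p"
  shows "\<forall>\<^sub>F q in near A p. a \<in> q"
proof -
  have "a \<in> carrier A" using ideal_carrier[OF specD(1)[OF assms(1)] assms(2)] .
  then show ?thesis
    unfolding near_iff[OF assms(1)] using assms
    by (intro exI[of _ "mr_spec A - basic_open A a"] conjI openin_cobasic) (auto simp: basic_open_def)
qed

lemma fraction_germI:
  assumes "p \<in> mr_spec A" "x \<in> carrier A" "y \<in> carrier A" "y \<notin> p"
    "\<forall>\<^sub>F q in near A p. f q = residue_frac A q x y"
  shows "fraction_germ A p f"
  unfolding fraction_germ_def
  by (intro bexI[of _ x] bexI[of _ y] eventually_conj near_notin assms)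

lemma fraction_germE:
  assumes "fraction_germ A p f" "p \<in> mr_spec A"
  obtains x y where "x \<in> carrier A" "y \<in> carrier A" "y \<notin> p"
    "\<forall>\<^sub>F q in near A p. q \<in> mr_spec A \<and> y \<notin> q \<and> f q = residue_frac A q x y"
proof -
  obtain x y where x: "x \<in> carrier A" "y \<in> carrier A"
      "\<forall>\<^sub>F q in near A p. y \<notin> q \<and> f q = residue_frac A q x y"
    using assms(1) unfolding fraction_germ_def by blast
  show thesis
    by (rule that[OF x(1,2) _ eventually_conj[OF near_spec[OF assms(2)] x(3)]])
      (use near_self[OF x(3) assms(2)] in blast)
qed

lemma fraction_germ_residue:
  "\<lbrakk>p \<in> mr_spec A; x \<in> carrier A; y \<in> carrier A; y \<notin> p\<rbrakk>
    \<Longrightarrow> fraction_germ A p (\<lambda>q. residue_frac A q x y)"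
  by (rule fraction_germI[of p x y]) simp_all

lemma fraction_germ_cong:
  assumes "p \<in> mr_spec A" "fraction_germ A p f" "\<forall>\<^sub>F q in near A p. g q = f q"
  shows "fraction_germ A p g"
proof -
  obtain x y where x: "x \<in> carrier A" "y \<in> carrier A" "y \<notin> p"
      "\<forall>\<^sub>F q in near A p. q \<in> mr_spec A \<and> y \<notin> q \<and> f q = residue_frac A q x y"
    using fraction_germE[OF assms(2,1)] .
  show ?thesis
    by (rule fraction_germI[OF assms(1) x(1-3)])
      (use x(4) assms(3) in \<open>eventually_elim, simp\<close>)
qed

lemma fraction_germ_mult:
  assumes p: "p \<in> mr_spec A" and f: "fraction_germ A p f" and g: "fraction_germ A p g"
  shows "fraction_germ A p (\<lambda>q. f q \<otimes>\<^bsub>residue_field A q\<^esub> g q)"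
proof -
  obtain x y where x: "x \<in> carrier A" "y \<in> carrier A" "y \<notin> p"
      "\<forall>\<^sub>F q in near A p. q \<in> mr_spec A \<and> y \<notin> q \<and> f q = residue_frac A q x y"
    using fraction_germE[OF f p] .
  obtain z w where z: "z \<in> carrier A" "w \<in> carrier A" "w \<notin> p"
      "\<forall>\<^sub>F q in near A p. q \<in> mr_spec A \<and> w \<notin> q \<and> g q = residue_frac A q z w"
    using fraction_germE[OF g p] .
  show ?thesis
  proof (rule fraction_germI[OF p])
    show "x \<otimes> z \<in> carrier A" using x z by simp
    show "y \<otimes> w \<in> carrier A" "y \<otimes> w \<notin> p" using spec_mult_notin[OF p, of y w] x z by simp_all
    show "\<forall>\<^sub>F q in near A p. f q \<otimes>\<^bsub>residue_field A q\<^esub> g q = residue_frac A q (x \<otimes> z) (y \<otimes> w)"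
      using x(4) z(4) by eventually_elim (simp add: residue_mult x(1,2) z(1,2))
  qed
qed

lemma fraction_germ_neg:
  assumes p: "p \<in> mr_spec A" and f: "fraction_germ A p f"
  shows "fraction_germ A p (\<lambda>q. \<boxminus>\<^bsub>residue_field A q\<^esub> (f q))"
proof -
  obtain x y where x: "x \<in> carrier A" "y \<in> carrier A" "y \<notin> p"
      "\<forall>\<^sub>F q in near A p. q \<in> mr_spec A \<and> y \<notin> q \<and> f q = residue_frac A q x y"
    using fraction_germE[OF f p] .
  show ?thesis
    by (rule fraction_germI[OF p, of "\<boxminus> x" y])
      (use x(1-3) in simp_all, use x(4) in \<open>eventually_elim, simp add: residue_neg x(1,2)\<close>)
qed

lemma fraction_germ_one: "p \<in> mr_spec A \<Longrightarrow> fraction_germ A p (\<lambda>q. \<one>\<^bsub>residue_field A q\<^esub>)"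
  and fraction_germ_zero: "p \<in> mr_spec A \<Longrightarrow> fraction_germ A p (\<lambda>q. \<zero>\<^bsub>residue_field A q\<^esub>)"
  unfolding residue_one residue_zero by (simp_all add: fraction_germ_residue specD(2))

lemma fraction_germ_carrier:
  assumes p: "p \<in> mr_spec A" and f: "fraction_germ A p f"
  shows "f p \<in> carrier (residue_field A p)"
    and "\<forall>\<^sub>F q in near A p. f q \<in> carrier (residue_field A q)"
proof -
  obtain x y where x: "x \<in> carrier A" "y \<in> carrier A" "y \<notin> p"
      "\<forall>\<^sub>F q in near A p. q \<in> mr_spec A \<and> y \<notin> q \<and> f q = residue_frac A q x y"
    using fraction_germE[OF f p] .
  then show *: "\<forall>\<^sub>F q in near A p. f q \<in> carrier (residue_field A q)"
    by (auto elim: eventually_mono simp: residue_fracI)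
  show "f p \<in> carrier (residue_field A p)" using near_self[OF * p] .
qed

text \<open>
  The witnesses \<open>v \<notin> p\<close> and \<open>i \<in> p\<close> of the relation at \<open>p\<close> satisfy \<open>v \<notin> q\<close> and \<open>i \<in> q\<close> for all \<open>q\<close> near \<open>p\<close>, so
  that they witness it there as well.
\<close>

lemma near_hadd:
  assumes p: "p \<in> mr_spec A" and f: "fraction_germ A p f" and g: "fraction_germ A p g"
    and h: "fraction_germ A p h" and mem: "f p \<in> g p \<boxplus>\<^bsub>residue_field A p\<^esub> h p"
  shows "\<forall>\<^sub>F q in near A p. f q \<in> g q \<boxplus>\<^bsub>residue_field A q\<^esub> h q"
proof -
  obtain x y where x: "x \<in> carrier A" "y \<in> carrier A" "y \<notin> p"
      "\<forall>\<^sub>F q in near A p. q \<in> mr_spec A \<and> y \<notin> q \<and> f q = residue_frac A q x y"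
    using fraction_germE[OF f p] .
  obtain x' y' where x': "x' \<in> carrier A" "y' \<in> carrier A" "y' \<notin> p"
      "\<forall>\<^sub>F q in near A p. q \<in> mr_spec A \<and> y' \<notin> q \<and> g q = residue_frac A q x' y'"
    using fraction_germE[OF g p] .
  obtain x'' y'' where x'': "x'' \<in> carrier A" "y'' \<in> carrier A" "y'' \<notin> p"
      "\<forall>\<^sub>F q in near A p. q \<in> mr_spec A \<and> y'' \<notin> q \<and> h q = residue_frac A q x'' y''"
    using fraction_germE[OF h p] .
  obtain v d i where v: "v \<in> carrier A - p" "d \<in> (x' \<otimes> y \<otimes> y'' \<otimes> v) \<boxplus> (x'' \<otimes> y \<otimes> y' \<otimes> v)"
      "i \<in> p" "x \<otimes> y' \<otimes> y'' \<otimes> v \<in> d \<boxplus> i"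
    using mem near_self[OF x(4) p] near_self[OF x'(4) p] near_self[OF x''(4) p]
      residue_hadd_iff[OF p x(1-3) x'(1-3) x''(1-3)] by auto
  have "\<forall>\<^sub>F q in near A p. v \<notin> q" "\<forall>\<^sub>F q in near A p. i \<in> q"
    using near_notin[OF p] near_in[OF p v(3)] v(1) by blast+
  then show ?thesis
    using x(4) x'(4) x''(4)
  proof eventually_elim
    case (elim q)
    then have "residue_frac A q x y \<in> residue_frac A q x' y' \<boxplus>\<^bsub>residue_field A q\<^esub> residue_frac A q x'' y''"
      using residue_hadd_iff[OF _ x(1,2) _ x'(1,2) _ x''(1,2), of q] v by blast
    then show ?case using elim by simp
  qed
qed

lemma near_eq:
  assumes p: "p \<in> mr_spec A" and f: "fraction_germ A p f" and g: "fraction_germ A p g" and "f p = g p"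
  shows "\<forall>\<^sub>F q in near A p. f q = g q"
proof -
  have "f p \<in> g p \<boxplus>\<^bsub>residue_field A p\<^esub> \<zero>\<^bsub>residue_field A p\<^esub>"
    using assms(4) residue_eq_iff[OF p] fraction_germ_carrier(1)[OF p] f g by blast
  from near_hadd[OF p f g fraction_germ_zero[OF p] this]
    fraction_germ_carrier(2)[OF p f] fraction_germ_carrier(2)[OF p g] near_spec[OF p]
  show ?thesis by eventually_elim (simp add: residue_eq_iff)
qed

lemma near_nonzero:
  assumes p: "p \<in> mr_spec A" and f: "fraction_germ A p f" and nz: "f p \<noteq> \<zero>\<^bsub>residue_field A p\<^esub>"
  shows "\<forall>\<^sub>F q in near A p. f q \<noteq> \<zero>\<^bsub>residue_field A q\<^esub>"
proof -
  obtain x y where x: "x \<in> carrier A" "y \<in> carrier A" "y \<notin> p"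
      "\<forall>\<^sub>F q in near A p. q \<in> mr_spec A \<and> y \<notin> q \<and> f q = residue_frac A q x y"
    using fraction_germE[OF f p] .
  have "x \<notin> p" using nz near_self[OF x(4) p] residue_frac_eq_zero_iff[of p x y] x(1,2) by simp
  from near_notin[OF p x(1) this] x(4)
  show ?thesis by eventually_elim (simp add: residue_frac_eq_zero_iff x(1,2))
qed

lemma constructible_sections_iff:
  "f \<in> constructible_sections A \<longleftrightarrow>
    f \<in> extensional (mr_spec A) \<and> (\<forall>p \<in> mr_spec A. fraction_germ A p f)"
proof
  assume f: "f \<in> constructible_sections A"
  have "fraction_germ A p f" if p: "p \<in> mr_spec A" for p
  proof -
    obtain U x y where U: "x \<in> carrier A" "y \<in> carrier A" "openin (constructible_topology A) U" "p \<in> U"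
        "U \<subseteq> basic_open A y" "\<forall>q \<in> U. f q = residue_frac A q x y"
      using f p unfolding constructible_sections_def by blast
    have "\<forall>q \<in> U. y \<notin> q \<and> f q = residue_frac A q x y" using U(5,6) unfolding basic_open_def by blast
    then show ?thesis unfolding fraction_germ_def near_iff[OF p] using U(1-4) by blast
  qed
  moreover have "f \<in> extensional (mr_spec A)"
    using f unfolding constructible_sections_def PiE_def by blast
  ultimately show "f \<in> extensional (mr_spec A) \<and> (\<forall>p \<in> mr_spec A. fraction_germ A p f)" by blast
next
  assume f: "f \<in> extensional (mr_spec A) \<and> (\<forall>p \<in> mr_spec A. fraction_germ A p f)"
  have "\<exists>U. \<exists>x \<in> carrier A. \<exists>y \<in> carrier A.
      openin (constructible_topology A) U \<and> closedin (constructible_topology A) U \<and>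
      p \<in> U \<and> U \<subseteq> basic_open A y \<and> (\<forall>q \<in> U. f q = residue_frac A q x y)" if p: "p \<in> mr_spec A" for p
  proof -
    have "fraction_germ A p f" using f p by blast
    then obtain x y where x: "x \<in> carrier A" "y \<in> carrier A"
        "\<forall>\<^sub>F q in near A p. q \<in> mr_spec A \<and> y \<notin> q \<and> f q = residue_frac A q x y"
      by (rule fraction_germE[OF _ p])
    then obtain U where U: "openin (constructible_topology A) U" "p \<in> U"
        "\<forall>q \<in> U. q \<in> mr_spec A \<and> y \<notin> q \<and> f q = residue_frac A q x y"
      using near_iff[OF p] by blast
    obtain W where "openin (constructible_topology A) W" "closedin (constructible_topology A) W" "p \<in> W" "W \<subseteq> U"
      using constructible_clopen_base[OF U(1,2)] by blast
    moreover from this have "W \<subseteq> basic_open A y" "\<forall>q \<in> W. f q = residue_frac A q x y"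
      using U(3) unfolding basic_open_def by blast+
    ultimately show ?thesis using x(1,2) by blast
  qed
  then show "f \<in> constructible_sections A"
    unfolding constructible_sections_def mem_Collect_eq PiE_iff
    using f fraction_germ_carrier(1)[of _ f] by simp
qed

lemma restrict_section:
  assumes f: "\<And>p. p \<in> mr_spec A \<Longrightarrow> fraction_germ A p f"
  shows "restrict f (mr_spec A) \<in> constructible_sections A"
proof -
  have "fraction_germ A p (restrict f (mr_spec A))" if p: "p \<in> mr_spec A" for p
  proof (rule fraction_germ_cong[OF p f[OF p]])
    show "\<forall>\<^sub>F q in near A p. restrict f (mr_spec A) q = f q"
      using near_spec[OF p] by eventually_elim simp
  qed
  then show ?thesis unfolding constructible_sections_iff by simp
qed

text \<open>
  By compactness finitely many local solutions on clopen sets suffice. Adding one clopen set \<open>W\<close> to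
  the domain of a solution, the new fraction is used on \<open>W\<close> and the old solution off \<open>W\<close>; both
  pieces are open, so the result is again given by fractions locally.
\<close>

lemma glue_germs:
  assumes "\<And>p. p \<in> mr_spec A \<Longrightarrow> \<exists>g. fraction_germ A p g \<and> (\<forall>\<^sub>F q in near A p. P q (g q))"
  shows "\<exists>f \<in> constructible_sections A. \<forall>p \<in> mr_spec A. P p (f p)"
proof -
  let ?X = "constructible_topology A"
  define good where "good W \<longleftrightarrow> openin ?X W \<and> closedin ?X W \<and>
    (\<exists>g. \<forall>q \<in> W. fraction_germ A q g \<and> P q (g q))" for W
  have good_ex: "\<exists>W. good W \<and> p \<in> W" if p: "p \<in> mr_spec A" for p
  proof -
    obtain g where g: "fraction_germ A p g" "\<forall>\<^sub>F q in near A p. P q (g q)" using assms p by blast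
    obtain x y where x: "x \<in> carrier A" "y \<in> carrier A"
        "\<forall>\<^sub>F q in near A p. q \<in> mr_spec A \<and> y \<notin> q \<and> g q = residue_frac A q x y"
      by (rule fraction_germE[OF g(1) p])
    have "\<forall>\<^sub>F q in near A p. fraction_germ A q (\<lambda>q. residue_frac A q x y) \<and> P q (residue_frac A q x y)"
      using x(3) g(2) by eventually_elim (simp add: fraction_germ_residue x(1,2))
    then obtain U where U: "openin ?X U" "p \<in> U"
        "\<forall>q \<in> U. fraction_germ A q (\<lambda>q. residue_frac A q x y) \<and> P q (residue_frac A q x y)"
      using near_iff[OF p] by blast
    then show ?thesis using constructible_clopen_base[OF U(1,2)] unfolding good_def by blast
  qed
  have sub: "W \<subseteq> mr_spec A" if "openin ?X W" for W using openin_subset[OF that] by simp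
  have fin: "\<exists>f. \<forall>q \<in> \<Union>\<W>. fraction_germ A q f \<and> P q (f q)"
    if "finite \<W>" "\<forall>W \<in> \<W>. good W" for \<W>
    using that
  proof (induction \<W>)
    case empty
    then show ?case by simp
  next
    case (insert W \<W>)
    then obtain f where f: "\<forall>q \<in> \<Union>\<W>. fraction_germ A q f \<and> P q (f q)" by blast
    obtain g where W: "openin ?X W" "closedin ?X W" and g: "\<forall>q \<in> W. fraction_germ A q g \<and> P q (g q)"
      using insert.prems unfolding good_def by blast
    let ?f = "\<lambda>q. if q \<in> W then g q else f q"
    have "fraction_germ A q ?f \<and> P q (?f q)" if q: "q \<in> \<Union> (insert W \<W>)" for q
    proof (cases "q \<in> W")
      case True
      then have q_spec: "q \<in> mr_spec A" using sub W by blast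
      have "\<forall>\<^sub>F r in near A q. ?f r = g r"
        unfolding near_iff[OF q_spec] using True W by (intro exI[of _ W]) auto
      then show ?thesis using True g fraction_germ_cong[OF q_spec, of g ?f] by simp
    next
      case False
      then obtain W' where "W' \<in> \<W>" "q \<in> W'" using q by blast
      then have q_spec: "q \<in> mr_spec A" using sub insert.prems unfolding good_def by blast
      have "\<forall>\<^sub>F r in near A q. ?f r = f r"
        unfolding near_iff[OF q_spec] using False W q_spec
        by (intro exI[of _ "mr_spec A - W"]) (auto simp: closedin_def)
      then show ?thesis using False q f fraction_germ_cong[OF q_spec, of f ?f] by auto
    qed
    then show ?case by blast
  qed
  have "topspace ?X \<subseteq> \<Union> {W. good W}" using good_ex by auto
  then obtain \<W> where \<W>: "finite \<W>" "\<W> \<subseteq> {W. good W}" "topspace ?X \<subseteq> \<Union>\<W>"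
    using compact_constructible unfolding compact_space_alt good_def
    by (metis (no_types, lifting) mem_Collect_eq)
  then obtain f where f: "\<forall>q \<in> \<Union>\<W>. fraction_germ A q f \<and> P q (f q)" using fin[of \<W>] by blast
  have "restrict f (mr_spec A) \<in> constructible_sections A"
    by (rule restrict_section) (use f \<W>(3) in auto)
  moreover have "\<forall>p \<in> mr_spec A. P p (restrict f (mr_spec A) p)" using f \<W>(3) by auto
  ultimately show ?thesis by blast
qed

text \<open>
  In this form the gluing lemma turns pointwise solutions into a section: it is enough that the
  condition \<open>P\<close> is open, in the sense that it spreads along germs of fractions.
\<close>

lemma section_from_pointwise:
  assumes ex: "\<And>p. p \<in> mr_spec A \<Longrightarrow> \<exists>k \<in> carrier (residue_field A p). P p k"
    and spread: "\<And>p g. \<lbrakk>p \<in> mr_spec A; fraction_germ A p g; P p (g p)\<rbrakk> \<Longrightarrow> \<forall>\<^sub>F q in near A p. P q (g q)"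
  shows "\<exists>f \<in> constructible_sections A. \<forall>p \<in> mr_spec A. P p (f p)"
proof (rule glue_germs)
  fix p assume p: "p \<in> mr_spec A"
  obtain k where k: "k \<in> carrier (residue_field A p)" "P p k" using ex[OF p] by blast
  obtain x y where x: "x \<in> carrier A" "y \<in> carrier A" "y \<notin> p" and e: "k = residue_frac A p x y"
    using k(1) residue_carrier[OF p] by blast
  have g: "fraction_germ A p (\<lambda>q. residue_frac A q x y)" by (rule fraction_germ_residue[OF p x])
  then show "\<exists>g. fraction_germ A p g \<and> (\<forall>\<^sub>F q in near A p. P q (g q))"
    using spread[OF p g] k(2) unfolding e by blast
qed

end

section \<open>The von Neumann hull is a geometric von Neumann hyperring\<close>

lemma (in hyperfield) hadd_cancel:
  assumes "a \<otimes> k \<in> (b \<otimes> k) \<boxplus> (c \<otimes> k)" "k \<noteq> \<zero>"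
    "a \<in> carrier A" "b \<in> carrier A" "c \<in> carrier A" "k \<in> carrier A"
  shows "a \<in> b \<boxplus> c"
proof -
  obtain d where d: "d \<in> b \<boxplus> c" "a \<otimes> k = d \<otimes> k"
    using hadd_mult_converse_hyperfield[OF assms(4-6,1)] by blast
  have "d \<in> carrier A" using d(1) assms(4,5) by (rule hadd_mem_carrier)
  then have "a = d" using hyperfield_cancel[of k a d] d(2) assms(2,3,6) by (simp add: m_comm)
  then show ?thesis using d(1) by simp
qed

lemma V_carrier [simp]: "carrier (V_hull A) = constructible_sections A"
  and V_mult [simp]: "p \<in> mr_spec A \<Longrightarrow> (f \<otimes>\<^bsub>V_hull A\<^esub> g) p = f p \<otimes>\<^bsub>residue_field A p\<^esub> g p"
  and V_neg [simp]: "p \<in> mr_spec A \<Longrightarrow> (\<boxminus>\<^bsub>V_hull A\<^esub> f) p = \<boxminus>\<^bsub>residue_field A p\<^esub> (f p)"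
  and V_one [simp]: "p \<in> mr_spec A \<Longrightarrow> \<one>\<^bsub>V_hull A\<^esub> p = \<one>\<^bsub>residue_field A p\<^esub>"
  and V_zero [simp]: "p \<in> mr_spec A \<Longrightarrow> \<zero>\<^bsub>V_hull A\<^esub> p = \<zero>\<^bsub>residue_field A p\<^esub>"
  and V_hadd_iff: "f \<in> g \<boxplus>\<^bsub>V_hull A\<^esub> h \<longleftrightarrow> f \<in> constructible_sections A \<and>
    (\<forall>p \<in> mr_spec A. f p \<in> g p \<boxplus>\<^bsub>residue_field A p\<^esub> h p)"
  unfolding V_hull_def by simp_all

lemma V_haddD:
  "\<lbrakk>f \<in> g \<boxplus>\<^bsub>V_hull A\<^esub> h; p \<in> mr_spec A\<rbrakk> \<Longrightarrow> f p \<in> g p \<boxplus>\<^bsub>residue_field A p\<^esub> h p"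
  unfolding V_hadd_iff by blast

context multiring
begin

lemma section_germ: "\<lbrakk>f \<in> constructible_sections A; p \<in> mr_spec A\<rbrakk> \<Longrightarrow> fraction_germ A p f"
  using constructible_sections_iff by blast

lemma section_value:
  "\<lbrakk>f \<in> constructible_sections A; p \<in> mr_spec A\<rbrakk> \<Longrightarrow> f p \<in> carrier (residue_field A p)"
  using section_germ fraction_germ_carrier(1) by blast

lemma section_ext:
  assumes "f \<in> constructible_sections A" "g \<in> constructible_sections A"
    "\<And>p. p \<in> mr_spec A \<Longrightarrow> f p = g p"
  shows "f = g"
  using assms unfolding constructible_sections_iff by (meson extensionalityI)

lemma V_closed:
  shows V_mult_closed: "\<lbrakk>f \<in> constructible_sections A; g \<in> constructible_sections A\<rbrakk>
      \<Longrightarrow> f \<otimes>\<^bsub>V_hull A\<^esub> g \<in> constructible_sections A"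
    and V_neg_closed: "f \<in> constructible_sections A \<Longrightarrow> \<boxminus>\<^bsub>V_hull A\<^esub> f \<in> constructible_sections A"
    and V_one_closed: "\<one>\<^bsub>V_hull A\<^esub> \<in> constructible_sections A"
    and V_zero_closed: "\<zero>\<^bsub>V_hull A\<^esub> \<in> constructible_sections A"
  unfolding V_hull_def monoid.simps multiring.simps
  by (intro restrict_section fraction_germ_mult fraction_germ_neg fraction_germ_one fraction_germ_zero;
      simp add: section_germ)+

text \<open>
  The axioms with universal quantifiers hold because they hold at each point. For the ones that
  assert existence, the pointwise solutions are glued to a section.
\<close>

theorem von_Neumann_V_hull: "von_Neumann_hyperring (V_hull A)"
proof (intro von_Neumann_hyperring.intro hyperring.intro multiring.intro comm_monoidI
    multiring_axioms.intro hyperring_axioms.intro von_Neumann_hyperring_axioms.intro;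
    (unfold V_carrier)?)
  fix f g assume fg: "f \<in> constructible_sections A" "g \<in> constructible_sections A"
  note val = fg[THEN section_value]
  show "f \<otimes>\<^bsub>V_hull A\<^esub> g \<in> constructible_sections A" by (rule V_mult_closed[OF fg])
  show "f \<otimes>\<^bsub>V_hull A\<^esub> g = g \<otimes>\<^bsub>V_hull A\<^esub> f"
  proof (rule section_ext)
    fix p assume p: "p \<in> mr_spec A"
    interpret K: multiring "residue_field A p" by (rule multiring_residue_field[OF p])
    show "(f \<otimes>\<^bsub>V_hull A\<^esub> g) p = (g \<otimes>\<^bsub>V_hull A\<^esub> f) p" using p val[OF p] by (simp add: K.m_comm)
  qed (intro V_closed fg)+
  show "f \<boxplus>\<^bsub>V_hull A\<^esub> g \<subseteq> constructible_sections A" using V_hadd_iff by blast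
  have "\<exists>k \<in> constructible_sections A. \<forall>p \<in> mr_spec A. k p \<in> f p \<boxplus>\<^bsub>residue_field A p\<^esub> g p"
  proof (rule section_from_pointwise)
    fix p assume p: "p \<in> mr_spec A"
    interpret K: multiring "residue_field A p" by (rule multiring_residue_field[OF p])
    show "\<exists>k \<in> carrier (residue_field A p). k \<in> f p \<boxplus>\<^bsub>residue_field A p\<^esub> g p"
      using K.hadd_nonempty K.hadd_closed val[OF p] by blast
    show "\<forall>\<^sub>F q in near A p. k q \<in> f q \<boxplus>\<^bsub>residue_field A q\<^esub> g q"
      if "fraction_germ A p k" "k p \<in> f p \<boxplus>\<^bsub>residue_field A p\<^esub> g p" for k
      using near_hadd[OF p that(1) section_germ[OF fg(1) p] section_germ[OF fg(2) p] that(2)] .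
  qed
  then show "f \<boxplus>\<^bsub>V_hull A\<^esub> g \<noteq> {}" using V_hadd_iff by blast
  show "f \<in> g \<boxplus>\<^bsub>V_hull A\<^esub> \<zero>\<^bsub>V_hull A\<^esub> \<longleftrightarrow> f = g"
  proof -
    have "f \<in> g \<boxplus>\<^bsub>V_hull A\<^esub> \<zero>\<^bsub>V_hull A\<^esub> \<longleftrightarrow> (\<forall>p \<in> mr_spec A. f p = g p)"
      unfolding V_hadd_iff using fg(1) residue_eq_iff val by simp
    then show ?thesis using section_ext[OF fg] by auto
  qed
  show "f \<boxplus>\<^bsub>V_hull A\<^esub> g = g \<boxplus>\<^bsub>V_hull A\<^esub> f"
  proof (rule Set.set_eqI)
    fix k
    have "f p \<boxplus>\<^bsub>residue_field A p\<^esub> g p = g p \<boxplus>\<^bsub>residue_field A p\<^esub> f p" if p: "p \<in> mr_spec A" for p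
      by (rule multiring.hadd_comm[OF multiring_residue_field[OF p] val[OF p]])
    then show "k \<in> f \<boxplus>\<^bsub>V_hull A\<^esub> g \<longleftrightarrow> k \<in> g \<boxplus>\<^bsub>V_hull A\<^esub> f" unfolding V_hadd_iff by simp
  qed
next
  fix f assume f: "f \<in> constructible_sections A"
  note val = section_value[OF f]
  show "\<one>\<^bsub>V_hull A\<^esub> \<otimes>\<^bsub>V_hull A\<^esub> f = f"
  proof (rule section_ext)
    fix p assume p: "p \<in> mr_spec A"
    interpret K: multiring "residue_field A p" by (rule multiring_residue_field[OF p])
    show "(\<one>\<^bsub>V_hull A\<^esub> \<otimes>\<^bsub>V_hull A\<^esub> f) p = f p" using p val[OF p] by simp
  qed (intro V_closed f)+
  show "f \<otimes>\<^bsub>V_hull A\<^esub> \<zero>\<^bsub>V_hull A\<^esub> = \<zero>\<^bsub>V_hull A\<^esub>"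
  proof (rule section_ext)
    fix p assume p: "p \<in> mr_spec A"
    interpret K: multiring "residue_field A p" by (rule multiring_residue_field[OF p])
    show "(f \<otimes>\<^bsub>V_hull A\<^esub> \<zero>\<^bsub>V_hull A\<^esub>) p = \<zero>\<^bsub>V_hull A\<^esub> p" using p val[OF p] by simp
  qed (intro V_closed f)+
  show "\<boxminus>\<^bsub>V_hull A\<^esub> f \<in> constructible_sections A" by (rule V_neg_closed[OF f])
  show "\<exists>b \<in> constructible_sections A. f = f \<otimes>\<^bsub>V_hull A\<^esub> f \<otimes>\<^bsub>V_hull A\<^esub> b"
  proof -
    have "\<exists>k \<in> constructible_sections A. \<forall>p \<in> mr_spec A.
        f p = f p \<otimes>\<^bsub>residue_field A p\<^esub> f p \<otimes>\<^bsub>residue_field A p\<^esub> k p"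
    proof (rule section_from_pointwise)
      fix p assume p: "p \<in> mr_spec A"
      interpret K: hyperfield "residue_field A p" by (rule hyperfield_residue_field[OF p])
      show "\<exists>k \<in> carrier (residue_field A p).
          f p = f p \<otimes>\<^bsub>residue_field A p\<^esub> f p \<otimes>\<^bsub>residue_field A p\<^esub> k"
      proof (cases "f p = \<zero>\<^bsub>residue_field A p\<^esub>")
        case True
        then show ?thesis by (intro bexI[of _ "\<zero>\<^bsub>residue_field A p\<^esub>"]) simp_all
      next
        case False
        then obtain i where "i \<in> carrier (residue_field A p)" "f p \<otimes>\<^bsub>residue_field A p\<^esub> i = \<one>\<^bsub>residue_field A p\<^esub>"
          using K.inverse_ex val[OF p] by blast
        then show ?thesis using val[OF p] by (intro bexI[of _ i]) (simp_all add: K.m_assoc)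
      qed
      note ff = section_germ[OF f p]
      show "\<forall>\<^sub>F q in near A p. f q = f q \<otimes>\<^bsub>residue_field A q\<^esub> f q \<otimes>\<^bsub>residue_field A q\<^esub> k q"
        if "fraction_germ A p k" "f p = f p \<otimes>\<^bsub>residue_field A p\<^esub> f p \<otimes>\<^bsub>residue_field A p\<^esub> k p" for k
        using near_eq[OF p ff fraction_germ_mult[OF p fraction_germ_mult[OF p ff ff] that(1)] that(2)] .
    qed
    then obtain k where k: "k \<in> constructible_sections A"
        "\<forall>p \<in> mr_spec A. f p = f p \<otimes>\<^bsub>residue_field A p\<^esub> f p \<otimes>\<^bsub>residue_field A p\<^esub> k p" by blast
    have "f = f \<otimes>\<^bsub>V_hull A\<^esub> f \<otimes>\<^bsub>V_hull A\<^esub> k"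
    proof (rule section_ext)
      fix p assume p: "p \<in> mr_spec A"
      show "f p = (f \<otimes>\<^bsub>V_hull A\<^esub> f \<otimes>\<^bsub>V_hull A\<^esub> k) p"
        unfolding V_mult[OF p] by (rule bspec[OF k(2) p])
    qed (intro V_closed f k(1))+
    then show ?thesis using k(1) by blast
  qed
next
  fix f g h assume fgh: "f \<in> constructible_sections A" "g \<in> constructible_sections A" "h \<in> constructible_sections A"
  note val = fgh[THEN section_value]
  show "f \<otimes>\<^bsub>V_hull A\<^esub> g \<otimes>\<^bsub>V_hull A\<^esub> h = f \<otimes>\<^bsub>V_hull A\<^esub> (g \<otimes>\<^bsub>V_hull A\<^esub> h)"
  proof (rule section_ext)
    fix p assume p: "p \<in> mr_spec A"
    interpret K: multiring "residue_field A p" by (rule multiring_residue_field[OF p])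
    show "(f \<otimes>\<^bsub>V_hull A\<^esub> g \<otimes>\<^bsub>V_hull A\<^esub> h) p = (f \<otimes>\<^bsub>V_hull A\<^esub> (g \<otimes>\<^bsub>V_hull A\<^esub> h)) p"
      using p val[OF p] by (simp add: K.m_assoc)
  qed (intro V_closed fgh)+
  show "h \<in> \<boxminus>\<^bsub>V_hull A\<^esub> g \<boxplus>\<^bsub>V_hull A\<^esub> f \<and> g \<in> f \<boxplus>\<^bsub>V_hull A\<^esub> \<boxminus>\<^bsub>V_hull A\<^esub> h"
    if "f \<in> g \<boxplus>\<^bsub>V_hull A\<^esub> h"
  proof -
    have "h p \<in> \<boxminus>\<^bsub>residue_field A p\<^esub> g p \<boxplus>\<^bsub>residue_field A p\<^esub> f p \<and>
        g p \<in> f p \<boxplus>\<^bsub>residue_field A p\<^esub> \<boxminus>\<^bsub>residue_field A p\<^esub> h p" if p: "p \<in> mr_spec A" for p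
      using multiring.hadd_reversible[OF multiring_residue_field[OF p] val[OF p]]
        \<open>f \<in> g \<boxplus>\<^bsub>V_hull A\<^esub> h\<close> p unfolding V_hadd_iff by blast
    then show ?thesis unfolding V_hadd_iff using fgh by simp
  qed
  show "\<exists>l \<in> g \<boxplus>\<^bsub>V_hull A\<^esub> h. x \<in> f \<boxplus>\<^bsub>V_hull A\<^esub> l"
    if k: "k \<in> f \<boxplus>\<^bsub>V_hull A\<^esub> g" and x: "x \<in> k \<boxplus>\<^bsub>V_hull A\<^esub> h" for k x
  proof -
    have xs: "x \<in> constructible_sections A" using x unfolding V_hadd_iff by blast
    have "\<exists>l \<in> constructible_sections A. \<forall>p \<in> mr_spec A.
        l p \<in> g p \<boxplus>\<^bsub>residue_field A p\<^esub> h p \<and> x p \<in> f p \<boxplus>\<^bsub>residue_field A p\<^esub> l p"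
    proof (rule section_from_pointwise)
      fix p assume p: "p \<in> mr_spec A"
      interpret K: multiring "residue_field A p" by (rule multiring_residue_field[OF p])
      have "k p \<in> f p \<boxplus>\<^bsub>residue_field A p\<^esub> g p" "x p \<in> k p \<boxplus>\<^bsub>residue_field A p\<^esub> h p"
        using k x p unfolding V_hadd_iff by blast+
      then obtain l where l: "l \<in> g p \<boxplus>\<^bsub>residue_field A p\<^esub> h p" "x p \<in> f p \<boxplus>\<^bsub>residue_field A p\<^esub> l"
        using K.hadd_assoc[OF val[OF p]] by blast
      have "l \<in> carrier (residue_field A p)" using l(1) val(2,3)[OF p] by (rule K.hadd_mem_carrier)
      then show "\<exists>l \<in> carrier (residue_field A p).
          l \<in> g p \<boxplus>\<^bsub>residue_field A p\<^esub> h p \<and> x p \<in> f p \<boxplus>\<^bsub>residue_field A p\<^esub> l"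
        using l by blast
      show "\<forall>\<^sub>F q in near A p. l q \<in> g q \<boxplus>\<^bsub>residue_field A q\<^esub> h q \<and> x q \<in> f q \<boxplus>\<^bsub>residue_field A q\<^esub> l q"
        if l: "fraction_germ A p l"
          "l p \<in> g p \<boxplus>\<^bsub>residue_field A p\<^esub> h p \<and> x p \<in> f p \<boxplus>\<^bsub>residue_field A p\<^esub> l p" for l
        using l(2) by (intro eventually_conj near_hadd[OF p] l(1) section_germ[OF _ p] fgh xs) simp_all
    qed
    then show ?thesis using xs unfolding V_hadd_iff Bex_def by blast
  qed
  show "f \<otimes>\<^bsub>V_hull A\<^esub> d \<in> g \<otimes>\<^bsub>V_hull A\<^esub> d \<boxplus>\<^bsub>V_hull A\<^esub> h \<otimes>\<^bsub>V_hull A\<^esub> d"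
    if d: "d \<in> constructible_sections A" and f: "f \<in> g \<boxplus>\<^bsub>V_hull A\<^esub> h" for d
  proof -
    have "(f \<otimes>\<^bsub>V_hull A\<^esub> d) p \<in> (g \<otimes>\<^bsub>V_hull A\<^esub> d) p \<boxplus>\<^bsub>residue_field A p\<^esub> (h \<otimes>\<^bsub>V_hull A\<^esub> d) p"
      if p: "p \<in> mr_spec A" for p
      unfolding V_mult[OF p]
      by (rule multiring.hadd_mult[OF multiring_residue_field[OF p] val[OF p] section_value[OF d p]])
        (use f p in \<open>simp add: V_hadd_iff\<close>)
    then show ?thesis unfolding V_hadd_iff using V_mult_closed[OF fgh(1) d] by blast
  qed
  show "\<exists>a \<in> f \<boxplus>\<^bsub>V_hull A\<^esub> g. x = a \<otimes>\<^bsub>V_hull A\<^esub> h"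
    if x: "x \<in> f \<otimes>\<^bsub>V_hull A\<^esub> h \<boxplus>\<^bsub>V_hull A\<^esub> g \<otimes>\<^bsub>V_hull A\<^esub> h" for x
  proof -
    have xs: "x \<in> constructible_sections A" using x unfolding V_hadd_iff by blast
    have "\<exists>a \<in> constructible_sections A. \<forall>p \<in> mr_spec A.
        a p \<in> f p \<boxplus>\<^bsub>residue_field A p\<^esub> g p \<and> x p = a p \<otimes>\<^bsub>residue_field A p\<^esub> h p"
    proof (rule section_from_pointwise)
      fix p assume p: "p \<in> mr_spec A"
      interpret K: hyperfield "residue_field A p" by (rule hyperfield_residue_field[OF p])
      have "x p \<in> f p \<otimes>\<^bsub>residue_field A p\<^esub> h p \<boxplus>\<^bsub>residue_field A p\<^esub> g p \<otimes>\<^bsub>residue_field A p\<^esub> h p"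
        using x p by (simp add: V_hadd_iff)
      then obtain a where a: "a \<in> f p \<boxplus>\<^bsub>residue_field A p\<^esub> g p" "x p = a \<otimes>\<^bsub>residue_field A p\<^esub> h p"
        using K.hadd_mult_converse_hyperfield[OF val[OF p]] by blast
      have "a \<in> carrier (residue_field A p)" using a(1) val(1,2)[OF p] by (rule K.hadd_mem_carrier)
      then show "\<exists>a \<in> carrier (residue_field A p).
          a \<in> f p \<boxplus>\<^bsub>residue_field A p\<^esub> g p \<and> x p = a \<otimes>\<^bsub>residue_field A p\<^esub> h p"
        using a by blast
      show "\<forall>\<^sub>F q in near A p. a q \<in> f q \<boxplus>\<^bsub>residue_field A q\<^esub> g q \<and> x q = a q \<otimes>\<^bsub>residue_field A q\<^esub> h q"
        if a: "fraction_germ A p a"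
          "a p \<in> f p \<boxplus>\<^bsub>residue_field A p\<^esub> g p \<and> x p = a p \<otimes>\<^bsub>residue_field A p\<^esub> h p" for a
        using a(2)
        by (intro eventually_conj near_hadd[OF p] near_eq[OF p] fraction_germ_mult[OF p] a(1)
            section_germ[OF _ p] fgh xs) simp_all
    qed
    then obtain a where a: "a \<in> constructible_sections A" "\<forall>p \<in> mr_spec A.
        a p \<in> f p \<boxplus>\<^bsub>residue_field A p\<^esub> g p \<and> x p = a p \<otimes>\<^bsub>residue_field A p\<^esub> h p" by blast
    have "x = a \<otimes>\<^bsub>V_hull A\<^esub> h"
      by (rule section_ext) (use xs V_mult_closed[OF a(1) fgh(3)] a(2) in simp_all)
    then show ?thesis using a unfolding V_hadd_iff Bex_def by blast
  qed
qed (intro V_closed)+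

lemma multiring_V_hull: "multiring (V_hull A)"
  using von_Neumann_V_hull unfolding von_Neumann_hyperring_def hyperring_def by blast

end

context multiring
begin

lemma genideal_self: "x \<in> mr_genideal A x"
  unfolding mr_genideal_def by blast

lemma genideal_least: "\<lbrakk>mr_ideal A I; x \<in> I\<rbrakk> \<Longrightarrow> mr_genideal A x \<subseteq> I"
  unfolding mr_genideal_def by blast

lemma carrier_ideal: "mr_ideal A (carrier A)"
  unfolding mr_ideal_def using hadd_closed hzero_closed by blast

lemma genideal_ideal: "x \<in> carrier A \<Longrightarrow> mr_ideal A (mr_genideal A x)"
proof -
  assume x: "x \<in> carrier A"
  have "mr_genideal A x \<subseteq> carrier A" by (rule genideal_least[OF carrier_ideal x])
  moreover have "a \<boxplus> b \<subseteq> mr_genideal A x" if "a \<in> mr_genideal A x" "b \<in> mr_genideal A x" for a b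
    using that ideal_hadd[of A _ a b] unfolding mr_genideal_def by blast
  moreover have "a \<otimes> b \<in> mr_genideal A x" if "a \<in> carrier A" "b \<in> mr_genideal A x" for a b
    using that ideal_mult[of A _ a b] unfolding mr_genideal_def by blast
  ultimately show ?thesis unfolding mr_ideal_def using genideal_self[of x] by blast
qed

text \<open>
  The elements \<open>z\<close> with \<open>z t \<in> (x t)\<close> form an ideal that contains \<open>x\<close>.
\<close>

lemma genideal_mult_subset:
  assumes "y \<in> mr_genideal A x" "x \<in> carrier A" "t \<in> carrier A"
  shows "y \<otimes> t \<in> mr_genideal A (x \<otimes> t)"
proof -
  let ?J = "{z \<in> carrier A. z \<otimes> t \<in> mr_genideal A (x \<otimes> t)}"
  have I: "mr_ideal A (mr_genideal A (x \<otimes> t))" using genideal_ideal assms by simp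
  have "mr_ideal A ?J"
    unfolding mr_ideal_def
  proof (intro conjI ballI)
    show "?J \<noteq> {}" using genideal_self assms by blast
    show "a \<boxplus> b \<subseteq> ?J" if ab: "a \<in> ?J" "b \<in> ?J" for a b
    proof
      fix z assume z: "z \<in> a \<boxplus> b"
      have zc: "z \<in> carrier A" using z ab by blast
      have "z \<otimes> t \<in> (a \<otimes> t) \<boxplus> (b \<otimes> t)" using hadd_mult[OF zc _ _ assms(3) z] ab by blast
      then show "z \<in> ?J" using zc ideal_hadd[OF I] ab by blast
    qed
    show "a \<otimes> b \<in> ?J" if ab: "a \<in> carrier A" "b \<in> ?J" for a b
      using ab ideal_mult[OF I ab(1), of "b \<otimes> t"] assms(3) by (simp add: m_assoc)
  qed auto
  then show ?thesis using genideal_least[of ?J x] genideal_self assms by blast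
qed

text \<open>
  From \<open>e\<^sup>n \<in> (s)\<close> and \<open>e\<^sup>m \<in> (t)\<close> follow \<open>e\<^sup>n t \<in> (s t)\<close> and \<open>e\<^sup>m e\<^sup>n \<in> (t e\<^sup>n)\<close>, so that \<open>e\<close> to the power \<open>m + n\<close>
  lies in \<open>(s t)\<close>.
\<close>

lemma sheaf_denoms_multiplicative:
  assumes e: "e \<in> carrier A"
  shows "multiplicative_set A (sheaf_denoms A e)"
proof (intro multiplicative_set.intro multiplicative_set_axioms.intro multiring_axioms)
  show "sheaf_denoms A e \<subseteq> carrier A" unfolding sheaf_denoms_def by blast
  have "e [^] (0::nat) \<in> mr_genideal A \<one>" using genideal_self by simp
  then show "\<one> \<in> sheaf_denoms A e" unfolding sheaf_denoms_def by blast
  show "s \<otimes> t \<in> sheaf_denoms A e" if st: "s \<in> sheaf_denoms A e" "t \<in> sheaf_denoms A e" for s t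
  proof -
    obtain n m :: nat where s: "s \<in> carrier A" "e [^] n \<in> mr_genideal A s"
        and t: "t \<in> carrier A" "e [^] m \<in> mr_genideal A t"
      using st unfolding sheaf_denoms_def by blast
    have I: "mr_ideal A (mr_genideal A (s \<otimes> t))" using genideal_ideal s t by simp
    have "e [^] n \<otimes> t \<in> mr_genideal A (s \<otimes> t)"
      by (rule genideal_mult_subset[OF s(2,1) t(1)])
    then have "mr_genideal A (t \<otimes> e [^] n) \<subseteq> mr_genideal A (s \<otimes> t)"
      using genideal_least[OF I] t e by (simp add: m_comm)
    moreover have "e [^] m \<otimes> e [^] n \<in> mr_genideal A (t \<otimes> e [^] n)"
      by (rule genideal_mult_subset[OF t(2,1)]) (use e in simp)
    ultimately have "e [^] (m + n) \<in> mr_genideal A (s \<otimes> t)" using e by (auto simp: nat_pow_mult)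
    then show ?thesis unfolding sheaf_denoms_def using s t by blast
  qed
qed

lemma nat_pow_one_eq: "e \<in> carrier A \<Longrightarrow> e [^] (1::nat) = e"
  unfolding One_nat_def nat_pow_Suc nat_pow_0 by simp

lemma sheaf_denoms_self:
  assumes "e \<in> carrier A" shows "e \<in> sheaf_denoms A e"
proof -
  have "e [^] (1::nat) \<in> mr_genideal A e" unfolding nat_pow_one_eq[OF assms] by (rule genideal_self)
  then show ?thesis unfolding sheaf_denoms_def using assms by blast
qed

lemma sheaf_denoms_mult_subset:
  assumes "a \<in> carrier A" "b \<in> carrier A"
  shows "sheaf_denoms A a \<subseteq> sheaf_denoms A (a \<otimes> b)"
proof
  fix s assume "s \<in> sheaf_denoms A a"
  then obtain n :: nat where s: "s \<in> carrier A" "a [^] n \<in> mr_genideal A s"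
    unfolding sheaf_denoms_def by blast
  have "(a \<otimes> b) [^] n = a [^] n \<otimes> b [^] n" using nat_pow_distrib assms by simp
  also have "\<dots> \<in> mr_genideal A s"
    by (rule ideal_mult_right[OF genideal_ideal[OF s(1)] s(2)]) (use assms in simp)
  finally show "s \<in> sheaf_denoms A (a \<otimes> b)" unfolding sheaf_denoms_def using s(1) by blast
qed

lemma spec_pow:
  assumes "p \<in> mr_spec A" "a \<in> carrier A" "a [^] (n::nat) \<in> p"
  shows "a \<in> p"
  using assms(3)
proof (induction n)
  case 0
  then show ?case using specD(2)[OF assms(1)] by simp
next
  case (Suc n)
  then show ?case using specD(3)[OF assms(1), of "a [^] n" a] assms(2) by auto
qed

lemma sheaf_denoms_notin:
  assumes "p \<in> mr_spec A" "e \<in> carrier A" "e \<notin> p" "s \<in> sheaf_denoms A e"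
  shows "s \<notin> p"
proof
  assume "s \<in> p"
  then have "mr_genideal A s \<subseteq> p" by (rule genideal_least[OF specD(1)[OF assms(1)]])
  then show False using spec_pow[OF assms(1,2)] assms(3,4) unfolding sheaf_denoms_def by blast
qed

lemma presheaf_restrict_frac:
  assumes e: "e \<in> carrier A" and b: "b \<in> carrier A" and sub: "sheaf_denoms A e \<subseteq> sheaf_denoms A b"
    and x: "x \<in> carrier A" "s \<in> sheaf_denoms A e"
  shows "presheaf_restrict A b (frac A (sheaf_denoms A e) x s) = frac A (sheaf_denoms A b) x s"
proof -
  interpret E: multiplicative_set A "sheaf_denoms A e" by (rule sheaf_denoms_multiplicative[OF e])
  interpret B: multiplicative_set A "sheaf_denoms A b" by (rule sheaf_denoms_multiplicative[OF b])
  have H: "(case X of (x', s') \<Rightarrow> frac A (sheaf_denoms A b) x' s') = frac A (sheaf_denoms A b) x s"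
    if X: "X \<in> frac A (sheaf_denoms A e) x s" for X
  proof -
    obtain x' s' where X': "X = (x', s')" by (cases X)
    then have x': "x' \<in> carrier A" "s' \<in> sheaf_denoms A e"
        "frac A (sheaf_denoms A e) x' s' = frac A (sheaf_denoms A e) x s"
      using X E.mem_frac_iff[OF x] by auto
    then have "\<exists>u \<in> sheaf_denoms A e. x' \<otimes> s \<otimes> u = x \<otimes> s' \<otimes> u" using E.frac_eq_iff x by blast
    then show ?thesis
      unfolding X' prod.case using B.frac_eq_iff[of x' s' x s] x x'(1,2) sub by blast
  qed
  show ?thesis
    unfolding presheaf_restrict_def by (rule UN_eq_const[OF E.frac_self[OF x] H])
qed

text \<open>
  The kernel of the evaluation at \<open>p\<close>. These prime ideals of the hull suffice to compare the supports
  of sections with the basic open sets of the hull.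
\<close>

definition point_ideal :: "'a set \<Rightarrow> ('a set \<Rightarrow> ('a set \<times> 'a set) set) set" where
  "point_ideal p = {f \<in> constructible_sections A. f p = \<zero>\<^bsub>residue_field A p\<^esub>}"

lemma point_ideal_prime:
  assumes p: "p \<in> mr_spec A"
  shows "point_ideal p \<in> mr_spec (V_hull A)"
proof -
  interpret K: hyperfield "residue_field A p" by (rule hyperfield_residue_field[OF p])
  have "mr_ideal (V_hull A) (point_ideal p)"
    unfolding mr_ideal_def
  proof (intro conjI ballI)
    show "point_ideal p \<subseteq> carrier (V_hull A)" unfolding point_ideal_def by auto
    show "point_ideal p \<noteq> {}" unfolding point_ideal_def using V_zero_closed p by (auto simp: V_zero)
    show "f \<boxplus>\<^bsub>V_hull A\<^esub> g \<subseteq> point_ideal p" if "f \<in> point_ideal p" "g \<in> point_ideal p" for f g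
      using that p K.hadd_zero_right[OF _ K.hzero_closed]
      unfolding point_ideal_def V_hadd_iff subset_iff by fastforce
    show "f \<otimes>\<^bsub>V_hull A\<^esub> g \<in> point_ideal p" if "f \<in> carrier (V_hull A)" "g \<in> point_ideal p" for f g
      using that p section_value[of f p] V_mult_closed[of f g] unfolding point_ideal_def by simp
  qed
  moreover have "\<one>\<^bsub>V_hull A\<^esub> \<notin> point_ideal p"
    unfolding point_ideal_def using p K.one_neq_zero by simp
  moreover have "f \<in> point_ideal p \<or> g \<in> point_ideal p"
    if "f \<in> carrier (V_hull A)" "g \<in> carrier (V_hull A)" "f \<otimes>\<^bsub>V_hull A\<^esub> g \<in> point_ideal p" for f g
    using that p section_value[of f p] section_value[of g p] K.mult_eq_zero[of "f p" "g p"]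
    unfolding point_ideal_def by simp
  ultimately show ?thesis unfolding mr_spec_def by blast
qed

text \<open>
  A section \<open>s\<close> that does not vanish on the support of \<open>e\<close> has a weak inverse \<open>w\<close>, and then \<open>e = e w s\<close> is a
  multiple of \<open>s\<close>. Conversely a prime ideal that contains \<open>s\<close>, and hence a power of \<open>e\<close>,
  contains \<open>e\<close>.
\<close>

lemma V_sheaf_denoms_iff:
  assumes e: "e \<in> constructible_sections A"
  shows "s \<in> sheaf_denoms (V_hull A) e \<longleftrightarrow> s \<in> constructible_sections A \<and>
    (\<forall>p \<in> mr_spec A. e p \<noteq> \<zero>\<^bsub>residue_field A p\<^esub> \<longrightarrow> s p \<noteq> \<zero>\<^bsub>residue_field A p\<^esub>)" (is "?L \<longleftrightarrow> ?R")
proof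
  interpret V: multiring "V_hull A" by (rule multiring_V_hull)
  assume s: ?L
  have sc: "s \<in> constructible_sections A" using s unfolding sheaf_denoms_def by simp
  have "s p \<noteq> \<zero>\<^bsub>residue_field A p\<^esub>" if p: "p \<in> mr_spec A" "e p \<noteq> \<zero>\<^bsub>residue_field A p\<^esub>" for p
    using V.sheaf_denoms_notin[OF point_ideal_prime[OF p(1)] _ _ s] p(2) e sc
    unfolding point_ideal_def by simp
  then show ?R using sc by blast
next
  interpret V: von_Neumann_hyperring "V_hull A" by (rule von_Neumann_V_hull)
  assume s: ?R
  then obtain w where w: "w \<in> constructible_sections A" "s = s \<otimes>\<^bsub>V_hull A\<^esub> s \<otimes>\<^bsub>V_hull A\<^esub> w"
    using V.von_Neumann[of s] by auto
  have "e = (e \<otimes>\<^bsub>V_hull A\<^esub> w) \<otimes>\<^bsub>V_hull A\<^esub> s"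
  proof (rule section_ext)
    fix p assume p: "p \<in> mr_spec A"
    interpret K: hyperfield "residue_field A p" by (rule hyperfield_residue_field[OF p])
    note val = section_value[OF e p] section_value[OF w(1) p] section_value[OF conjunct1[OF s] p]
    show "e p = ((e \<otimes>\<^bsub>V_hull A\<^esub> w) \<otimes>\<^bsub>V_hull A\<^esub> s) p"
    proof (cases "e p = \<zero>\<^bsub>residue_field A p\<^esub>")
      case True
      then show ?thesis using p val by simp
    next
      case False
      then have nz: "s p \<noteq> \<zero>\<^bsub>residue_field A p\<^esub>" using s p by blast
      have "s p \<otimes>\<^bsub>residue_field A p\<^esub> \<one>\<^bsub>residue_field A p\<^esub> = s p \<otimes>\<^bsub>residue_field A p\<^esub> (s p \<otimes>\<^bsub>residue_field A p\<^esub> w p)"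
        using arg_cong[OF w(2), of "\<lambda>f. f p"] p val by (simp add: K.m_assoc)
      then have "\<one>\<^bsub>residue_field A p\<^esub> = s p \<otimes>\<^bsub>residue_field A p\<^esub> w p"
        by (rule K.hyperfield_cancel) (use val nz in simp_all)
      then have "w p \<otimes>\<^bsub>residue_field A p\<^esub> s p = \<one>\<^bsub>residue_field A p\<^esub>" using val K.m_comm by simp
      then show ?thesis using p val by (simp add: K.m_assoc)
    qed
  qed (intro e V_closed w(1) conjunct1[OF s])+
  then have "e \<in> mr_genideal (V_hull A) s"
    using ideal_mult[OF V.genideal_ideal[of s] _ V.genideal_self[of s], of "e \<otimes>\<^bsub>V_hull A\<^esub> w"]
      V_mult_closed[OF e w(1)] s by simp
  then have "e [^]\<^bsub>V_hull A\<^esub> (1::nat) \<in> mr_genideal (V_hull A) s"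
    using V.nat_pow_one_eq[of e] e by simp
  then show ?L unfolding sheaf_denoms_def mem_Collect_eq V_carrier using s by blast
qed

text \<open>
  A cover of a basic open set of the hull covers, at the points \<open>point_ideal p\<close>, the support of a
  section by supports of sections. These supports are open in the constructible topology, and
  sections are defined locally, so local data glue.
\<close>

theorem geometric_V_hull: "geometric_von_Neumann_hyperring (V_hull A)"
proof (intro geometric_von_Neumann_hyperring.intro geometric_von_Neumann_hyperring_axioms.intro
    von_Neumann_V_hull)
  interpret V: von_Neumann_hyperring "V_hull A" by (rule von_Neumann_V_hull)
  have supp: "e p \<noteq> \<zero>\<^bsub>residue_field A p\<^esub> \<longleftrightarrow> (\<exists>i \<in> I. d i p \<noteq> \<zero>\<^bsub>residue_field A p\<^esub>)"
    if "p \<in> mr_spec A" "e \<in> constructible_sections A" "d \<in> I \<rightarrow> constructible_sections A"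
      "basic_open (V_hull A) e = (\<Union>i \<in> I. basic_open (V_hull A) (d i))"
    for p e d and I :: "('a set \<Rightarrow> ('a set \<times> 'a set) set) set"
  proof -
    have "f p \<noteq> \<zero>\<^bsub>residue_field A p\<^esub> \<longleftrightarrow> point_ideal p \<in> basic_open (V_hull A) f"
      if "f \<in> constructible_sections A" for f
      using that point_ideal_prime[OF \<open>p \<in> mr_spec A\<close>] unfolding basic_open_def point_ideal_def by simp
    then show ?thesis using that by (auto simp: Pi_iff)
  qed
  have sub: "sheaf_denoms (V_hull A) e \<subseteq> sheaf_denoms (V_hull A) (d i)"
    if "e \<in> constructible_sections A" "d \<in> I \<rightarrow> constructible_sections A" "i \<in> I"
      "basic_open (V_hull A) e = (\<Union>i \<in> I. basic_open (V_hull A) (d i))"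
    for e d i and I :: "('a set \<Rightarrow> ('a set \<times> 'a set) set) set"
  proof -
    have di: "d i \<in> constructible_sections A" using that(2,3) by blast
    have "e p \<noteq> \<zero>\<^bsub>residue_field A p\<^esub>" if "p \<in> mr_spec A" "d i p \<noteq> \<zero>\<^bsub>residue_field A p\<^esub>" for p
      using supp[OF that(1) \<open>e \<in> constructible_sections A\<close> \<open>d \<in> I \<rightarrow> constructible_sections A\<close>
          \<open>basic_open (V_hull A) e = (\<Union>i \<in> I. basic_open (V_hull A) (d i))\<close>] that(2) \<open>i \<in> I\<close> by blast
    then show ?thesis unfolding V_sheaf_denoms_iff[OF that(1)] V_sheaf_denoms_iff[OF di] subset_iff by blast
  qed
  {
    fix e a b c and I :: "('a set \<Rightarrow> ('a set \<times> 'a set) set) set" and d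
    assume e: "e \<in> carrier (V_hull A)" and d: "d \<in> I \<rightarrow> carrier (V_hull A)"
      and cover: "basic_open (V_hull A) e = (\<Union>i \<in> I. basic_open (V_hull A) (d i))"
      and abc: "a \<in> carrier (structure_presheaf (V_hull A) e)" "b \<in> carrier (structure_presheaf (V_hull A) e)"
        "c \<in> carrier (structure_presheaf (V_hull A) e)"
      and loc: "\<And>i. i \<in> I \<Longrightarrow> presheaf_restrict (V_hull A) (d i) a \<in>
         presheaf_restrict (V_hull A) (d i) b \<boxplus>\<^bsub>structure_presheaf (V_hull A) (d i)\<^esub> presheaf_restrict (V_hull A) (d i) c"
    interpret E: multiplicative_set "V_hull A" "sheaf_denoms (V_hull A) e"
      by (rule V.sheaf_denoms_multiplicative[OF e])
    obtain x y z s where xyz: "x \<in> carrier (V_hull A)" "y \<in> carrier (V_hull A)" "z \<in> carrier (V_hull A)"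
        and s: "s \<in> sheaf_denoms (V_hull A) e" and fr: "a = frac (V_hull A) (sheaf_denoms (V_hull A) e) x s"
          "b = frac (V_hull A) (sheaf_denoms (V_hull A) e) y s" "c = frac (V_hull A) (sheaf_denoms (V_hull A) e) z s"
      using E.common_denominator3[OF abc[unfolded structure_presheaf_def]] .
    have sc: "s \<in> constructible_sections A" using s E.S_closed by simp
    note secs = xyz[unfolded V_carrier] sc e[unfolded V_carrier]
    have pt: "x p \<in> y p \<boxplus>\<^bsub>residue_field A p\<^esub> z p"
      if p: "p \<in> mr_spec A" "e p \<noteq> \<zero>\<^bsub>residue_field A p\<^esub>" for p
    proof -
      obtain i where i: "i \<in> I" "d i p \<noteq> \<zero>\<^bsub>residue_field A p\<^esub>"
        using supp[OF p(1) _ _ cover] e d p(2) by auto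
      have di: "d i \<in> carrier (V_hull A)" using d i by blast
      interpret D: multiplicative_set "V_hull A" "sheaf_denoms (V_hull A) (d i)"
        by (rule V.sheaf_denoms_multiplicative[OF di])
      have ss: "sheaf_denoms (V_hull A) e \<subseteq> sheaf_denoms (V_hull A) (d i)"
        using sub[OF _ _ i(1) cover] e d by simp
      then have s': "s \<in> sheaf_denoms (V_hull A) (d i)" using s by blast
      obtain v where v: "v \<in> sheaf_denoms (V_hull A) (d i)"
          "x \<otimes>\<^bsub>V_hull A\<^esub> s \<otimes>\<^bsub>V_hull A\<^esub> s \<otimes>\<^bsub>V_hull A\<^esub> v \<in>
            (y \<otimes>\<^bsub>V_hull A\<^esub> s \<otimes>\<^bsub>V_hull A\<^esub> s \<otimes>\<^bsub>V_hull A\<^esub> v) \<boxplus>\<^bsub>V_hull A\<^esub> (z \<otimes>\<^bsub>V_hull A\<^esub> s \<otimes>\<^bsub>V_hull A\<^esub> s \<otimes>\<^bsub>V_hull A\<^esub> v)"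
        using loc[OF i(1)] D.frac_hadd_iff[OF xyz(1) s' xyz(2) s' xyz(3) s']
        unfolding fr structure_presheaf_def V.presheaf_restrict_frac[OF e di ss xyz(1) s]
          V.presheaf_restrict_frac[OF e di ss xyz(2) s] V.presheaf_restrict_frac[OF e di ss xyz(3) s] by blast
      interpret K: hyperfield "residue_field A p" by (rule hyperfield_residue_field[OF p(1)])
      have v': "v \<in> constructible_sections A" "v p \<noteq> \<zero>\<^bsub>residue_field A p\<^esub>"
        using v(1) i(2) p(1) V_sheaf_denoms_iff[OF di[unfolded V_carrier]] by blast+
      have s'': "s p \<noteq> \<zero>\<^bsub>residue_field A p\<^esub>" using s p V_sheaf_denoms_iff[OF e[unfolded V_carrier]] by blast
      note val = secs(1-4)[THEN section_value, OF p(1)] section_value[OF v'(1) p(1)]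
      let ?k = "s p \<otimes>\<^bsub>residue_field A p\<^esub> s p \<otimes>\<^bsub>residue_field A p\<^esub> v p"
      have "?k \<noteq> \<zero>\<^bsub>residue_field A p\<^esub>"
        using K.mult_eq_zero[of "s p \<otimes>\<^bsub>residue_field A p\<^esub> s p" "v p"] K.mult_eq_zero[of "s p" "s p"] val v'(2) s''
        by auto
      moreover have "x p \<otimes>\<^bsub>residue_field A p\<^esub> ?k \<in>
          (y p \<otimes>\<^bsub>residue_field A p\<^esub> ?k) \<boxplus>\<^bsub>residue_field A p\<^esub> (z p \<otimes>\<^bsub>residue_field A p\<^esub> ?k)"
        using V_haddD[OF v(2) p(1)] val by (simp add: p(1) K.m_assoc)
      ultimately show ?thesis using K.hadd_cancel[of "x p" ?k "y p" "z p"] val by simp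
    qed
    \<comment> \<open>Off the support of \<open>e\<close> nothing is known, and the multiplier \<open>e\<close> makes the relation trivial there.\<close>
    have "x \<otimes>\<^bsub>V_hull A\<^esub> s \<otimes>\<^bsub>V_hull A\<^esub> s \<otimes>\<^bsub>V_hull A\<^esub> e \<in>
        (y \<otimes>\<^bsub>V_hull A\<^esub> s \<otimes>\<^bsub>V_hull A\<^esub> s \<otimes>\<^bsub>V_hull A\<^esub> e) \<boxplus>\<^bsub>V_hull A\<^esub> (z \<otimes>\<^bsub>V_hull A\<^esub> s \<otimes>\<^bsub>V_hull A\<^esub> s \<otimes>\<^bsub>V_hull A\<^esub> e)"
      unfolding V_hadd_iff
    proof (intro conjI ballI V_mult_closed secs)
      fix p assume p: "p \<in> mr_spec A"
      interpret K: hyperfield "residue_field A p" by (rule hyperfield_residue_field[OF p])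
      note val = secs[THEN section_value, OF p]
      let ?k = "s p \<otimes>\<^bsub>residue_field A p\<^esub> s p \<otimes>\<^bsub>residue_field A p\<^esub> e p"
      have "x p \<otimes>\<^bsub>residue_field A p\<^esub> ?k \<in>
          (y p \<otimes>\<^bsub>residue_field A p\<^esub> ?k) \<boxplus>\<^bsub>residue_field A p\<^esub> (z p \<otimes>\<^bsub>residue_field A p\<^esub> ?k)"
      proof (cases "e p = \<zero>\<^bsub>residue_field A p\<^esub>")
        case True
        then show ?thesis using val by simp
      next
        case False
        then show ?thesis using K.hadd_mult[OF val(1-3) _ pt[OF p]] val by simp
      qed
      then show "(x \<otimes>\<^bsub>V_hull A\<^esub> s \<otimes>\<^bsub>V_hull A\<^esub> s \<otimes>\<^bsub>V_hull A\<^esub> e) p \<in>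
          (y \<otimes>\<^bsub>V_hull A\<^esub> s \<otimes>\<^bsub>V_hull A\<^esub> s \<otimes>\<^bsub>V_hull A\<^esub> e) p \<boxplus>\<^bsub>residue_field A p\<^esub>
          (z \<otimes>\<^bsub>V_hull A\<^esub> s \<otimes>\<^bsub>V_hull A\<^esub> s \<otimes>\<^bsub>V_hull A\<^esub> e) p"
        using p val by (simp add: K.m_assoc)
    qed
    then show "a \<in> b \<boxplus>\<^bsub>structure_presheaf (V_hull A) e\<^esub> c"
      unfolding fr structure_presheaf_def
      using E.frac_hadd_iff[OF xyz(1) s xyz(2) s xyz(3) s] V.sheaf_denoms_self[OF e] by blast
  }
  {
    fix e and I :: "('a set \<Rightarrow> ('a set \<times> 'a set) set) set" and d x
    assume e: "e \<in> carrier (V_hull A)" and d: "d \<in> I \<rightarrow> carrier (V_hull A)"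
      and cover: "basic_open (V_hull A) e = (\<Union>i \<in> I. basic_open (V_hull A) (d i))"
      and x: "\<And>i. i \<in> I \<Longrightarrow> x i \<in> carrier (structure_presheaf (V_hull A) (d i))"
      and comp: "\<And>i j. \<lbrakk>i \<in> I; j \<in> I\<rbrakk> \<Longrightarrow>
         presheaf_restrict (V_hull A) (d i \<otimes>\<^bsub>V_hull A\<^esub> d j) (x i) = presheaf_restrict (V_hull A) (d i \<otimes>\<^bsub>V_hull A\<^esub> d j) (x j)"
    have di: "d i \<in> carrier (V_hull A)" if "i \<in> I" for i using d that by blast
    have "\<exists>a s. a \<in> carrier (V_hull A) \<and> s \<in> sheaf_denoms (V_hull A) (d i) \<and>
        x i = frac (V_hull A) (sheaf_denoms (V_hull A) (d i)) a s" if i: "i \<in> I" for i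
    proof -
      interpret D: multiplicative_set "V_hull A" "sheaf_denoms (V_hull A) (d i)"
        by (rule V.sheaf_denoms_multiplicative[OF di[OF i]])
      show ?thesis using x[OF i] unfolding structure_presheaf_def D.fractions_carrier by blast
    qed
    then obtain a s where a: "\<And>i. i \<in> I \<Longrightarrow> a i \<in> carrier (V_hull A)"
        and s: "\<And>i. i \<in> I \<Longrightarrow> s i \<in> sheaf_denoms (V_hull A) (d i)"
        and fr: "\<And>i. i \<in> I \<Longrightarrow> x i = frac (V_hull A) (sheaf_denoms (V_hull A) (d i)) (a i) (s i)"
      by metis
    have sc: "s i \<in> constructible_sections A" if "i \<in> I" for i
      using s[OF that] unfolding sheaf_denoms_def by simp
    have snz: "s i p \<noteq> \<zero>\<^bsub>residue_field A p\<^esub>"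
      if "i \<in> I" "p \<in> mr_spec A" "d i p \<noteq> \<zero>\<^bsub>residue_field A p\<^esub>" for i p
      using s[OF that(1)] that(2,3) V_sheaf_denoms_iff[OF di[OF that(1), unfolded V_carrier]] by blast
    have agree: "a i p \<otimes>\<^bsub>residue_field A p\<^esub> s j p = a j p \<otimes>\<^bsub>residue_field A p\<^esub> s i p"
      if ij: "i \<in> I" "j \<in> I" and p: "p \<in> mr_spec A"
        and nz: "d i p \<noteq> \<zero>\<^bsub>residue_field A p\<^esub>" "d j p \<noteq> \<zero>\<^bsub>residue_field A p\<^esub>" for i j p
    proof -
      note dij = di[OF ij(1)] di[OF ij(2)]
      let ?dd = "d i \<otimes>\<^bsub>V_hull A\<^esub> d j"
      have dd: "?dd \<in> carrier (V_hull A)" using dij by (rule V.m_closed)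
      interpret D: multiplicative_set "V_hull A" "sheaf_denoms (V_hull A) ?dd"
        by (rule V.sheaf_denoms_multiplicative[OF dd])
      have si: "sheaf_denoms (V_hull A) (d i) \<subseteq> sheaf_denoms (V_hull A) ?dd"
        by (rule V.sheaf_denoms_mult_subset[OF dij])
      have sj: "sheaf_denoms (V_hull A) (d j) \<subseteq> sheaf_denoms (V_hull A) ?dd"
        using V.sheaf_denoms_mult_subset[OF dij(2,1)] V.m_comm[OF dij] by simp
      have "frac (V_hull A) (sheaf_denoms (V_hull A) ?dd) (a i) (s i) =
          frac (V_hull A) (sheaf_denoms (V_hull A) ?dd) (a j) (s j)"
        using comp[OF ij] unfolding fr[OF ij(1)] fr[OF ij(2)]
          V.presheaf_restrict_frac[OF dij(1) dd si a[OF ij(1)] s[OF ij(1)]]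
          V.presheaf_restrict_frac[OF dij(2) dd sj a[OF ij(2)] s[OF ij(2)]] .
      then obtain u where u: "u \<in> sheaf_denoms (V_hull A) ?dd"
          "a i \<otimes>\<^bsub>V_hull A\<^esub> s j \<otimes>\<^bsub>V_hull A\<^esub> u = a j \<otimes>\<^bsub>V_hull A\<^esub> s i \<otimes>\<^bsub>V_hull A\<^esub> u"
        using D.frac_eq_iff[OF a[OF ij(1)] subsetD[OF si s[OF ij(1)]] a[OF ij(2)] subsetD[OF sj s[OF ij(2)]]]
        by blast
      interpret K: hyperfield "residue_field A p" by (rule hyperfield_residue_field[OF p])
      note val = section_value[OF a[OF ij(1), unfolded V_carrier] p] section_value[OF a[OF ij(2), unfolded V_carrier] p]
        section_value[OF sc[OF ij(1)] p] section_value[OF sc[OF ij(2)] p]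
        section_value[OF dij(1)[unfolded V_carrier] p] section_value[OF dij(2)[unfolded V_carrier] p]
      have "?dd p \<noteq> \<zero>\<^bsub>residue_field A p\<^esub>" using K.mult_eq_zero[of "d i p" "d j p"] nz val p by auto
      then have uu: "u \<in> constructible_sections A" "u p \<noteq> \<zero>\<^bsub>residue_field A p\<^esub>"
        using u(1) p V_sheaf_denoms_iff[OF dd[unfolded V_carrier]] by blast+
      note uv = section_value[OF uu(1) p]
      have "u p \<otimes>\<^bsub>residue_field A p\<^esub> (a i p \<otimes>\<^bsub>residue_field A p\<^esub> s j p) = u p \<otimes>\<^bsub>residue_field A p\<^esub> (a j p \<otimes>\<^bsub>residue_field A p\<^esub> s i p)"
        using arg_cong[OF u(2), of "\<lambda>f. f p"] p val uv by (simp add: K.m_comm)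
      then show ?thesis by (rule K.hyperfield_cancel) (use uv uu(2) val in simp_all)
    qed
    \<comment> \<open>On the support of \<open>e\<close> the glued section is the quotient of \<open>a i\<close> by \<open>s i\<close> for any \<open>i\<close> with \<open>d i\<close> nonzero.\<close>
    have "\<exists>y \<in> constructible_sections A. \<forall>p \<in> mr_spec A.
        (\<exists>i \<in> I. d i p \<noteq> \<zero>\<^bsub>residue_field A p\<^esub> \<and> a i p = y p \<otimes>\<^bsub>residue_field A p\<^esub> s i p) \<or> e p = \<zero>\<^bsub>residue_field A p\<^esub>"
    proof (rule section_from_pointwise)
      fix p assume p: "p \<in> mr_spec A"
      interpret K: hyperfield "residue_field A p" by (rule hyperfield_residue_field[OF p])
      show "\<exists>k \<in> carrier (residue_field A p).
          (\<exists>i \<in> I. d i p \<noteq> \<zero>\<^bsub>residue_field A p\<^esub> \<and> a i p = k \<otimes>\<^bsub>residue_field A p\<^esub> s i p) \<or> e p = \<zero>\<^bsub>residue_field A p\<^esub>"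
      proof (cases "e p = \<zero>\<^bsub>residue_field A p\<^esub>")
        case True
        then show ?thesis using K.hzero_closed by blast
      next
        case False
        then obtain i where i: "i \<in> I" "d i p \<noteq> \<zero>\<^bsub>residue_field A p\<^esub>"
          using supp[OF p _ _ cover] e d by auto
        note val = section_value[OF a[OF i(1), unfolded V_carrier] p] section_value[OF sc[OF i(1)] p]
        obtain r where r: "r \<in> carrier (residue_field A p)" "s i p \<otimes>\<^bsub>residue_field A p\<^esub> r = \<one>\<^bsub>residue_field A p\<^esub>"
          using K.inverse_ex[OF val(2) snz[OF i(1) p i(2)]] by blast
        have "a i p = (a i p \<otimes>\<^bsub>residue_field A p\<^esub> r) \<otimes>\<^bsub>residue_field A p\<^esub> s i p"
          using r val K.m_comm[of r "s i p"] by (simp add: K.m_assoc)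
        then show ?thesis using i K.m_closed[OF val(1) r(1)] by blast
      qed
      show "\<forall>\<^sub>F q in near A p.
          (\<exists>i \<in> I. d i q \<noteq> \<zero>\<^bsub>residue_field A q\<^esub> \<and> a i q = g q \<otimes>\<^bsub>residue_field A q\<^esub> s i q) \<or> e q = \<zero>\<^bsub>residue_field A q\<^esub>"
        if g: "fraction_germ A p g"
          "(\<exists>i \<in> I. d i p \<noteq> \<zero>\<^bsub>residue_field A p\<^esub> \<and> a i p = g p \<otimes>\<^bsub>residue_field A p\<^esub> s i p) \<or> e p = \<zero>\<^bsub>residue_field A p\<^esub>" for g
        using g(2)
      proof
        assume "\<exists>i \<in> I. d i p \<noteq> \<zero>\<^bsub>residue_field A p\<^esub> \<and> a i p = g p \<otimes>\<^bsub>residue_field A p\<^esub> s i p"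
        then obtain i where i: "i \<in> I" "d i p \<noteq> \<zero>\<^bsub>residue_field A p\<^esub>" "a i p = g p \<otimes>\<^bsub>residue_field A p\<^esub> s i p" by blast
        note germs = section_germ[OF di[OF i(1), unfolded V_carrier] p]
          section_germ[OF a[OF i(1), unfolded V_carrier] p] section_germ[OF sc[OF i(1)] p]
        from near_nonzero[OF p germs(1) i(2)] near_eq[OF p germs(2) fraction_germ_mult[OF p g(1) germs(3)] i(3)]
        show ?thesis by eventually_elim (use i(1) in blast)
      next
        assume "e p = \<zero>\<^bsub>residue_field A p\<^esub>"
        from near_eq[OF p section_germ[OF e[unfolded V_carrier] p] fraction_germ_zero[OF p] this]
        show ?thesis by eventually_elim simp
      qed
    qed
    then obtain y where y: "y \<in> constructible_sections A" and sol: "\<And>p. p \<in> mr_spec A \<Longrightarrow>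
        (\<exists>i \<in> I. d i p \<noteq> \<zero>\<^bsub>residue_field A p\<^esub> \<and> a i p = y p \<otimes>\<^bsub>residue_field A p\<^esub> s i p) \<or> e p = \<zero>\<^bsub>residue_field A p\<^esub>"
      by blast
    have y_eq: "a i p = y p \<otimes>\<^bsub>residue_field A p\<^esub> s i p"
      if i: "i \<in> I" and p: "p \<in> mr_spec A" and nz: "d i p \<noteq> \<zero>\<^bsub>residue_field A p\<^esub>" for i p
    proof -
      interpret K: hyperfield "residue_field A p" by (rule hyperfield_residue_field[OF p])
      have "e p \<noteq> \<zero>\<^bsub>residue_field A p\<^esub>" using supp[OF p _ _ cover] e d i nz by auto
      then obtain j where j: "j \<in> I" "d j p \<noteq> \<zero>\<^bsub>residue_field A p\<^esub>" "a j p = y p \<otimes>\<^bsub>residue_field A p\<^esub> s j p"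
        using sol[OF p] by blast
      note val = section_value[OF a[OF i, unfolded V_carrier] p] section_value[OF sc[OF i] p]
        section_value[OF sc[OF j(1)] p] section_value[OF y p]
      have "a i p \<otimes>\<^bsub>residue_field A p\<^esub> s j p = y p \<otimes>\<^bsub>residue_field A p\<^esub> s j p \<otimes>\<^bsub>residue_field A p\<^esub> s i p"
        using agree[OF i j(1) p nz j(2)] j(3) by simp
      then have "s j p \<otimes>\<^bsub>residue_field A p\<^esub> a i p = s j p \<otimes>\<^bsub>residue_field A p\<^esub> (y p \<otimes>\<^bsub>residue_field A p\<^esub> s i p)"
        using val by (simp add: K.m_ac)
      then show ?thesis by (rule K.hyperfield_cancel) (use val snz[OF j(1) p j(2)] in simp_all)
    qed
    interpret E: multiplicative_set "V_hull A" "sheaf_denoms (V_hull A) e"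
      by (rule V.sheaf_denoms_multiplicative[OF e])
    let ?y = "frac (V_hull A) (sheaf_denoms (V_hull A) e) y \<one>\<^bsub>V_hull A\<^esub>"
    have yc: "y \<in> carrier (V_hull A)" using y by simp
    have "?y \<in> carrier (structure_presheaf (V_hull A) e)"
      unfolding structure_presheaf_def by (rule E.frac_carrierI[OF yc E.one_S])
    moreover have "presheaf_restrict (V_hull A) (d i) ?y = x i" if i: "i \<in> I" for i
    proof -
      interpret D: multiplicative_set "V_hull A" "sheaf_denoms (V_hull A) (d i)"
        by (rule V.sheaf_denoms_multiplicative[OF di[OF i]])
      have ss: "sheaf_denoms (V_hull A) e \<subseteq> sheaf_denoms (V_hull A) (d i)"
        using sub[OF _ _ i cover] e d by simp
      have ai: "a i \<in> constructible_sections A" "d i \<in> constructible_sections A" using a[OF i] di[OF i] by simp_all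
      have "y \<otimes>\<^bsub>V_hull A\<^esub> s i \<otimes>\<^bsub>V_hull A\<^esub> d i = a i \<otimes>\<^bsub>V_hull A\<^esub> \<one>\<^bsub>V_hull A\<^esub> \<otimes>\<^bsub>V_hull A\<^esub> d i"
      proof (rule section_ext)
        fix p assume p: "p \<in> mr_spec A"
        interpret K: hyperfield "residue_field A p" by (rule hyperfield_residue_field[OF p])
        note val = section_value[OF y p] section_value[OF sc[OF i] p] section_value[OF ai(1) p]
        show "(y \<otimes>\<^bsub>V_hull A\<^esub> s i \<otimes>\<^bsub>V_hull A\<^esub> d i) p = (a i \<otimes>\<^bsub>V_hull A\<^esub> \<one>\<^bsub>V_hull A\<^esub> \<otimes>\<^bsub>V_hull A\<^esub> d i) p"
          using y_eq[OF i p] val p by (cases "d i p = \<zero>\<^bsub>residue_field A p\<^esub>") simp_all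
      qed (intro V_closed y sc[OF i] ai)+
      then show ?thesis
        unfolding fr[OF i] V.presheaf_restrict_frac[OF e di[OF i] ss yc E.one_S]
        using D.frac_eq_iff[OF yc D.one_S a[OF i] s[OF i]] V.sheaf_denoms_self[OF di[OF i]] by blast
    qed
    ultimately show "\<exists>y \<in> carrier (structure_presheaf (V_hull A) e). \<forall>i \<in> I. presheaf_restrict (V_hull A) (d i) y = x i"
      by blast
  }
qed

end

section \<open>The canonical morphism and uniqueness of extensions\<close>

lemma multiring_hom_eqI:
  "\<lbrakk>f \<in> multiring_hom A B; g \<in> multiring_hom A B; \<And>a. a \<in> carrier A \<Longrightarrow> f a = g a\<rbrakk> \<Longrightarrow> f = g"
  by (rule extensionalityI[OF multiring_homD(7) multiring_homD(7)])

lemma hom_preimage_prime: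
  assumes A: "multiring A" and B: "multiring B" and f: "f \<in> multiring_hom A B" and q: "q \<in> mr_spec B"
  shows "{a \<in> carrier A. f a \<in> q} \<in> mr_spec A" (is "?p \<in> _")
proof -
  interpret A: multiring A by (rule A)
  interpret B: multiring B by (rule B)
  note fD = multiring_homD[OF f] and I = specD(1)[OF q]
  have "mr_ideal A ?p"
    unfolding mr_ideal_def
  proof (intro conjI ballI)
    show "?p \<noteq> {}" using B.ideal_zero[OF I] fD(5) A.hzero_closed by auto
    show "a \<boxplus>\<^bsub>A\<^esub> b \<subseteq> ?p" if ab: "a \<in> ?p" "b \<in> ?p" for a b
    proof
      fix x assume x: "x \<in> a \<boxplus>\<^bsub>A\<^esub> b"
      then have xc: "x \<in> carrier A" using ab A.hadd_mem_carrier by blast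
      have "f x \<in> f a \<boxplus>\<^bsub>B\<^esub> f b" by (rule fD(2)[OF x xc]) (use ab in simp_all)
      then show "x \<in> ?p" using xc ideal_hadd[OF I, of "f a" "f b" "f x"] ab by simp
    qed
    show "a \<otimes>\<^bsub>A\<^esub> b \<in> ?p" if ab: "a \<in> carrier A" "b \<in> ?p" for a b
      using ab ideal_mult[OF I fD(1), of a "f b"] fD(3) by simp
  qed auto
  moreover have "\<one>\<^bsub>A\<^esub> \<notin> ?p" using fD(6) specD(2)[OF q] by simp
  moreover have "a \<in> ?p \<or> b \<in> ?p" if ab: "a \<in> carrier A" "b \<in> carrier A" "a \<otimes>\<^bsub>A\<^esub> b \<in> ?p" for a b
    using ab specD(3)[OF q _ fD(1) fD(1), of a b] fD(3)[of a b] by simp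
  ultimately show ?thesis unfolding mr_spec_def by blast
qed

lemma (in hyperfield) zero_prime: "{\<zero>} \<in> mr_spec A"
proof -
  have "\<zero> \<boxplus> \<zero> \<subseteq> {\<zero>}" using hadd_zero_right by blast
  then have "mr_ideal A {\<zero>}" unfolding mr_ideal_def by simp
  then show ?thesis unfolding mr_spec_def using one_neq_zero mult_eq_zero by blast
qed

context multiring
begin

lemma residue_hadd_of_mem:
  assumes p: "p \<in> mr_spec A" and mem: "a \<in> b \<boxplus> c" and b: "b \<in> carrier A" and c: "c \<in> carrier A"
    and y: "y \<in> carrier A" "y \<notin> p"
  shows "residue_frac A p a y \<in> residue_frac A p b y \<boxplus>\<^bsub>residue_field A p\<^esub> residue_frac A p c y"
proof -
  note I = specD(1)[OF p]
  interpret F: multiplicative_set "quotient_multiring A p" "residue_denoms A p"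
    by (rule residue_multiplicative[OF p])
  show ?thesis
    unfolding residue_field_def residue_frac_def
    by (intro F.frac_hadd_of_mem quot_hadd_of_mem[OF I mem] quot_carrierI b c residue_denomI[OF p y])
qed

lemma V_unit_apply:
  "\<lbrakk>a \<in> carrier A; p \<in> mr_spec A\<rbrakk> \<Longrightarrow> V_unit A a p = residue_frac A p a \<one>"
  unfolding V_unit_def by simp

lemma V_unit_section: "a \<in> carrier A \<Longrightarrow> V_unit A a \<in> constructible_sections A"
  unfolding V_unit_def
  by (simp, intro restrict_section fraction_germ_residue) (simp_all add: specD(2))

lemma V_unit_eq_zero_iff:
  "\<lbrakk>a \<in> carrier A; p \<in> mr_spec A\<rbrakk> \<Longrightarrow> V_unit A a p = \<zero>\<^bsub>residue_field A p\<^esub> \<longleftrightarrow> a \<in> p"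
  using residue_frac_eq_zero_iff[of p a \<one>] specD(2)[of p A] by (simp add: V_unit_apply)

lemma residue_frac_mult_V_unit:
  assumes "p \<in> mr_spec A" "x \<in> carrier A" "y \<in> carrier A" "y \<notin> p"
  shows "residue_frac A p x y \<otimes>\<^bsub>residue_field A p\<^esub> V_unit A y p = V_unit A x p"
proof -
  have "residue_frac A p (x \<otimes> y) (y \<otimes> \<one>) = residue_frac A p x \<one>"
    by (rule residue_frac_eqI) (use assms specD(2)[of p A] in simp_all)
  then show ?thesis
    using residue_mult[OF assms assms(3) one_closed specD(2)[OF assms(1)]] assms by (simp add: V_unit_apply)
qed

lemma V_unit_hom: "V_unit A \<in> multiring_hom A (V_hull A)"
proof (rule multiring_homI)
  show "V_unit A \<in> extensional (carrier A)" unfolding V_unit_def by simp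
  show "V_unit A a \<in> carrier (V_hull A)" if "a \<in> carrier A" for a using V_unit_section[OF that] by simp
  show "V_unit A a \<in> V_unit A b \<boxplus>\<^bsub>V_hull A\<^esub> V_unit A c"
    if "a \<in> carrier A" "b \<in> carrier A" "c \<in> carrier A" "a \<in> b \<boxplus> c" for a b c
    unfolding V_hadd_iff
  proof (intro conjI ballI V_unit_section that(1))
    fix p assume p: "p \<in> mr_spec A"
    show "V_unit A a p \<in> V_unit A b p \<boxplus>\<^bsub>residue_field A p\<^esub> V_unit A c p"
      using residue_hadd_of_mem[OF p that(4,2,3) one_closed specD(2)[OF p]] p that(1-3)
      by (simp add: V_unit_apply)
  qed
  show "V_unit A (a \<otimes> b) = V_unit A a \<otimes>\<^bsub>V_hull A\<^esub> V_unit A b"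
    if ab: "a \<in> carrier A" "b \<in> carrier A" for a b
  proof (rule section_ext)
    fix p assume p: "p \<in> mr_spec A"
    show "V_unit A (a \<otimes> b) p = (V_unit A a \<otimes>\<^bsub>V_hull A\<^esub> V_unit A b) p"
      using residue_mult[OF p ab(1) one_closed _ ab(2) one_closed] specD(2)[OF p] p ab
      by (simp add: V_unit_apply)
  qed (intro V_closed V_unit_section m_closed ab)+
  show "V_unit A (\<boxminus> a) = \<boxminus>\<^bsub>V_hull A\<^esub> V_unit A a" if a: "a \<in> carrier A" for a
  proof (rule section_ext)
    fix p assume p: "p \<in> mr_spec A"
    show "V_unit A (\<boxminus> a) p = (\<boxminus>\<^bsub>V_hull A\<^esub> V_unit A a) p"
      using residue_neg[OF p a one_closed specD(2)[OF p]] p a by (simp add: V_unit_apply)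
  qed (intro V_closed V_unit_section hneg_closed a)+
  show "V_unit A \<zero> = \<zero>\<^bsub>V_hull A\<^esub>"
    by (rule section_ext) (simp_all add: V_unit_section V_closed V_unit_apply residue_zero)
  show "V_unit A \<one> = \<one>\<^bsub>V_hull A\<^esub>"
    by (rule section_ext) (simp_all add: V_unit_section V_closed V_unit_apply residue_one)
qed

text \<open>
  Let \<open>p\<close> be the kernel of \<open>\<phi> \<circ> v\<close>. Products of sections correspond to intersections of sets, so only
  the generating sets of the topology matter. For \<open>D(a)\<close> with \<open>a \<notin> p\<close> the section \<open>v(a)\<close> serves. For the
  complement of \<open>D(b)\<close> with \<open>b \<in> p\<close> it is the indicator \<open>e\<close> of this complement: \<open>1 \<in> e + v(b) w\<close> for a weak
  inverse \<open>w\<close> of \<open>v(b)\<close>, and since \<open>\<phi>\<close> sends \<open>v(b)\<close> to zero, it sends \<open>e\<close> to one.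
\<close>

lemma nonvanishing_bump:
  assumes K: "hyperfield K" and \<phi>: "\<phi> \<in> multiring_hom (V_hull A) K"
    and U: "openin (constructible_topology A) U" "{a \<in> carrier A. \<phi> (V_unit A a) = \<zero>\<^bsub>K\<^esub>} \<in> U"
  shows "\<exists>e \<in> constructible_sections A. \<phi> e \<noteq> \<zero>\<^bsub>K\<^esub> \<and> (\<forall>q \<in> mr_spec A - U. e q = \<zero>\<^bsub>residue_field A q\<^esub>)"
proof -
  interpret K: hyperfield K by (rule K)
  interpret V: von_Neumann_hyperring "V_hull A" by (rule von_Neumann_V_hull)
  note \<phi>D = multiring_homD[OF \<phi>, unfolded V_carrier]
  let ?p = "{a \<in> carrier A. \<phi> (V_unit A a) = \<zero>\<^bsub>K\<^esub>}"
  have "generate_topology_on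
      (basic_open A ` carrier A \<union> (\<lambda>a. mr_spec A - basic_open A a) ` carrier A) U"
    using U(1) unfolding constructible_topology_def openin_topology_generated_by_iff .
  then show ?thesis using U(2)
  proof induction
    case Empty
    then show ?case by simp
  next
    case (Int U1 U2)
    then obtain e1 e2 where e1: "e1 \<in> constructible_sections A" "\<phi> e1 \<noteq> \<zero>\<^bsub>K\<^esub>"
          "\<forall>q \<in> mr_spec A - U1. e1 q = \<zero>\<^bsub>residue_field A q\<^esub>"
        and e2: "e2 \<in> constructible_sections A" "\<phi> e2 \<noteq> \<zero>\<^bsub>K\<^esub>"
          "\<forall>q \<in> mr_spec A - U2. e2 q = \<zero>\<^bsub>residue_field A q\<^esub>"
      by blast
    have "(e1 \<otimes>\<^bsub>V_hull A\<^esub> e2) q = \<zero>\<^bsub>residue_field A q\<^esub>" if q: "q \<in> mr_spec A - U1 \<inter> U2" for q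
    proof -
      have qs: "q \<in> mr_spec A" using q by blast
      interpret R: multiring "residue_field A q" by (rule multiring_residue_field[OF qs])
      have "e1 q = \<zero>\<^bsub>residue_field A q\<^esub> \<or> e2 q = \<zero>\<^bsub>residue_field A q\<^esub>" using q e1(3) e2(3) by blast
      then show ?thesis
        by (rule disjE) (simp_all add: qs section_value[OF e1(1) qs] section_value[OF e2(1) qs])
    qed
    moreover have "\<phi> (e1 \<otimes>\<^bsub>V_hull A\<^esub> e2) \<noteq> \<zero>\<^bsub>K\<^esub>"
      unfolding \<phi>D(3)[OF e1(1) e2(1)]
      using K.mult_eq_zero[OF _ \<phi>D(1)[OF e1(1)] \<phi>D(1)[OF e2(1)]] e1(2) e2(2) by blast
    ultimately show ?case using V_mult_closed[OF e1(1) e2(1)] by blast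
  next
    case (UN \<U>)
    then obtain U' where "U' \<in> \<U>" "?p \<in> U'" by blast
    then show ?case using UN.IH[of U'] by blast
  next
    case (Basis W)
    then consider a where "a \<in> carrier A" "W = basic_open A a"
      | b where "b \<in> carrier A" "W = mr_spec A - basic_open A b" by blast
    then show ?case
    proof cases
      case 1
      then have "\<phi> (V_unit A a) \<noteq> \<zero>\<^bsub>K\<^esub>" using Basis(2) unfolding basic_open_def by blast
      moreover have "\<forall>q \<in> mr_spec A - W. V_unit A a q = \<zero>\<^bsub>residue_field A q\<^esub>"
        using 1 V_unit_eq_zero_iff unfolding basic_open_def by blast
      ultimately show ?thesis using V_unit_section[OF 1(1)] by blast
    next
      case 2
      then have b: "\<phi> (V_unit A b) = \<zero>\<^bsub>K\<^esub>" using Basis(2) unfolding basic_open_def by blast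
      have "\<exists>e \<in> constructible_sections A. \<forall>q \<in> mr_spec A.
          b \<in> q \<and> e q = \<one>\<^bsub>residue_field A q\<^esub> \<or> b \<notin> q \<and> e q = \<zero>\<^bsub>residue_field A q\<^esub>"
      proof (rule section_from_pointwise)
        fix q assume q: "q \<in> mr_spec A"
        interpret R: multiring "residue_field A q" by (rule multiring_residue_field[OF q])
        show "\<exists>k \<in> carrier (residue_field A q).
            b \<in> q \<and> k = \<one>\<^bsub>residue_field A q\<^esub> \<or> b \<notin> q \<and> k = \<zero>\<^bsub>residue_field A q\<^esub>"
          using R.one_closed R.hzero_closed by blast
        show "\<forall>\<^sub>F r in near A q. b \<in> r \<and> g r = \<one>\<^bsub>residue_field A r\<^esub> \<or> b \<notin> r \<and> g r = \<zero>\<^bsub>residue_field A r\<^esub>"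
          if g: "fraction_germ A q g"
            "b \<in> q \<and> g q = \<one>\<^bsub>residue_field A q\<^esub> \<or> b \<notin> q \<and> g q = \<zero>\<^bsub>residue_field A q\<^esub>" for g
          using g(2)
        proof
          assume h: "b \<in> q \<and> g q = \<one>\<^bsub>residue_field A q\<^esub>"
          from near_in[OF q conjunct1[OF h]] near_eq[OF q g(1) fraction_germ_one[OF q] conjunct2[OF h]]
          show ?thesis by eventually_elim simp
        next
          assume h: "b \<notin> q \<and> g q = \<zero>\<^bsub>residue_field A q\<^esub>"
          from near_notin[OF q 2(1) conjunct1[OF h]] near_eq[OF q g(1) fraction_germ_zero[OF q] conjunct2[OF h]]
          show ?thesis by eventually_elim simp
        qed
      qed
      then obtain e where e: "e \<in> constructible_sections A" "\<And>q. q \<in> mr_spec A \<Longrightarrow>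
          b \<in> q \<and> e q = \<one>\<^bsub>residue_field A q\<^esub> \<or> b \<notin> q \<and> e q = \<zero>\<^bsub>residue_field A q\<^esub>" by blast
      note vb = V_unit_section[OF 2(1)]
      obtain w where w: "w \<in> constructible_sections A"
          "V_unit A b = V_unit A b \<otimes>\<^bsub>V_hull A\<^esub> V_unit A b \<otimes>\<^bsub>V_hull A\<^esub> w"
        using V.von_Neumann[of "V_unit A b"] vb by auto
      have one: "\<one>\<^bsub>V_hull A\<^esub> \<in> e \<boxplus>\<^bsub>V_hull A\<^esub> (V_unit A b \<otimes>\<^bsub>V_hull A\<^esub> w)"
        unfolding V_hadd_iff
      proof (intro conjI ballI V_one_closed)
        fix q assume q: "q \<in> mr_spec A"
        interpret R: hyperfield "residue_field A q" by (rule hyperfield_residue_field[OF q])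
        note val = section_value[OF vb q] section_value[OF w(1) q]
        show "\<one>\<^bsub>V_hull A\<^esub> q \<in> e q \<boxplus>\<^bsub>residue_field A q\<^esub> (V_unit A b \<otimes>\<^bsub>V_hull A\<^esub> w) q"
        proof (cases "b \<in> q")
          case True
          then have "V_unit A b q = \<zero>\<^bsub>residue_field A q\<^esub>" "e q = \<one>\<^bsub>residue_field A q\<^esub>"
            using V_unit_eq_zero_iff[OF 2(1) q] e(2)[OF q] by blast+
          then show ?thesis using q val by simp
        next
          case False
          then have nz: "V_unit A b q \<noteq> \<zero>\<^bsub>residue_field A q\<^esub>" and eq0: "e q = \<zero>\<^bsub>residue_field A q\<^esub>"
            using V_unit_eq_zero_iff[OF 2(1) q] e(2)[OF q] by blast+
          have "V_unit A b q \<otimes>\<^bsub>residue_field A q\<^esub> (V_unit A b q \<otimes>\<^bsub>residue_field A q\<^esub> w q) =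
              V_unit A b q \<otimes>\<^bsub>residue_field A q\<^esub> \<one>\<^bsub>residue_field A q\<^esub>"
            using arg_cong[OF w(2), of "\<lambda>f. f q"] q val by (simp add: R.m_assoc)
          then have "V_unit A b q \<otimes>\<^bsub>residue_field A q\<^esub> w q = \<one>\<^bsub>residue_field A q\<^esub>"
            by (rule R.hyperfield_cancel) (use val nz in simp_all)
          then show ?thesis using q eq0 by simp
        qed
      qed
      have "\<phi> \<one>\<^bsub>V_hull A\<^esub> \<in> \<phi> e \<boxplus>\<^bsub>K\<^esub> \<phi> (V_unit A b \<otimes>\<^bsub>V_hull A\<^esub> w)"
        by (rule \<phi>D(2)[OF one V_one_closed e(1) V_mult_closed[OF vb w(1)]])
      then have "\<one>\<^bsub>K\<^esub> \<in> \<phi> e \<boxplus>\<^bsub>K\<^esub> \<zero>\<^bsub>K\<^esub>"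
        using \<phi>D(6) \<phi>D(3)[OF vb w(1)] \<phi>D(1)[OF w(1)] b by simp
      then have "\<one>\<^bsub>K\<^esub> = \<phi> e" by (rule K.hadd_zero_right[OF _ \<phi>D(1)[OF e(1)]])
      then have "\<phi> e \<noteq> \<zero>\<^bsub>K\<^esub>" using K.one_neq_zero by simp
      moreover have "\<forall>q \<in> mr_spec A - W. e q = \<zero>\<^bsub>residue_field A q\<^esub>"
        using e(2) 2(2) unfolding basic_open_def by blast
      ultimately show ?thesis using e(1) by blast
    qed
  qed
qed

text \<open>
  Near the kernel \<open>p\<close> of \<open>\<phi> \<circ> v\<close> a section \<open>h\<close> is a fraction \<open>x/y\<close>, so \<open>h v(y) e = v(x) e\<close> for a section
  \<open>e\<close> supported near \<open>p\<close> with \<open>\<phi> e \<noteq> 0\<close>. Cancelling \<open>\<phi> e\<close> gives \<open>\<phi> h \<cdot> \<phi> (v y) = \<phi> (v x)\<close>, and \<open>\<phi> (v y)\<close> is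
  invertible. Thus \<open>\<phi> h\<close> is determined by \<open>\<phi> \<circ> v\<close>.
\<close>

theorem hom_from_V_hull_determined:
  assumes K: "hyperfield K" and \<phi>: "\<phi> \<in> multiring_hom (V_hull A) K" and \<psi>: "\<psi> \<in> multiring_hom (V_hull A) K"
    and agree: "\<And>a. a \<in> carrier A \<Longrightarrow> \<phi> (V_unit A a) = \<psi> (V_unit A a)"
  shows "\<phi> = \<psi>"
proof (rule multiring_hom_eqI[OF \<phi> \<psi>], unfold V_carrier)
  fix h assume h: "h \<in> constructible_sections A"
  interpret K: hyperfield K by (rule K)
  define p where "p = {a \<in> carrier A. \<phi> (V_unit A a) = \<zero>\<^bsub>K\<^esub>}"
  have p': "p = {a \<in> carrier A. \<psi> (V_unit A a) = \<zero>\<^bsub>K\<^esub>}" unfolding p_def using agree by auto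
  have "{a \<in> carrier A. compose (carrier A) \<phi> (V_unit A) a \<in> {\<zero>\<^bsub>K\<^esub>}} \<in> mr_spec A"
    by (rule hom_preimage_prime[OF multiring_axioms K.multiring_axioms
          multiring_hom_compose[OF multiring_axioms V_unit_hom \<phi>] K.zero_prime])
  moreover have "{a \<in> carrier A. compose (carrier A) \<phi> (V_unit A) a \<in> {\<zero>\<^bsub>K\<^esub>}} = p"
    unfolding p_def by (auto simp: compose_eq)
  ultimately have p: "p \<in> mr_spec A" by simp
  obtain x y where x: "x \<in> carrier A" "y \<in> carrier A" "y \<notin> p"
      "\<forall>\<^sub>F q in near A p. q \<in> mr_spec A \<and> y \<notin> q \<and> h q = residue_frac A q x y"
    using fraction_germE[OF section_germ[OF h p] p] .
  then obtain U where U: "openin (constructible_topology A) U" "p \<in> U"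
      "\<forall>q \<in> U. q \<in> mr_spec A \<and> y \<notin> q \<and> h q = residue_frac A q x y"
    unfolding near_iff[OF p] by blast
  note vx = V_unit_section[OF x(1)] and vy = V_unit_section[OF x(2)]
  have key: "\<chi> h \<otimes>\<^bsub>K\<^esub> \<chi> (V_unit A y) = \<chi> (V_unit A x)"
    if \<chi>: "\<chi> \<in> multiring_hom (V_hull A) K" and c: "p = {a \<in> carrier A. \<chi> (V_unit A a) = \<zero>\<^bsub>K\<^esub>}" for \<chi>
  proof -
    note \<chi>D = multiring_homD[OF \<chi>, unfolded V_carrier]
    obtain e where e: "e \<in> constructible_sections A" "\<chi> e \<noteq> \<zero>\<^bsub>K\<^esub>"
        "\<And>q. q \<in> mr_spec A - U \<Longrightarrow> e q = \<zero>\<^bsub>residue_field A q\<^esub>"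
      using nonvanishing_bump[OF K \<chi> U(1) U(2)[unfolded c]] by blast
    have "e \<otimes>\<^bsub>V_hull A\<^esub> (h \<otimes>\<^bsub>V_hull A\<^esub> V_unit A y) = e \<otimes>\<^bsub>V_hull A\<^esub> V_unit A x"
    proof (rule section_ext)
      fix q assume q: "q \<in> mr_spec A"
      interpret R: multiring "residue_field A q" by (rule multiring_residue_field[OF q])
      note val = section_value[OF e(1) q] section_value[OF h q] section_value[OF vx q] section_value[OF vy q]
      show "(e \<otimes>\<^bsub>V_hull A\<^esub> (h \<otimes>\<^bsub>V_hull A\<^esub> V_unit A y)) q = (e \<otimes>\<^bsub>V_hull A\<^esub> V_unit A x) q"
      proof (cases "q \<in> U")
        case True
        then have "h q \<otimes>\<^bsub>residue_field A q\<^esub> V_unit A y q = V_unit A x q"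
          using residue_frac_mult_V_unit[OF q x(1,2)] U(3) by simp
        then show ?thesis using q by simp
      next
        case False
        then show ?thesis using e(3) q val by simp
      qed
    qed (intro V_closed e(1) h vx vy)+
    then have "\<chi> e \<otimes>\<^bsub>K\<^esub> (\<chi> h \<otimes>\<^bsub>K\<^esub> \<chi> (V_unit A y)) = \<chi> e \<otimes>\<^bsub>K\<^esub> \<chi> (V_unit A x)"
      using \<chi>D(3) e(1) h vx vy V_mult_closed[OF h vy] by metis
    then show ?thesis
      by (rule K.hyperfield_cancel) (use e(2) \<chi>D(1) e(1) h vx vy in simp_all)
  qed
  have "\<phi> (V_unit A y) \<otimes>\<^bsub>K\<^esub> \<phi> h = \<phi> (V_unit A y) \<otimes>\<^bsub>K\<^esub> \<psi> h"
    using key[OF \<phi> p_def] key[OF \<psi> p'] agree[OF x(1)] agree[OF x(2)] multiring_homD(1)[OF \<phi>] multiring_homD(1)[OF \<psi>]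
      h vy K.m_comm by (metis V_carrier)
  then show "\<phi> h = \<psi> h"
  proof (rule K.hyperfield_cancel)
    show "\<phi> (V_unit A y) \<noteq> \<zero>\<^bsub>K\<^esub>" using x(2,3) unfolding p_def by blast
  qed (use multiring_homD(1)[OF \<phi>] multiring_homD(1)[OF \<psi>] h vy in simp_all)
qed

lemma evaluation_hom:
  assumes q: "q \<in> mr_spec A"
  shows "(\<lambda>h \<in> constructible_sections A. h q) \<in> multiring_hom (V_hull A) (residue_field A q)"
  by (rule multiring_homI) (simp_all add: q section_value V_closed V_haddD)

end

text \<open>
  A section is determined by its values, and each evaluation maps to a hyperfield.
\<close>

lemma hom_between_V_hulls_determined:
  assumes A: "multiring A" and B: "multiring B" and g: "g \<in> multiring_hom (V_hull A) (V_hull B)"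
    and g': "g' \<in> multiring_hom (V_hull A) (V_hull B)"
    and agree: "\<And>a. a \<in> carrier A \<Longrightarrow> g (V_unit A a) = g' (V_unit A a)"
  shows "g = g'"
proof (rule multiring_hom_eqI[OF g g'])
  interpret A: multiring A by (rule A)
  interpret B: multiring B by (rule B)
  fix h assume h: "h \<in> carrier (V_hull A)"
  note hs = h[unfolded V_carrier]
  have gh: "g h \<in> constructible_sections B" "g' h \<in> constructible_sections B"
    using multiring_homD(1)[OF g h] multiring_homD(1)[OF g' h] by simp_all
  show "g h = g' h"
  proof (rule B.section_ext[OF gh])
    fix q assume q: "q \<in> mr_spec B"
    let ?ev = "\<lambda>h \<in> constructible_sections B. h q"
    have e: "compose (constructible_sections A) ?ev k a = k a q"
      if "k \<in> multiring_hom (V_hull A) (V_hull B)" "a \<in> constructible_sections A" for k a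
      using multiring_homD(1)[OF that(1), of a] that(2) by (simp add: compose_eq)
    have "compose (constructible_sections A) ?ev g = compose (constructible_sections A) ?ev g'"
      by (rule A.hom_from_V_hull_determined[OF B.hyperfield_residue_field[OF q]])
        (use multiring_hom_compose[OF A.multiring_V_hull g B.evaluation_hom[OF q]]
          multiring_hom_compose[OF A.multiring_V_hull g' B.evaluation_hom[OF q]]
          in \<open>simp_all add: e[OF g] e[OF g'] A.V_unit_section agree\<close>)
    then show "g h q = g' h q" using e[OF g hs] e[OF g' hs] by simp
  qed
qed

section \<open>Functoriality\<close>

locale multiring_morphism = A: multiring A + B: multiring B
  for A :: "('a, 'm) multiring_scheme" and B :: "('b, 'n) multiring_scheme" +
  fixes f
  assumes hom: "f \<in> multiring_hom A B"
begin

lemmas fD = multiring_homD[OF hom]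

definition pullback :: "'b set \<Rightarrow> 'a set" where
  "pullback q = {a \<in> carrier A. f a \<in> q}"

lemma pullback_spec: "q \<in> mr_spec B \<Longrightarrow> pullback q \<in> mr_spec A"
  unfolding pullback_def by (rule hom_preimage_prime[OF A.multiring_axioms B.multiring_axioms hom])

lemma notin_pullback: "\<lbrakk>a \<in> carrier A; a \<notin> pullback q\<rbrakk> \<Longrightarrow> f a \<notin> q"
  unfolding pullback_def by blast

lemma continuous_pullback:
  "continuous_map (constructible_topology B) (constructible_topology A) pullback"
proof -
  let ?G = "basic_open A ` carrier A \<union> (\<lambda>a. mr_spec A - basic_open A a) ` carrier A"
  have "continuous_map (constructible_topology B) (topology_generated_by ?G) pullback"
  proof (rule continuous_on_generated_topo)
    fix U assume "U \<in> ?G"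
    then obtain a where a: "a \<in> carrier A" "U = basic_open A a \<or> U = mr_spec A - basic_open A a" by blast
    have *: "pullback -` basic_open A a \<inter> mr_spec B = basic_open B (f a)"
      unfolding basic_open_def using a(1) pullback_spec unfolding pullback_def by auto
    then have "pullback -` (mr_spec A - basic_open A a) \<inter> mr_spec B = mr_spec B - basic_open B (f a)"
      using pullback_spec by blast
    then have "pullback -` U \<inter> mr_spec B = basic_open B (f a) \<or>
        pullback -` U \<inter> mr_spec B = mr_spec B - basic_open B (f a)"
      using a(2) * by blast
    then show "openin (constructible_topology B) (pullback -` U \<inter> topspace (constructible_topology B))"
      using B.openin_basic[OF fD(1)[OF a(1)]] B.openin_cobasic[OF fD(1)[OF a(1)]] by auto
  next
    have "\<Union>?G = mr_spec A"
      using A.topspace_constructible unfolding constructible_topology_def topology_generated_by_topspace .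
    then show "pullback ` topspace (constructible_topology B) \<subseteq> \<Union>?G"
      using pullback_spec by auto
  qed
  then show ?thesis unfolding constructible_topology_def[of A] .
qed

lemma eventually_pullback:
  assumes q: "q \<in> mr_spec B" and P: "eventually P (near A (pullback q))"
  shows "\<forall>\<^sub>F r in near B q. P (pullback r)"
proof -
  obtain U where U: "openin (constructible_topology A) U" "pullback q \<in> U" "\<forall>p \<in> U. P p"
    using P A.near_iff[OF pullback_spec[OF q]] by blast
  have "openin (constructible_topology B) {r \<in> topspace (constructible_topology B). pullback r \<in> U}"
    by (rule openin_continuous_map_preimage[OF continuous_pullback U(1)])
  then show ?thesis
    unfolding B.near_iff[OF q] using U(2,3) q
    by (intro exI[of _ "{r \<in> topspace (constructible_topology B). pullback r \<in> U}"]) auto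
qed

text \<open>
  The morphism \<open>f\<close> induces \<open>x/y \<mapsto> f x/f y\<close> from the residue hyperfield at \<open>pullback q\<close> to the one
  at \<open>q\<close>. Preservation of sums includes independence of the fraction, since equality is a sum with zero.
\<close>

lemma residue_map_hadd:
  assumes q: "q \<in> mr_spec B" and x: "x \<in> carrier A" "y \<in> carrier A" "y \<notin> pullback q"
    and x': "x' \<in> carrier A" "y' \<in> carrier A" "y' \<notin> pullback q"
    and x'': "x'' \<in> carrier A" "y'' \<in> carrier A" "y'' \<notin> pullback q"
    and mem: "residue_frac A (pullback q) x y \<in> residue_frac A (pullback q) x' y'
      \<boxplus>\<^bsub>residue_field A (pullback q)\<^esub> residue_frac A (pullback q) x'' y''"
  shows "residue_frac B q (f x) (f y) \<in> residue_frac B q (f x') (f y')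
      \<boxplus>\<^bsub>residue_field B q\<^esub> residue_frac B q (f x'') (f y'')"
proof -
  obtain v d i where v: "v \<in> carrier A - pullback q"
      and d: "d \<in> (x' \<otimes>\<^bsub>A\<^esub> y \<otimes>\<^bsub>A\<^esub> y'' \<otimes>\<^bsub>A\<^esub> v) \<boxplus>\<^bsub>A\<^esub> (x'' \<otimes>\<^bsub>A\<^esub> y \<otimes>\<^bsub>A\<^esub> y' \<otimes>\<^bsub>A\<^esub> v)"
      and i: "i \<in> pullback q" "x \<otimes>\<^bsub>A\<^esub> y' \<otimes>\<^bsub>A\<^esub> y'' \<otimes>\<^bsub>A\<^esub> v \<in> d \<boxplus>\<^bsub>A\<^esub> i"
    using mem unfolding A.residue_hadd_iff[OF pullback_spec[OF q] x x' x''] by blast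
  have vc: "v \<in> carrier A" "f v \<in> carrier B - q" using v notin_pullback fD(1) by blast+
  have ic: "i \<in> carrier A" "f i \<in> q" using i(1) unfolding pullback_def by blast+
  note car = x(1,2) x'(1,2) x''(1,2) vc(1)
  have s: "x' \<otimes>\<^bsub>A\<^esub> y \<otimes>\<^bsub>A\<^esub> y'' \<otimes>\<^bsub>A\<^esub> v \<in> carrier A" "x'' \<otimes>\<^bsub>A\<^esub> y \<otimes>\<^bsub>A\<^esub> y' \<otimes>\<^bsub>A\<^esub> v \<in> carrier A"
      "x \<otimes>\<^bsub>A\<^esub> y' \<otimes>\<^bsub>A\<^esub> y'' \<otimes>\<^bsub>A\<^esub> v \<in> carrier A" using car by simp_all
  have dc: "d \<in> carrier A" by (rule A.hadd_mem_carrier[OF d s(1,2)])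
  have "f d \<in> (f x' \<otimes>\<^bsub>B\<^esub> f y \<otimes>\<^bsub>B\<^esub> f y'' \<otimes>\<^bsub>B\<^esub> f v) \<boxplus>\<^bsub>B\<^esub> (f x'' \<otimes>\<^bsub>B\<^esub> f y \<otimes>\<^bsub>B\<^esub> f y' \<otimes>\<^bsub>B\<^esub> f v)"
    using fD(2)[OF d dc s(1,2)] car by (simp add: fD(3))
  moreover have "f x \<otimes>\<^bsub>B\<^esub> f y' \<otimes>\<^bsub>B\<^esub> f y'' \<otimes>\<^bsub>B\<^esub> f v \<in> f d \<boxplus>\<^bsub>B\<^esub> f i"
    using fD(2)[OF i(2) s(3) dc ic(1)] car by (simp add: fD(3))
  ultimately show ?thesis
    unfolding B.residue_hadd_iff[OF q fD(1)[OF x(1)] fD(1)[OF x(2)] notin_pullback[OF x(2,3)]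
        fD(1)[OF x'(1)] fD(1)[OF x'(2)] notin_pullback[OF x'(2,3)]
        fD(1)[OF x''(1)] fD(1)[OF x''(2)] notin_pullback[OF x''(2,3)]]
    using vc(2) ic(2) by blast
qed

lemma residue_map_eq:
  assumes q: "q \<in> mr_spec B" and x: "x \<in> carrier A" "y \<in> carrier A" "y \<notin> pullback q"
    and x': "x' \<in> carrier A" "y' \<in> carrier A" "y' \<notin> pullback q"
    and e: "residue_frac A (pullback q) x y = residue_frac A (pullback q) x' y'"
  shows "residue_frac B q (f x) (f y) = residue_frac B q (f x') (f y')"
proof -
  note p = pullback_spec[OF q]
  have "residue_frac A (pullback q) x y \<in> residue_frac A (pullback q) x' y'
      \<boxplus>\<^bsub>residue_field A (pullback q)\<^esub> residue_frac A (pullback q) \<zero>\<^bsub>A\<^esub> \<one>\<^bsub>A\<^esub>"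
    using e A.residue_eq_iff[OF p A.residue_fracI[OF p x] A.residue_fracI[OF p x']] A.residue_zero by simp
  then have "residue_frac B q (f x) (f y) \<in> residue_frac B q (f x') (f y')
      \<boxplus>\<^bsub>residue_field B q\<^esub> residue_frac B q (f \<zero>\<^bsub>A\<^esub>) (f \<one>\<^bsub>A\<^esub>)"
    by (rule residue_map_hadd[OF q x x' A.hzero_closed A.one_closed specD(2)[OF p]])
  then show ?thesis
    unfolding fD(5,6) using B.residue_zero
      B.residue_eq_iff[OF q B.residue_fracI[OF q fD(1)[OF x(1)] fD(1)[OF x(2)] notin_pullback[OF x(2,3)]]
        B.residue_fracI[OF q fD(1)[OF x'(1)] fD(1)[OF x'(2)] notin_pullback[OF x'(2,3)]]]
    by simp
qed

text \<open>
  The value at \<open>q\<close> is the image of the value at \<open>pullback q\<close> under the induced map of residue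
  hyperfields. By \<open>residue_map_eq\<close> only one \<open>k\<close> can be chosen.
\<close>

definition V_lift :: "('a set \<Rightarrow> ('a set \<times> 'a set) set) \<Rightarrow> 'b set \<Rightarrow> ('b set \<times> 'b set) set" where
  "V_lift = (\<lambda>h \<in> constructible_sections A. \<lambda>q \<in> mr_spec B. SOME k.
    \<exists>x \<in> carrier A. \<exists>y \<in> carrier A - pullback q.
      h (pullback q) = residue_frac A (pullback q) x y \<and> k = residue_frac B q (f x) (f y))"

lemma V_lift_apply:
  assumes h: "h \<in> constructible_sections A" and q: "q \<in> mr_spec B"
    and x: "x \<in> carrier A" "y \<in> carrier A" "y \<notin> pullback q" and e: "h (pullback q) = residue_frac A (pullback q) x y"
  shows "V_lift h q = residue_frac B q (f x) (f y)"
proof -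
  have "(SOME k. \<exists>x \<in> carrier A. \<exists>y \<in> carrier A - pullback q.
      h (pullback q) = residue_frac A (pullback q) x y \<and> k = residue_frac B q (f x) (f y))
    = residue_frac B q (f x) (f y)"
  proof (rule some_equality)
    fix k assume "\<exists>x \<in> carrier A. \<exists>y \<in> carrier A - pullback q.
      h (pullback q) = residue_frac A (pullback q) x y \<and> k = residue_frac B q (f x) (f y)"
    then obtain x' y' where x': "x' \<in> carrier A" "y' \<in> carrier A" "y' \<notin> pullback q"
        "h (pullback q) = residue_frac A (pullback q) x' y'" "k = residue_frac B q (f x') (f y')" by blast
    then show "k = residue_frac B q (f x) (f y)"
      using residue_map_eq[OF q x'(1-3) x] e by simp
  qed (use x e in blast)
  then show ?thesis unfolding V_lift_def using h q by simp
qed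

lemma section_repr:
  assumes "h \<in> constructible_sections A" "q \<in> mr_spec B"
  obtains x y where "x \<in> carrier A" "y \<in> carrier A" "y \<notin> pullback q"
    "h (pullback q) = residue_frac A (pullback q) x y"
  using A.section_value[OF assms(1) pullback_spec[OF assms(2)]]
  unfolding A.residue_carrier[OF pullback_spec[OF assms(2)]] by blast

lemma V_lift_section:
  assumes h: "h \<in> constructible_sections A"
  shows "V_lift h \<in> constructible_sections B"
proof -
  have "fraction_germ B q (V_lift h)" if q: "q \<in> mr_spec B" for q
  proof -
    note p = pullback_spec[OF q]
    obtain x y where x: "x \<in> carrier A" "y \<in> carrier A" "y \<notin> pullback q"
        and ev: "\<forall>\<^sub>F p in near A (pullback q). p \<in> mr_spec A \<and> y \<notin> p \<and> h p = residue_frac A p x y"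
      using A.fraction_germE[OF A.section_germ[OF h p] p] .
    have "\<forall>\<^sub>F r in near B q. V_lift h r = residue_frac B r (f x) (f y)"
      using eventually_pullback[OF q ev] B.near_spec[OF q]
      by eventually_elim (use V_lift_apply[OF h _ x(1,2)] in blast)
    then show ?thesis
      by (rule B.fraction_germI[OF q fD(1)[OF x(1)] fD(1)[OF x(2)] notin_pullback[OF x(2,3)]])
  qed
  then show ?thesis
    unfolding B.constructible_sections_iff using h by (simp add: V_lift_def)
qed

lemma V_lift_unit: "a \<in> carrier A \<Longrightarrow> V_lift (V_unit A a) = V_unit B (f a)"
proof (rule B.section_ext)
  fix q assume a: "a \<in> carrier A" and q: "q \<in> mr_spec B"
  have "V_lift (V_unit A a) q = residue_frac B q (f a) (f \<one>\<^bsub>A\<^esub>)"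
    by (rule V_lift_apply[OF A.V_unit_section[OF a] q a A.one_closed specD(2)[OF pullback_spec[OF q]]])
      (rule A.V_unit_apply[OF a pullback_spec[OF q]])
  then show "V_lift (V_unit A a) q = V_unit B (f a) q"
    unfolding fD(6) using B.V_unit_apply[OF fD(1)[OF a] q] by simp
qed (auto simp: V_lift_section A.V_unit_section B.V_unit_section fD(1))

lemma V_lift_hom: "V_lift \<in> multiring_hom (V_hull A) (V_hull B)"
proof (rule multiring_homI; (unfold V_carrier)?)
  show "V_lift \<in> extensional (constructible_sections A)" unfolding V_lift_def by simp
  show "V_lift h \<in> constructible_sections B" if "h \<in> constructible_sections A" for h
    by (rule V_lift_section[OF that])
  show "V_lift h \<in> V_lift g \<boxplus>\<^bsub>V_hull B\<^esub> V_lift k"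
    if h: "h \<in> constructible_sections A" and g: "g \<in> constructible_sections A"
      and k: "k \<in> constructible_sections A" and mem: "h \<in> g \<boxplus>\<^bsub>V_hull A\<^esub> k" for h g k
    unfolding V_hadd_iff
  proof (intro conjI ballI V_lift_section[OF h])
    fix q assume q: "q \<in> mr_spec B"
    note p = pullback_spec[OF q]
    obtain x y where x: "x \<in> carrier A" "y \<in> carrier A" "y \<notin> pullback q"
        "h (pullback q) = residue_frac A (pullback q) x y" using section_repr[OF h q] .
    obtain x' y' where x': "x' \<in> carrier A" "y' \<in> carrier A" "y' \<notin> pullback q"
        "g (pullback q) = residue_frac A (pullback q) x' y'" using section_repr[OF g q] .
    obtain x'' y'' where x'': "x'' \<in> carrier A" "y'' \<in> carrier A" "y'' \<notin> pullback q"
        "k (pullback q) = residue_frac A (pullback q) x'' y''" using section_repr[OF k q] .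
    show "V_lift h q \<in> V_lift g q \<boxplus>\<^bsub>residue_field B q\<^esub> V_lift k q"
      unfolding V_lift_apply[OF h q x] V_lift_apply[OF g q x'] V_lift_apply[OF k q x'']
      using residue_map_hadd[OF q x(1-3) x'(1-3) x''(1-3)] V_haddD[OF mem p] x(4) x'(4) x''(4) by simp
  qed
  show "V_lift (h \<otimes>\<^bsub>V_hull A\<^esub> g) = V_lift h \<otimes>\<^bsub>V_hull B\<^esub> V_lift g"
    if h: "h \<in> constructible_sections A" and g: "g \<in> constructible_sections A" for h g
  proof (rule B.section_ext)
    fix q assume q: "q \<in> mr_spec B"
    note p = pullback_spec[OF q]
    obtain x y where x: "x \<in> carrier A" "y \<in> carrier A" "y \<notin> pullback q"
        "h (pullback q) = residue_frac A (pullback q) x y" using section_repr[OF h q] .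
    obtain x' y' where x': "x' \<in> carrier A" "y' \<in> carrier A" "y' \<notin> pullback q"
        "g (pullback q) = residue_frac A (pullback q) x' y'" using section_repr[OF g q] .
    have "(h \<otimes>\<^bsub>V_hull A\<^esub> g) (pullback q) = residue_frac A (pullback q) (x \<otimes>\<^bsub>A\<^esub> x') (y \<otimes>\<^bsub>A\<^esub> y')"
      using A.residue_mult[OF p x(1-3) x'(1-3)] p x(4) x'(4) by simp
    then have "V_lift (h \<otimes>\<^bsub>V_hull A\<^esub> g) q = residue_frac B q (f (x \<otimes>\<^bsub>A\<^esub> x')) (f (y \<otimes>\<^bsub>A\<^esub> y'))"
      using A.spec_mult_notin[OF p, of y y'] x x' by (intro V_lift_apply A.V_mult_closed h g q) simp_all
    also have "\<dots> = V_lift h q \<otimes>\<^bsub>residue_field B q\<^esub> V_lift g q"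
      unfolding V_lift_apply[OF h q x] V_lift_apply[OF g q x']
      using B.residue_mult[OF q fD(1)[OF x(1)] fD(1)[OF x(2)] notin_pullback[OF x(2,3)]
          fD(1)[OF x'(1)] fD(1)[OF x'(2)] notin_pullback[OF x'(2,3)]] x x' by (simp add: fD(3))
    finally show "V_lift (h \<otimes>\<^bsub>V_hull A\<^esub> g) q = (V_lift h \<otimes>\<^bsub>V_hull B\<^esub> V_lift g) q" using q by simp
  qed (intro V_lift_section A.V_mult_closed B.V_mult_closed h g)+
  show "V_lift (\<boxminus>\<^bsub>V_hull A\<^esub> h) = \<boxminus>\<^bsub>V_hull B\<^esub> V_lift h" if h: "h \<in> constructible_sections A" for h
  proof (rule B.section_ext)
    fix q assume q: "q \<in> mr_spec B"
    note p = pullback_spec[OF q]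
    obtain x y where x: "x \<in> carrier A" "y \<in> carrier A" "y \<notin> pullback q"
        "h (pullback q) = residue_frac A (pullback q) x y" using section_repr[OF h q] .
    have "(\<boxminus>\<^bsub>V_hull A\<^esub> h) (pullback q) = residue_frac A (pullback q) (\<boxminus>\<^bsub>A\<^esub> x) y"
      using A.residue_neg[OF p x(1-3)] p x(4) by simp
    then have "V_lift (\<boxminus>\<^bsub>V_hull A\<^esub> h) q = residue_frac B q (f (\<boxminus>\<^bsub>A\<^esub> x)) (f y)"
      using x by (intro V_lift_apply A.V_neg_closed h q) simp_all
    also have "\<dots> = \<boxminus>\<^bsub>residue_field B q\<^esub> (V_lift h q)"
      unfolding V_lift_apply[OF h q x]
      using B.residue_neg[OF q fD(1)[OF x(1)] fD(1)[OF x(2)] notin_pullback[OF x(2,3)]] x by (simp add: fD(4))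
    finally show "V_lift (\<boxminus>\<^bsub>V_hull A\<^esub> h) q = (\<boxminus>\<^bsub>V_hull B\<^esub> V_lift h) q" using q by simp
  qed (intro V_lift_section A.V_neg_closed B.V_neg_closed h)+
  show "V_lift \<zero>\<^bsub>V_hull A\<^esub> = \<zero>\<^bsub>V_hull B\<^esub>"
    using V_lift_unit[OF A.hzero_closed] multiring_homD(5)[OF A.V_unit_hom] multiring_homD(5)[OF B.V_unit_hom] fD(5)
    by simp
  show "V_lift \<one>\<^bsub>V_hull A\<^esub> = \<one>\<^bsub>V_hull B\<^esub>"
    using V_lift_unit[OF A.one_closed] multiring_homD(6)[OF A.V_unit_hom] multiring_homD(6)[OF B.V_unit_hom] fD(6)
    by simp
qed

end

theorem V_map_exists_unique:
  assumes A: "multiring A" and B: "multiring B" and f: "f \<in> multiring_hom A B"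
  shows "\<exists>!g. g \<in> multiring_hom (V_hull A) (V_hull B) \<and>
    compose (carrier A) g (V_unit A) = compose (carrier A) (V_unit B) f"
proof -
  interpret multiring_morphism A B f
    by (intro multiring_morphism.intro multiring_morphism_axioms.intro A B f)
  show ?thesis
  proof (rule ex1I[of _ V_lift])
    have "compose (carrier A) V_lift (V_unit A) = compose (carrier A) (V_unit B) f"
      unfolding compose_def by (rule restrict_ext) (rule V_lift_unit)
    then show "V_lift \<in> multiring_hom (V_hull A) (V_hull B) \<and>
        compose (carrier A) V_lift (V_unit A) = compose (carrier A) (V_unit B) f"
      using V_lift_hom by blast
    fix g assume g: "g \<in> multiring_hom (V_hull A) (V_hull B) \<and>
        compose (carrier A) g (V_unit A) = compose (carrier A) (V_unit B) f"
    have "g (V_unit A a) = V_lift (V_unit A a)" if "a \<in> carrier A" for a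
      using g that V_lift_unit[OF that] by (metis compose_eq)
    then show "g = V_lift" using hom_between_V_hulls_determined[OF A B _ V_lift_hom] g by blast
  qed
qed

lemma V_map:
  assumes A: "multiring A" and B: "multiring B" and f: "f \<in> multiring_hom A B"
  shows V_map_hom: "V_map A B f \<in> multiring_hom (V_hull A) (V_hull B)"
    and V_map_unit: "a \<in> carrier A \<Longrightarrow> V_map A B f (V_unit A a) = V_unit B (f a)"
proof -
  have *: "V_map A B f \<in> multiring_hom (V_hull A) (V_hull B) \<and>
      compose (carrier A) (V_map A B f) (V_unit A) = compose (carrier A) (V_unit B) f"
    unfolding V_map_def by (rule theI'[OF V_map_exists_unique[OF A B f]])
  then show "V_map A B f \<in> multiring_hom (V_hull A) (V_hull B)" by blast
  show "V_map A B f (V_unit A a) = V_unit B (f a)" if "a \<in> carrier A"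
    using * that by (metis compose_eq)
qed

lemma V_map_eqI:
  assumes A: "multiring A" and B: "multiring B" and f: "f \<in> multiring_hom A B"
    and g: "g \<in> multiring_hom (V_hull A) (V_hull B)"
    and "\<And>a. a \<in> carrier A \<Longrightarrow> g (V_unit A a) = V_unit B (f a)"
  shows "V_map A B f = g"
  by (rule hom_between_V_hulls_determined[OF A B V_map_hom[OF A B f] g])
    (simp add: V_map_unit[OF A B f] assms(5))

lemma identity_hom: "multiring A \<Longrightarrow> (\<lambda>a \<in> carrier A. a) \<in> multiring_hom A A"
proof -
  assume "multiring A"
  then interpret multiring A .
  show ?thesis by (rule multiring_homI) simp_all
qed

lemma V_map_identity:
  assumes A: "multiring A"
  shows "V_map A A (\<lambda>a \<in> carrier A. a) = (\<lambda>x \<in> carrier (V_hull A). x)"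
proof (rule V_map_eqI[OF A A identity_hom[OF A] identity_hom[OF multiring.multiring_V_hull[OF A]]])
  fix a assume a: "a \<in> carrier A"
  then show "(\<lambda>x \<in> carrier (V_hull A). x) (V_unit A a) = V_unit A ((\<lambda>a \<in> carrier A. a) a)"
    using multiring.V_unit_section[OF A a] by simp
qed

lemma V_map_compose:
  assumes A: "multiring A" and B: "multiring B" and C: "multiring C"
    and f: "f \<in> multiring_hom A B" and g: "g \<in> multiring_hom B C"
  shows "V_map A C (compose (carrier A) g f) = compose (carrier (V_hull A)) (V_map B C g) (V_map A B f)"
proof (rule V_map_eqI[OF A C multiring_hom_compose[OF A f g]
      multiring_hom_compose[OF multiring.multiring_V_hull[OF A] V_map_hom[OF A B f] V_map_hom[OF B C g]]])
  fix a assume a: "a \<in> carrier A"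
  show "compose (carrier (V_hull A)) (V_map B C g) (V_map A B f) (V_unit A a) =
      V_unit C (compose (carrier A) g f a)"
    using multiring.V_unit_section[OF A a] multiring_homD(1)[OF f a] a
    by (simp add: compose_eq V_map_unit[OF A B f] V_map_unit[OF B C g])
qed

section \<open>The canonical morphism of a geometric von Neumann hyperring\<close>

lemma (in multiring) spec_mult_iff:
  assumes p: "p \<in> mr_spec A" and ab: "a \<in> carrier A" "b \<in> carrier A"
  shows "a \<otimes> b \<in> p \<longleftrightarrow> a \<in> p \<or> b \<in> p"
proof
  show "a \<otimes> b \<in> p \<Longrightarrow> a \<in> p \<or> b \<in> p" by (rule specD(3)[OF p _ ab])
  show "a \<in> p \<or> b \<in> p \<Longrightarrow> a \<otimes> b \<in> p"
    using ideal_mult[OF specD(1)[OF p] ab(1)] ideal_mult_right[OF specD(1)[OF p] _ ab(2)] by blast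
qed

lemma (in multiring) basic_open_mult:
  "\<lbrakk>a \<in> carrier A; b \<in> carrier A\<rbrakk> \<Longrightarrow> basic_open A (a \<otimes> b) = basic_open A a \<inter> basic_open A b"
  unfolding basic_open_def using spec_mult_iff[of _ a b] by blast

context hyperring
begin

lemma principal_ideal:
  assumes v: "v \<in> carrier A"
  shows "mr_ideal A ((\<lambda>r. r \<otimes> v) ` carrier A)" (is "mr_ideal A ?I")
  unfolding mr_ideal_def
proof (intro conjI ballI)
  show "?I \<subseteq> carrier A" "?I \<noteq> {}" using v by auto
  show "a \<boxplus> b \<subseteq> ?I" if ab: "a \<in> ?I" "b \<in> ?I" for a b
  proof
    fix x assume x: "x \<in> a \<boxplus> b"
    obtain r s where r: "r \<in> carrier A" "a = r \<otimes> v" and s: "s \<in> carrier A" "b = s \<otimes> v" using ab by blast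
    then obtain t where t: "t \<in> r \<boxplus> s" "x = t \<otimes> v" using hadd_mult_converse[OF r(1) s(1) v] x by blast
    have "t \<in> carrier A" using t(1) r(1) s(1) by (rule hadd_mem_carrier)
    then show "x \<in> ?I" using t(2) by blast
  qed
  show "a \<otimes> b \<in> ?I" if a: "a \<in> carrier A" and b: "b \<in> ?I" for a b
  proof -
    obtain r where r: "r \<in> carrier A" "b = r \<otimes> v" using b by blast
    then have "a \<otimes> b = (a \<otimes> r) \<otimes> v" using a v by (simp add: m_assoc)
    then show ?thesis using m_closed[OF a r(1)] by blast
  qed
qed

text \<open>
  A power of \<open>1\<close> is \<open>1\<close>, and in a hyperring the ideal generated by \<open>v\<close> consists of the multiples of \<open>v\<close>.
\<close>

lemma sheaf_denoms_one_unit: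
  assumes "v \<in> sheaf_denoms A \<one>"
  obtains w where "v \<in> carrier A" "w \<in> carrier A" "v \<otimes> w = \<one>"
proof -
  obtain n :: nat where v: "v \<in> carrier A" "\<one> [^] n \<in> mr_genideal A v"
    using assms unfolding sheaf_denoms_def by blast
  have "v \<in> (\<lambda>r. r \<otimes> v) ` carrier A" using v(1) by (intro image_eqI[of _ _ \<one>]) simp_all
  then have "\<one> \<in> (\<lambda>r. r \<otimes> v) ` carrier A"
    using genideal_least[OF principal_ideal[OF v(1)]] v(2) by auto
  then obtain w where "w \<in> carrier A" "\<one> = w \<otimes> v" by blast
  then show thesis using that v(1) m_comm by metis
qed

end

context von_Neumann_hyperring
begin

text \<open>
  If \<open>i = i\<^sup>2 b\<close>, then \<open>i b\<close> is idempotent with the same zeros as \<open>i\<close>, and \<open>e\<close> is an element of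
  \<open>1 - i b\<close> that is annihilated by \<open>i b\<close>.
\<close>

lemma complement_ex:
  assumes q: "q \<in> mr_spec A" and i: "i \<in> q"
  shows "\<exists>e \<in> carrier A. e \<notin> q \<and> i \<otimes> e = \<zero>"
proof -
  note I = specD(1)[OF q]
  have ic: "i \<in> carrier A" by (rule ideal_carrier[OF I i])
  obtain b where b: "b \<in> carrier A" "i = i \<otimes> i \<otimes> b" using von_Neumann[OF ic] by blast
  define \<epsilon> where "\<epsilon> = i \<otimes> b"
  have \<epsilon>: "\<epsilon> \<in> carrier A" "i \<otimes> \<epsilon> = i" unfolding \<epsilon>_def using ic b by (simp_all add: m_assoc)
  have "\<epsilon> \<otimes> \<epsilon> = (i \<otimes> \<epsilon>) \<otimes> b" using ic b(1) \<epsilon>(1) unfolding \<epsilon>_def by (simp add: m_ac)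
  then have idem: "\<epsilon> \<otimes> \<epsilon> = \<epsilon>" using \<epsilon>(2) unfolding \<epsilon>_def by simp
  have "\<zero> \<in> (\<one> \<otimes> \<epsilon>) \<boxplus> ((\<boxminus> \<epsilon>) \<otimes> \<epsilon>)"
    using zero_mem_diff[OF \<epsilon>(1)] \<epsilon>(1) idem by (simp add: hneg_mult_left)
  then obtain e where e: "e \<in> \<one> \<boxplus> (\<boxminus> \<epsilon>)" "\<zero> = e \<otimes> \<epsilon>"
    using hadd_mult_converse[OF one_closed hneg_closed[OF \<epsilon>(1)] \<epsilon>(1)] by blast
  have ec: "e \<in> carrier A" by (rule hadd_mem_carrier[OF e(1) one_closed hneg_closed[OF \<epsilon>(1)]])
  have "i \<otimes> e = (i \<otimes> \<epsilon>) \<otimes> e" using \<epsilon>(2) by simp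
  also have "\<dots> = i \<otimes> (e \<otimes> \<epsilon>)" using ic \<epsilon>(1) ec by (simp add: m_ac)
  also have "\<dots> = \<zero>" unfolding e(2)[symmetric] using ic by simp
  finally have "i \<otimes> e = \<zero>" .
  moreover have "e \<notin> q"
  proof
    assume "e \<in> q"
    moreover have "\<epsilon> \<in> q" unfolding \<epsilon>_def by (rule ideal_mult_right[OF I i b(1)])
    moreover have "\<one> \<in> e \<boxplus> \<epsilon>"
      using hadd_rev_right[OF e(1) one_closed hneg_closed[OF \<epsilon>(1)]] \<epsilon>(1) by simp
    ultimately show False using ideal_hadd[OF I] specD(2)[OF q] by blast
  qed
  ultimately show ?thesis using ec by blast
qed

text \<open>
  If \<open>b e = 0\<close> and \<open>e \<notin> q\<close>, then all primes in \<open>D(e)\<close> contain \<open>b\<close>. So the complement of \<open>D(b)\<close> is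
  a neighbourhood of \<open>q\<close> already in the spectral topology.
\<close>

lemma constructible_basic_open_base:
  assumes "openin (constructible_topology A) U" "q \<in> U" "q \<in> mr_spec A"
  shows "\<exists>t \<in> carrier A. q \<in> basic_open A t \<and> basic_open A t \<subseteq> U"
proof -
  have "generate_topology_on
      (basic_open A ` carrier A \<union> (\<lambda>a. mr_spec A - basic_open A a) ` carrier A) U"
    using assms(1) unfolding constructible_topology_def openin_topology_generated_by_iff .
  then show ?thesis using assms(2)
  proof induction
    case Empty
    then show ?case by simp
  next
    case (Int U1 U2)
    then obtain t1 t2 where t: "t1 \<in> carrier A" "q \<in> basic_open A t1" "basic_open A t1 \<subseteq> U1"
      "t2 \<in> carrier A" "q \<in> basic_open A t2" "basic_open A t2 \<subseteq> U2" by blast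
    show ?case
      by (rule bexI[of _ "t1 \<otimes> t2"], unfold basic_open_mult[OF t(1,4)]) (use t in blast, use t in simp)
  next
    case (UN \<U>)
    then obtain U' where U': "U' \<in> \<U>" "q \<in> U'" by blast
    then obtain t where "t \<in> carrier A" "q \<in> basic_open A t" "basic_open A t \<subseteq> U'" using UN.IH[of U'] by blast
    then show ?case using U'(1) by blast
  next
    case (Basis W)
    then consider a where "a \<in> carrier A" "W = basic_open A a"
      | b where "b \<in> carrier A" "W = mr_spec A - basic_open A b" by blast
    then show ?case
    proof cases
      case 1
      then show ?thesis using Basis(2) by blast
    next
      case 2
      then have "b \<in> q" using Basis(2) assms(3) unfolding basic_open_def by blast
      then obtain e where e: "e \<in> carrier A" "e \<notin> q" "b \<otimes> e = \<zero>" using complement_ex[OF assms(3)] by blast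
      have "b \<in> r" if "r \<in> mr_spec A" "e \<notin> r" for r
        using specD(3)[OF that(1), of b e] e that ideal_zero[OF specD(1)[OF that(1)]] 2(1) by auto
      then have "basic_open A e \<subseteq> W" unfolding 2(2) basic_open_def by blast
      then show ?thesis using e assms(3) unfolding basic_open_def by blast
    qed
  qed
qed

end

context geometric_von_Neumann_hyperring
begin

lemma sheaf_denoms_one_subset: "t \<in> carrier A \<Longrightarrow> sheaf_denoms A \<one> \<subseteq> sheaf_denoms A t"
  using sheaf_denoms_mult_subset[OF one_closed, of t] by simp

lemma basic_open_one: "basic_open A \<one> = mr_spec A"
  unfolding basic_open_def using specD(2) by blast

text \<open>
  An additive relation in the residue hyperfield at \<open>q\<close> holds in \<open>A\<close> up to some \<open>v \<notin> q\<close> and up to a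
  summand \<open>i \<in> q\<close>; multiplication by a complement of \<open>i\<close> removes the latter. So the relation holds on
  the members of a cover by basic open sets, and hence globally by the sheaf condition.
\<close>

theorem V_unit_reflects_hadd:
  assumes a: "a \<in> carrier A" and b: "b \<in> carrier A" and c: "c \<in> carrier A"
    and mem: "V_unit A a \<in> V_unit A b \<boxplus>\<^bsub>V_hull A\<^esub> V_unit A c"
  shows "a \<in> b \<boxplus> c"
proof -
  define T where "T = {t \<in> carrier A. a \<otimes> t \<in> (b \<otimes> t) \<boxplus> (c \<otimes> t)}"
  have TC: "(\<lambda>t. t) \<in> T \<rightarrow> carrier A" unfolding T_def by blast
  have "\<exists>t \<in> T. q \<in> basic_open A t" if q: "q \<in> mr_spec A" for q
  proof -
    note one = one_closed specD(2)[OF q]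
    have "residue_frac A q a \<one> \<in> residue_frac A q b \<one> \<boxplus>\<^bsub>residue_field A q\<^esub> residue_frac A q c \<one>"
      using V_haddD[OF mem q] a b c q by (simp add: V_unit_apply)
    then obtain v d i where v: "v \<in> carrier A - q" and d: "d \<in> (b \<otimes> v) \<boxplus> (c \<otimes> v)"
        and i: "i \<in> q" "a \<otimes> v \<in> d \<boxplus> i"
      unfolding residue_hadd_iff[OF q a one b one c one] using a b c by auto
    obtain e where e: "e \<in> carrier A" "e \<notin> q" "i \<otimes> e = \<zero>" using complement_ex[OF q i(1)] by blast
    have ic: "i \<in> carrier A" by (rule ideal_carrier[OF specD(1)[OF q] i(1)])
    have vc: "a \<otimes> v \<in> carrier A" "b \<otimes> v \<in> carrier A" "c \<otimes> v \<in> carrier A" "v \<in> carrier A" using a b c v by auto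
    have dc: "d \<in> carrier A" by (rule hadd_mem_carrier[OF d vc(2,3)])
    have "a \<otimes> v \<otimes> e \<in> (d \<otimes> e) \<boxplus> (i \<otimes> e)" by (rule hadd_mult[OF vc(1) dc ic e(1) i(2)])
    then have "a \<otimes> v \<otimes> e = d \<otimes> e" using e dc hadd_zero_right[of _ "d \<otimes> e"] by simp
    moreover have "d \<otimes> e \<in> (b \<otimes> v \<otimes> e) \<boxplus> (c \<otimes> v \<otimes> e)" by (rule hadd_mult[OF dc vc(2,3) e(1) d])
    ultimately have "a \<otimes> (v \<otimes> e) \<in> (b \<otimes> (v \<otimes> e)) \<boxplus> (c \<otimes> (v \<otimes> e))"
      using a b c vc(4) e(1) by (simp add: m_assoc)
    moreover have "v \<otimes> e \<in> carrier A - q" using spec_mult_notin[OF q v] e by blast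
    ultimately show ?thesis unfolding T_def basic_open_def using q by blast
  qed
  then have cover: "basic_open A \<one> = (\<Union>t \<in> T. basic_open A t)"
    unfolding basic_open_one by (auto simp: basic_open_def)
  interpret E: multiplicative_set A "sheaf_denoms A \<one>" by (rule sheaf_denoms_multiplicative[OF one_closed])
  let ?fr = "\<lambda>x. frac A (sheaf_denoms A \<one>) x \<one>"
  have frc: "?fr x \<in> carrier (structure_presheaf A \<one>)" if "x \<in> carrier A" for x
    unfolding structure_presheaf_def by (rule E.frac_carrierI[OF that E.one_S])
  have "?fr a \<in> ?fr b \<boxplus>\<^bsub>structure_presheaf A \<one>\<^esub> ?fr c"
  proof (rule sheaf_hadd[OF one_closed TC cover frc[OF a] frc[OF b] frc[OF c]])
    fix t assume t: "t \<in> T"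
    then have tc: "t \<in> carrier A" "a \<otimes> t \<in> (b \<otimes> t) \<boxplus> (c \<otimes> t)" unfolding T_def by blast+
    interpret D: multiplicative_set A "sheaf_denoms A t" by (rule sheaf_denoms_multiplicative[OF tc(1)])
    have r: "presheaf_restrict A t (?fr x) = frac A (sheaf_denoms A t) x \<one>" if "x \<in> carrier A" for x
      by (rule presheaf_restrict_frac[OF one_closed tc(1) sheaf_denoms_one_subset[OF tc(1)] that E.one_S])
    have "a \<otimes> \<one> \<otimes> \<one> \<otimes> t \<in> (b \<otimes> \<one> \<otimes> \<one> \<otimes> t) \<boxplus> (c \<otimes> \<one> \<otimes> \<one> \<otimes> t)" using tc(2) a b c by simp
    then show "presheaf_restrict A t (?fr a) \<in> presheaf_restrict A t (?fr b)
        \<boxplus>\<^bsub>structure_presheaf A t\<^esub> presheaf_restrict A t (?fr c)"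
      unfolding r[OF a] r[OF b] r[OF c] structure_presheaf_def
      using D.frac_hadd_iff[OF a D.one_S b D.one_S c D.one_S] sheaf_denoms_self[OF tc(1)] by blast
  qed
  then obtain v where v: "v \<in> sheaf_denoms A \<one>" "a \<otimes> v \<in> (b \<otimes> v) \<boxplus> (c \<otimes> v)"
    unfolding structure_presheaf_def E.frac_hadd_iff[OF a E.one_S b E.one_S c E.one_S] using a b c by auto
  obtain w where w: "v \<in> carrier A" "w \<in> carrier A" "v \<otimes> w = \<one>" using sheaf_denoms_one_unit[OF v(1)] .
  have "a \<otimes> v \<otimes> w \<in> (b \<otimes> v \<otimes> w) \<boxplus> (c \<otimes> v \<otimes> w)"
    by (rule hadd_mult[OF _ _ _ w(2) v(2)]) (use a b c w in simp_all)
  then show ?thesis using a b c w by (simp add: m_assoc)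
qed

lemma V_unit_inj: "inj_on (V_unit A) (carrier A)"
proof (rule inj_onI)
  fix a b assume a: "a \<in> carrier A" and b: "b \<in> carrier A" and e: "V_unit A a = V_unit A b"
  have "V_unit A b \<in> V_unit A b \<boxplus>\<^bsub>V_hull A\<^esub> V_unit A \<zero>"
    by (rule multiring_homD(2)[OF V_unit_hom mem_hadd_zero[OF b] b b hzero_closed])
  then have "a \<in> b \<boxplus> \<zero>" using V_unit_reflects_hadd[OF a b hzero_closed] e by simp
  then show "a = b" using hadd_zero_right b by blast
qed

lemma V_unit_mult: "\<lbrakk>a \<in> carrier A; b \<in> carrier A; q \<in> mr_spec A\<rbrakk>
    \<Longrightarrow> V_unit A (a \<otimes> b) q = V_unit A a q \<otimes>\<^bsub>residue_field A q\<^esub> V_unit A b q"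
  using multiring_homD(3)[OF V_unit_hom, of a b] by simp

text \<open>
  A fraction \<open>x/y\<close> equals \<open>x w/1\<close> for a weak inverse \<open>w\<close> of \<open>y\<close>, so a section is locally, on basic open
  sets, the image of an element. By injectivity these elements agree on overlaps, and they glue.
\<close>

theorem V_unit_surj: "V_unit A ` carrier A = constructible_sections A"
proof
  show "V_unit A ` carrier A \<subseteq> constructible_sections A" using V_unit_section by blast
  show "constructible_sections A \<subseteq> V_unit A ` carrier A"
  proof
    fix h assume h: "h \<in> constructible_sections A"
    define T where "T = {t \<in> carrier A. \<exists>b \<in> carrier A. \<forall>q \<in> basic_open A t. h q = V_unit A b q}"
    have TC: "(\<lambda>t. t) \<in> T \<rightarrow> carrier A" unfolding T_def by blast
    have "\<exists>t \<in> T. q \<in> basic_open A t" if q: "q \<in> mr_spec A" for q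
    proof -
      obtain x y where x: "x \<in> carrier A" "y \<in> carrier A" "y \<notin> q"
          "\<forall>\<^sub>F r in near A q. r \<in> mr_spec A \<and> y \<notin> r \<and> h r = residue_frac A r x y"
        using fraction_germE[OF section_germ[OF h q] q] .
      then obtain U where U: "openin (constructible_topology A) U" "q \<in> U"
          "\<forall>r \<in> U. r \<in> mr_spec A \<and> y \<notin> r \<and> h r = residue_frac A r x y"
        unfolding near_iff[OF q] by blast
      obtain t where t: "t \<in> carrier A" "q \<in> basic_open A t" "basic_open A t \<subseteq> U"
        using constructible_basic_open_base[OF U(1,2) q] by blast
      obtain w where w: "w \<in> carrier A" "y = y \<otimes> y \<otimes> w" using von_Neumann[OF x(2)] by blast
      have "h r = V_unit A (x \<otimes> w) r" if r: "r \<in> U" for r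
      proof -
        note rs = bspec[OF U(3) r]
        have yy: "y \<otimes> y \<in> carrier A" "y \<otimes> y \<notin> r" using spec_mult_notin[of r y y] rs x(2) by auto
        have "residue_frac A r x y = residue_frac A r (x \<otimes> y) (y \<otimes> y)"
          by (rule residue_frac_eqI) (use rs x yy in \<open>simp_all add: m_assoc\<close>)
        moreover have "(x \<otimes> w) \<otimes> (y \<otimes> y) = (x \<otimes> y) \<otimes> \<one>"
        proof -
          have "(x \<otimes> w) \<otimes> (y \<otimes> y) = x \<otimes> (y \<otimes> y \<otimes> w)" using x w(1) by (simp add: m_ac)
          then show ?thesis using w(2) x by simp
        qed
        then have "residue_frac A r (x \<otimes> w) \<one> = residue_frac A r (x \<otimes> y) (y \<otimes> y)"
          by (intro residue_frac_eqI) (use rs x w(1) yy specD(2)[of r A] in simp_all)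
        ultimately show ?thesis using rs V_unit_apply[of "x \<otimes> w" r] x w(1) by simp
      qed
      then have "t \<in> T" unfolding T_def using t x(1) w(1) by blast
      then show ?thesis using t(2) by blast
    qed
    then have cover: "basic_open A \<one> = (\<Union>t \<in> T. basic_open A t)"
      unfolding basic_open_one by (auto simp: basic_open_def)
    have "\<forall>t \<in> T. \<exists>b. b \<in> carrier A \<and> (\<forall>q \<in> basic_open A t. h q = V_unit A b q)"
      unfolding T_def by blast
    then obtain b where "\<forall>t \<in> T. b t \<in> carrier A \<and> (\<forall>q \<in> basic_open A t. h q = V_unit A (b t) q)"
      using bchoice by metis
    then have b: "\<And>t. t \<in> T \<Longrightarrow> b t \<in> carrier A"
        "\<And>t q. \<lbrakk>t \<in> T; q \<in> basic_open A t\<rbrakk> \<Longrightarrow> h q = V_unit A (b t) q" by blast+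
    have tc: "t \<in> carrier A" if "t \<in> T" for t using TC that by blast
    define x where "x t = frac A (sheaf_denoms A t) (b t) \<one>" for t
    have "\<exists>y \<in> carrier (structure_presheaf A \<one>). \<forall>t \<in> T. presheaf_restrict A t y = x t"
    proof (rule sheaf_glue[OF one_closed TC cover])
      fix t assume t: "t \<in> T"
      interpret D: multiplicative_set A "sheaf_denoms A t" by (rule sheaf_denoms_multiplicative[OF tc[OF t]])
      show "x t \<in> carrier (structure_presheaf A t)"
        unfolding x_def structure_presheaf_def by (rule D.frac_carrierI[OF b(1)[OF t] D.one_S])
    next
      fix t s assume t: "t \<in> T" and s: "s \<in> T"
      note cs = tc[OF t] tc[OF s] b(1)[OF t] b(1)[OF s]
      have ts: "t \<otimes> s \<in> carrier A" using cs by simp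
      interpret D: multiplicative_set A "sheaf_denoms A (t \<otimes> s)" by (rule sheaf_denoms_multiplicative[OF ts])
      interpret T: multiplicative_set A "sheaf_denoms A t" by (rule sheaf_denoms_multiplicative[OF cs(1)])
      interpret S: multiplicative_set A "sheaf_denoms A s" by (rule sheaf_denoms_multiplicative[OF cs(2)])
      have st: "sheaf_denoms A s \<subseteq> sheaf_denoms A (t \<otimes> s)"
        using sheaf_denoms_mult_subset[OF cs(2,1)] m_comm[OF cs(1,2)] by simp
      have "V_unit A (b t \<otimes> (t \<otimes> s)) = V_unit A (b s \<otimes> (t \<otimes> s))"
      proof (rule section_ext)
        fix q assume q: "q \<in> mr_spec A"
        interpret R: multiring "residue_field A q" by (rule multiring_residue_field[OF q])
        show "V_unit A (b t \<otimes> (t \<otimes> s)) q = V_unit A (b s \<otimes> (t \<otimes> s)) q"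
        proof (cases "t \<otimes> s \<in> q")
          case True
          then have "V_unit A (t \<otimes> s) q = \<zero>\<^bsub>residue_field A q\<^esub>" using V_unit_eq_zero_iff[OF ts q] by blast
          then show ?thesis
            using V_unit_mult[OF cs(3) ts q] V_unit_mult[OF cs(4) ts q]
              section_value[OF V_unit_section[OF cs(3)] q] section_value[OF V_unit_section[OF cs(4)] q] by simp
        next
          case False
          then have "q \<in> basic_open A t" "q \<in> basic_open A s"
            unfolding basic_open_def using q spec_mult_iff[OF q cs(1,2)] by blast+
          then have "V_unit A (b t) q = V_unit A (b s) q" using b(2)[OF t] b(2)[OF s] by metis
          then show ?thesis using V_unit_mult[OF cs(3) ts q] V_unit_mult[OF cs(4) ts q] by simp
        qed
      qed (intro V_unit_section m_closed cs ts)+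
      then have "b t \<otimes> (t \<otimes> s) = b s \<otimes> (t \<otimes> s)"
        using inj_onD[OF V_unit_inj] cs ts by simp
      then have "b t \<otimes> \<one> \<otimes> (t \<otimes> s) = b s \<otimes> \<one> \<otimes> (t \<otimes> s)" using cs by simp
      then show "presheaf_restrict A (t \<otimes> s) (x t) = presheaf_restrict A (t \<otimes> s) (x s)"
        unfolding x_def presheaf_restrict_frac[OF cs(1) ts sheaf_denoms_mult_subset[OF cs(1,2)] cs(3) T.one_S]
          presheaf_restrict_frac[OF cs(2) ts st cs(4) S.one_S]
        using D.frac_eq_iff[OF cs(3) D.one_S cs(4) D.one_S] sheaf_denoms_self[OF ts] by blast
    qed
    then obtain y where y: "y \<in> carrier (structure_presheaf A \<one>)" "\<And>t. t \<in> T \<Longrightarrow> presheaf_restrict A t y = x t"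
      by blast
    interpret E: multiplicative_set A "sheaf_denoms A \<one>" by (rule sheaf_denoms_multiplicative[OF one_closed])
    obtain c s where c: "c \<in> carrier A" "s \<in> sheaf_denoms A \<one>" "y = frac A (sheaf_denoms A \<one>) c s"
      using y(1) unfolding structure_presheaf_def E.fractions_carrier by blast
    obtain w where w: "s \<in> carrier A" "w \<in> carrier A" "s \<otimes> w = \<one>" using sheaf_denoms_one_unit[OF c(2)] .
    have "V_unit A (c \<otimes> w) = h"
    proof (rule section_ext)
      fix q assume q: "q \<in> mr_spec A"
      interpret R: hyperfield "residue_field A q" by (rule hyperfield_residue_field[OF q])
      obtain t where t: "t \<in> T" "q \<in> basic_open A t" using cover q unfolding basic_open_one by blast
      interpret D: multiplicative_set A "sheaf_denoms A t" by (rule sheaf_denoms_multiplicative[OF tc[OF t(1)]])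
      have sub: "sheaf_denoms A \<one> \<subseteq> sheaf_denoms A t" by (rule sheaf_denoms_one_subset[OF tc[OF t(1)]])
      have "frac A (sheaf_denoms A t) c s = frac A (sheaf_denoms A t) (b t) \<one>"
        using y(2)[OF t(1)]
        unfolding c(3) x_def presheaf_restrict_frac[OF one_closed tc[OF t(1)] sub c(1,2)] .
      then obtain u where u: "u \<in> sheaf_denoms A t" "c \<otimes> \<one> \<otimes> u = b t \<otimes> s \<otimes> u"
        using D.frac_eq_iff[OF c(1) subsetD[OF sub c(2)] b(1)[OF t(1)] D.one_S] by blast
      have uc: "u \<in> carrier A" by (rule D.S_closed[OF u(1)])
      have "u \<notin> q"
        using sheaf_denoms_notin[OF q tc[OF t(1)] _ u(1)] t(2) unfolding basic_open_def by blast
      then have nz: "V_unit A u q \<noteq> \<zero>\<^bsub>residue_field A q\<^esub>" using V_unit_eq_zero_iff[OF uc q] by blast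
      note bt = b(1)[OF t(1)]
      note val = c(1)[THEN V_unit_section, THEN section_value, OF q] w(1)[THEN V_unit_section, THEN section_value, OF q]
        w(2)[THEN V_unit_section, THEN section_value, OF q] bt[THEN V_unit_section, THEN section_value, OF q]
        uc[THEN V_unit_section, THEN section_value, OF q]
      have "V_unit A (u \<otimes> c) q = V_unit A (u \<otimes> (b t \<otimes> s)) q"
        using u(2) c(1) uc bt w(1) by (simp add: m_comm)
      then have "V_unit A u q \<otimes>\<^bsub>residue_field A q\<^esub> V_unit A c q =
          V_unit A u q \<otimes>\<^bsub>residue_field A q\<^esub> (V_unit A (b t) q \<otimes>\<^bsub>residue_field A q\<^esub> V_unit A s q)"
        using V_unit_mult[OF uc c(1) q] V_unit_mult[OF uc m_closed[OF bt w(1)] q] V_unit_mult[OF bt w(1) q] by simp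
      then have cb: "V_unit A c q = V_unit A (b t) q \<otimes>\<^bsub>residue_field A q\<^esub> V_unit A s q"
        by (rule R.hyperfield_cancel) (use val nz in simp_all)
      have one: "V_unit A s q \<otimes>\<^bsub>residue_field A q\<^esub> V_unit A w q = \<one>\<^bsub>residue_field A q\<^esub>"
        using V_unit_mult[OF w(1,2) q] w(3) multiring_homD(6)[OF V_unit_hom] V_one[OF q] by simp
      have "V_unit A (c \<otimes> w) q = V_unit A (b t) q"
        using V_unit_mult[OF c(1) w(2) q] cb one val by (simp add: R.m_assoc)
      then show "V_unit A (c \<otimes> w) q = h q" using b(2)[OF t] by simp
    qed (use V_unit_section c(1) w(2) h in simp_all)
    then show "h \<in> V_unit A ` carrier A" using c(1) w(2) by blast
  qed
qed

lemma V_unit_inverse_hom: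
  "(\<lambda>h \<in> constructible_sections A. the_inv_into (carrier A) (V_unit A) h) \<in> multiring_hom (V_hull A) A"
proof -
  let ?r = "\<lambda>h \<in> constructible_sections A. the_inv_into (carrier A) (V_unit A) h"
  have rv: "?r (V_unit A a) = a" if "a \<in> carrier A" for a
    using the_inv_into_f_f[OF V_unit_inj that] V_unit_section[OF that] by simp
  have ex: "\<exists>a \<in> carrier A. h = V_unit A a" if "h \<in> constructible_sections A" for h
    using that V_unit_surj by blast
  note vD = multiring_homD[OF V_unit_hom]
  show ?thesis
  proof (rule multiring_homI; (unfold V_carrier)?)
    show "?r \<in> extensional (constructible_sections A)" by simp
    fix h assume "h \<in> constructible_sections A"
    then obtain a where a: "a \<in> carrier A" "h = V_unit A a" using ex by blast
    show "?r h \<in> carrier A" unfolding a(2) rv[OF a(1)] by (rule a(1))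
    show "?r (\<boxminus>\<^bsub>V_hull A\<^esub> h) = \<boxminus> ?r h"
      unfolding a(2) rv[OF a(1)] vD(4)[OF a(1), symmetric] by (rule rv[OF hneg_closed[OF a(1)]])
    fix g assume "g \<in> constructible_sections A"
    then obtain b where b: "b \<in> carrier A" "g = V_unit A b" using ex by blast
    show "?r (h \<otimes>\<^bsub>V_hull A\<^esub> g) = ?r h \<otimes> ?r g"
      unfolding a(2) b(2) rv[OF a(1)] rv[OF b(1)] vD(3)[OF a(1) b(1), symmetric]
      by (rule rv[OF m_closed[OF a(1) b(1)]])
    fix k assume k: "k \<in> constructible_sections A" "h \<in> g \<boxplus>\<^bsub>V_hull A\<^esub> k"
    then obtain c where c: "c \<in> carrier A" "k = V_unit A c" using ex by blast
    show "?r h \<in> ?r g \<boxplus> ?r k"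
      using V_unit_reflects_hadd[OF a(1) b(1) c(1)] k(2)
      unfolding a(2) b(2) c(2) rv[OF a(1)] rv[OF b(1)] rv[OF c(1)] .
  next
    show "?r \<zero>\<^bsub>V_hull A\<^esub> = \<zero>" using rv[OF hzero_closed] unfolding vD(5) .
    show "?r \<one>\<^bsub>V_hull A\<^esub> = \<one>" using rv[OF one_closed] unfolding vD(6) .
  qed
qed

end

text \<open>
  The canonical morphism of \<open>B\<close> is an isomorphism onto the hull of \<open>B\<close>. Composed with it, a morphism from the
  hull of \<open>A\<close> to \<open>B\<close> becomes one between hulls, for which existence and uniqueness are known.
\<close>

theorem V_hull_universal:
  assumes A: "multiring A" and B: "geometric_von_Neumann_hyperring B" and f: "f \<in> multiring_hom A B"
  shows "\<exists>!g. g \<in> multiring_hom (V_hull A) B \<and> compose (carrier A) g (V_unit A) = f"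
proof -
  interpret A: multiring A by (rule A)
  interpret B: geometric_von_Neumann_hyperring B by (rule B)
  note mB = B.multiring_axioms
  let ?r = "\<lambda>h \<in> constructible_sections B. the_inv_into (carrier B) (V_unit B) h"
  let ?g = "compose (carrier (V_hull A)) ?r (V_map A B f)"
  have g: "?g \<in> multiring_hom (V_hull A) B"
    by (rule multiring_hom_compose[OF A.multiring_V_hull V_map_hom[OF A mB f] B.V_unit_inverse_hom])
  have "compose (carrier A) ?g (V_unit A) a = f a" if a: "a \<in> carrier A" for a
    using a A.V_unit_section[OF a] V_map_unit[OF A mB f a] B.V_unit_section[OF multiring_homD(1)[OF f a]]
      the_inv_into_f_f[OF B.V_unit_inj multiring_homD(1)[OF f a]] by (simp add: compose_eq)
  then have gf: "compose (carrier A) ?g (V_unit A) = f"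
    by (intro extensionalityI[OF compose_extensional multiring_homD(7)[OF f]])
  show ?thesis
  proof (rule ex1I[of _ ?g])
    show "?g \<in> multiring_hom (V_hull A) B \<and> compose (carrier A) ?g (V_unit A) = f" using g gf by blast
    fix k assume k: "k \<in> multiring_hom (V_hull A) B \<and> compose (carrier A) k (V_unit A) = f"
    have eq: "compose (carrier (V_hull A)) (V_unit B) k = compose (carrier (V_hull A)) (V_unit B) ?g"
    proof (rule hom_between_V_hulls_determined[OF A mB])
      show "compose (carrier (V_hull A)) (V_unit B) k \<in> multiring_hom (V_hull A) (V_hull B)"
        "compose (carrier (V_hull A)) (V_unit B) ?g \<in> multiring_hom (V_hull A) (V_hull B)"
        using multiring_hom_compose[OF A.multiring_V_hull _ B.V_unit_hom] k g by blast+
      fix a assume a: "a \<in> carrier A"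
      have "k (V_unit A a) = ?g (V_unit A a)" using k gf a by (metis compose_eq)
      then show "compose (carrier (V_hull A)) (V_unit B) k (V_unit A a) =
          compose (carrier (V_hull A)) (V_unit B) ?g (V_unit A a)"
        using A.V_unit_section[OF a] by (simp only: compose_eq V_carrier)
    qed
    show "k = ?g"
    proof (rule multiring_hom_eqI[OF conjunct1[OF k] g])
      fix h assume h: "h \<in> carrier (V_hull A)"
      have "V_unit B (k h) = V_unit B (?g h)" using fun_cong[OF eq, of h] h by (simp only: compose_eq)
      then show "k h = ?g h"
        using inj_onD[OF B.V_unit_inj] multiring_homD(1)[OF conjunct1[OF k] h] multiring_homD(1)[OF g h] by blast
    qed
  qed
qed

theorem theorem4p8:
  fixes A :: "'a multiring" and B :: "'b multiring"
  assumes "multiring A" and "multiring B"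
  shows
    "\<comment> \<open>existence and uniqueness of \<open>V(f)\<close>\<close>
     (\<forall>f \<in> multiring_hom A B. \<exists>!g. g \<in> multiring_hom (V_hull A) (V_hull B) \<and>
       compose (carrier A) g (V_unit A) = compose (carrier A) (V_unit B) f) \<and>
     \<comment> \<open>\<open>V\<close> is a functor from multirings to geometric von Neumann hyperrings\<close>
     geometric_von_Neumann_hyperring (V_hull A) \<and>
     (\<forall>f \<in> multiring_hom A B. V_map A B f \<in> multiring_hom (V_hull A) (V_hull B)) \<and>
     V_map A A (\<lambda>a \<in> carrier A. a) = (\<lambda>x \<in> carrier (V_hull A). x) \<and>
     (\<forall>C :: 'c multiring. multiring C \<longrightarrow>
       (\<forall>f \<in> multiring_hom A B. \<forall>g \<in> multiring_hom B C.
          V_map A C (compose (carrier A) g f) =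
            compose (carrier (V_hull A)) (V_map B C g) (V_map A B f))) \<and>
     (geometric_von_Neumann_hyperring B \<longrightarrow>
       \<comment> \<open>universal property of \<open>v\<^sub>A\<close>\<close>
       (\<forall>f \<in> multiring_hom A B.
          \<exists>!g. g \<in> multiring_hom (V_hull A) B \<and> compose (carrier A) g (V_unit A) = f) \<and>
       \<comment> \<open>\<open>V\<close> is left adjoint to the inclusion: \<open>g \<mapsto> g \<circ> v\<^sub>A\<close> is a bijection from
         \<open>Hom(V(A), B)\<close> to \<open>Hom(A, B)\<close>, natural in \<open>A\<close> and in \<open>B\<close>\<close>
       bij_betw (\<lambda>g. compose (carrier A) g (V_unit A))
         (multiring_hom (V_hull A) B) (multiring_hom A B) \<and>
       (\<forall>C :: 'c multiring. multiring C \<longrightarrow>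
          (\<forall>h \<in> multiring_hom C A. \<forall>g \<in> multiring_hom (V_hull A) B.
             compose (carrier C) (compose (carrier (V_hull C)) g (V_map C A h)) (V_unit C) =
               compose (carrier C) (compose (carrier A) g (V_unit A)) h)) \<and>
       (\<forall>D :: 'd multiring. geometric_von_Neumann_hyperring D \<longrightarrow>
          (\<forall>k \<in> multiring_hom B D. \<forall>g \<in> multiring_hom (V_hull A) B.
             compose (carrier A) (compose (carrier (V_hull A)) k g) (V_unit A) =
               compose (carrier A) k (compose (carrier A) g (V_unit A)))))"
proof -
  note A = assms(1) and B = assms(2)
  have sec: "V_unit C a \<in> carrier (V_hull C)" if "multiring C" "a \<in> carrier C" for C :: "'e multiring" and a
    using multiring.V_unit_section[OF that] by simp
  have univ: "\<forall>f \<in> multiring_hom A B.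
      \<exists>!g. g \<in> multiring_hom (V_hull A) B \<and> compose (carrier A) g (V_unit A) = f"
    if "geometric_von_Neumann_hyperring B"
    using V_hull_universal[OF A that] by blast
  have bij: "bij_betw (\<lambda>g. compose (carrier A) g (V_unit A)) (multiring_hom (V_hull A) B) (multiring_hom A B)"
    if "geometric_von_Neumann_hyperring B"
    unfolding bij_betw_def
  proof (intro conjI inj_onI Set.set_eqI iffI)
    have restr: "compose (carrier A) g (V_unit A) \<in> multiring_hom A B" if "g \<in> multiring_hom (V_hull A) B" for g
      by (rule multiring_hom_compose[OF A multiring.V_unit_hom[OF A] that])
    show "g = g'" if "g \<in> multiring_hom (V_hull A) B" "g' \<in> multiring_hom (V_hull A) B"
        "compose (carrier A) g (V_unit A) = compose (carrier A) g' (V_unit A)" for g g'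
      using univ[OF \<open>geometric_von_Neumann_hyperring B\<close>] restr[OF that(2)] that by metis
    show "f \<in> multiring_hom A B" if "f \<in> (\<lambda>g. compose (carrier A) g (V_unit A)) ` multiring_hom (V_hull A) B" for f
      using that restr by blast
    show "f \<in> (\<lambda>g. compose (carrier A) g (V_unit A)) ` multiring_hom (V_hull A) B" if "f \<in> multiring_hom A B" for f
      using univ[OF \<open>geometric_von_Neumann_hyperring B\<close>] that by blast
  qed
  have nat_source: "compose (carrier C) (compose (carrier (V_hull C)) g (V_map C A h)) (V_unit C) =
      compose (carrier C) (compose (carrier A) g (V_unit A)) h"
    if C: "multiring C" and h: "h \<in> multiring_hom C A" for C :: "'c multiring" and g :: "_ \<Rightarrow> 'b" and h
    unfolding compose_def[of "carrier C"]
    by (rule restrict_ext) (simp add: compose_eq sec[OF C] V_map_unit[OF C A h] multiring_homD(1)[OF h] del: V_carrier)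
  have nat_target: "compose (carrier A) (compose (carrier (V_hull A)) k g) (V_unit A) =
      compose (carrier A) k (compose (carrier A) g (V_unit A))" for g :: "_ \<Rightarrow> 'b" and k :: "'b \<Rightarrow> 'd"
    unfolding compose_def[of "carrier A"]
    by (rule restrict_ext) (simp add: compose_eq sec[OF A] del: V_carrier)
  show ?thesis
    by (intro conjI ballI allI impI V_map_exists_unique[OF A B] multiring.geometric_V_hull[OF A]
        V_map_hom[OF A B] V_map_identity[OF A] V_map_compose[OF A B] univ[rule_format] bij
        nat_source nat_target) assumption+
qed

end
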